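(* Let $\mathcal A,\mathcal B$ be unital $C^*$-algebras and let $\phi_i\in\mathrm{UCP}(\mathcal A,\mathcal B)$ for $i=1,2$. Then there is a 1-1 correspondence between the set of minimal joint representation modules of $(\phi_1,\phi_2)$ (modulo isomorphism) and the set of maps in $K(\phi_1,\phi_2)$.
   Context: $\mathrm{UCP}(\mathcal A,\mathcal B)$ is the set of unital completely positive maps $\mathcal A\to\mathcal B$. For a Hilbert (right) $\mathcal B$-module $\mathcal E$, $\mathbf B^a(\mathcal E)$ is the $C^*$-algebra of bounded adjointable maps on $\mathcal E$; inner products are linear in the second variable. A joint representation module (tuple) for $(\phi_1,\phi_2)$ is $(\mathcal E,\sigma_1,\sigma_2,x)$ with $\mathcal E$ a Hilbert $\mathcal B$-module, $\sigma_1,\sigma_2:\mathcal A\to\mathbf B^a(\mathcal E)$ unital $*$-homomorphisms (left actions of $\mathcal A$), and $x\in\mathcal E$ a unit vector (that is, $\langle x,x\rangle=1$) such that $\phi_i(a)=\langle x,\sigma_i(a)x\rangle$ for all $a\in\mathcal A$, $i=1,2$. It is minimal if $\mathcal E$ is the closed linear span of all elements $\sigma_{\epsilon_1}(a_1)\cdots\sigma_{\epsilon_k}(a_k)xb$ with $k\ge1$, $\epsilon_j\in\{1,2\}$, $a_j\in\mathcal A$, $b\in\mathcal B$. Isomorphism of such tuples has its usual meaning: a right $\mathcal B$-linear unitary between the modules that intertwines the respective left actions and carries the distinguished vector to the distinguished vector. $\mathcal A*\mathcal A$ is the full free product (as unital $C^*$-algebras) of $\mathcal A$ with itself, with canonical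 injections $\rho_1,\rho_2:\mathcal A\to\mathcal A*\mathcal A$; and $$K(\phi_1,\phi_2)=\{\phi\in\mathrm{UCP}(\mathcal A*\mathcal A,\mathcal B):\ \phi\circ\rho_1=\phi_1,\ \phi\circ\rho_2=\phi_2\}.$$ *)

theory Defs
  imports "HOL-Analysis.Analysis" "HOL-Library.Poly_Mapping"
begin

section \<open>Unital C*-algebras\<close>

text \<open>Based on \<^class>\<open>monoid_mult\<close> rather than \<^class>\<open>real_normed_algebra_1\<close>, so that the
  zero algebra is not excluded.\<close>

class cstar_algebra = real_normed_algebra + banach + monoid_mult +
  fixes scaleC :: "complex \<Rightarrow> 'a \<Rightarrow> 'a" (infixr \<open>*\<^sub>C\<close> 75)
    and star :: "'a \<Rightarrow> 'a"
  assumes scaleC_add_right: "c *\<^sub>C (x + y) = c *\<^sub>C x + c *\<^sub>C y"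
    and scaleC_add_left: "(c + d) *\<^sub>C x = c *\<^sub>C x + d *\<^sub>C x"
    and scaleC_scaleC: "c *\<^sub>C d *\<^sub>C x = (c * d) *\<^sub>C x"
    and scaleR_scaleC: "r *\<^sub>R x = complex_of_real r *\<^sub>C x"
    and mult_scaleC_left: "(c *\<^sub>C x) * y = c *\<^sub>C (x * y)"
    and mult_scaleC_right: "x * (c *\<^sub>C y) = c *\<^sub>C (x * y)"
    and norm_scaleC: "norm (c *\<^sub>C x) = cmod c * norm x"
    and star_add: "star (x + y) = star x + star y"
    and star_scaleC: "star (c *\<^sub>C x) = cnj c *\<^sub>C star x"
    and star_mult: "star (x * y) = star y * star x"
    and star_star: "star (star x) = x"
    and norm_star_mult: "norm (star x * x) = (norm x)\<^sup>2"

definition clinear_map :: "('a::cstar_algebra \<Rightarrow> 'b::cstar_algebra) \<Rightarrow> bool" where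
  "clinear_map \<phi> \<longleftrightarrow>
     (\<forall>x y. \<phi> (x + y) = \<phi> x + \<phi> y) \<and> (\<forall>c x. \<phi> (c *\<^sub>C x) = c *\<^sub>C \<phi> x)"

definition unital_star_hom :: "('a::cstar_algebra \<Rightarrow> 'b::cstar_algebra) \<Rightarrow> bool" where
  "unital_star_hom \<pi> \<longleftrightarrow> clinear_map \<pi> \<and> \<pi> 1 = 1 \<and>
     (\<forall>x y. \<pi> (x * y) = \<pi> x * \<pi> y) \<and> (\<forall>x. \<pi> (star x) = star (\<pi> x))"

lemma scaleC_one [simp]: "1 *\<^sub>C (x::'a::cstar_algebra) = x"
  using scaleR_scaleC[of 1 x] by simp

lemma scaleC_zero [simp]: "0 *\<^sub>C (x::'a::cstar_algebra) = 0"
  using scaleR_scaleC[of 0 x] by simp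

lemma scaleC_minus_one: "(-1) *\<^sub>C (x::'a::cstar_algebra) = - x"
  using scaleR_scaleC[of "-1" x] by simp

lemma star_zero [simp]: "star (0::'a::cstar_algebra) = 0"
  using star_scaleC[of 0 "0::'a"] by simp

lemma star_one [simp]: "star (1::'a::cstar_algebra) = 1"
  by (metis mult_1_right mult_1_left star_mult star_star)

lemma star_minus: "star (- x) = - star (x::'a::cstar_algebra)"
  by (metis scaleC_minus_one star_scaleC complex_cnj_minus complex_cnj_one)

lemma star_diff: "star (x - y) = star x - star (y::'a::cstar_algebra)"
  by (metis add_uminus_conv_diff star_add star_minus)

lemma star_scaleR: "star (r *\<^sub>R x) = r *\<^sub>R star (x::'a::cstar_algebra)"
  by (simp add: scaleR_scaleC star_scaleC)

lemma norm_star [simp]: "norm (star x) = norm (x::'a::cstar_algebra)"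
proof -
  have le: "norm y \<le> norm (star y)" for y :: 'a
  proof (cases "norm y = 0")
    case False
    have "norm y * norm y \<le> norm (star y) * norm y"
      using norm_star_mult[of y] norm_mult_ineq[of "star y" y] by (simp add: power2_eq_square)
    then show ?thesis using False by simp
  qed simp
  show ?thesis using le[of x] le[of "star x"] by (simp add: star_star)
qed

lemma bounded_linear_star: "bounded_linear (star :: 'a::cstar_algebra \<Rightarrow> 'a)"
  by (rule bounded_linear_intro[where K = 1]) (simp_all add: star_add star_scaleR)

text \<open>Square roots of \<open>1 - x\<close> by the binomial series; they give contractivity of star
  homomorphisms.\<close>

lemma sqrt_one_minus:
  fixes x :: "'a::cstar_algebra"
  assumes "norm x < 1" "star x = x"
  obtains c where "star c = c" "c * c = 1 - x"
    "\<And>y. y * x = x * y \<Longrightarrow> y * c = c * y"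
proof -
  define a :: "nat \<Rightarrow> real" where "a n = (1/2 gchoose n) * (-1) ^ n" for n
  have rad: "summable (\<lambda>n. norm (a n) * r ^ n)" if "0 \<le> r" "r < 1" for r :: real
  proof -
    have "conv_radius (\<lambda>n. (1/2::real) gchoose n) \<ge> 1"
      by (subst conv_radius_gchoose) auto
    then have "summable (\<lambda>n. norm (((1/2::real) gchoose n) * r ^ n))"
      by (intro abs_summable_in_conv_radius) (use that in \<open>auto intro: less_le_trans[of _ 1]\<close>)
    moreover have "norm (((1/2::real) gchoose n) * r ^ n) = norm (a n) * r ^ n" for n
      using that by (simp add: a_def abs_mult power_abs)
    ultimately show ?thesis by simp
  qed
  have np: "norm (x ^ Suc n) \<le> norm x ^ Suc n" for n
  proof (induction n)
    case (Suc n)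
    have "norm (x ^ Suc (Suc n)) \<le> norm x * norm (x ^ Suc n)"
      unfolding power_Suc[of x "Suc n"] by (rule norm_mult_ineq)
    also have "\<dots> \<le> norm x * norm x ^ Suc n"
      by (rule mult_left_mono[OF Suc]) simp
    finally show ?case by simp
  qed simp
  define f where "f n = a n *\<^sub>R x ^ n" for n
  have absf: "summable (\<lambda>n. norm (f n))"
  proof -
    have "summable (\<lambda>n. norm (f (Suc n)))"
    proof (rule summable_comparison_test)
      show "summable (\<lambda>n. norm (a (Suc n)) * norm x ^ Suc n)"
        using rad[of "norm x"] assms(1)
        by (subst summable_Suc_iff[of "\<lambda>n. norm (a n) * norm x ^ n"]) simp
      show "\<exists>N. \<forall>n\<ge>N. norm (norm (f (Suc n))) \<le> norm (a (Suc n)) * norm x ^ Suc n"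
        using np by (auto simp: f_def mult_left_mono simp del: power_Suc)
    qed
    then show ?thesis using summable_Suc_iff[of "\<lambda>n. norm (f n)"] by blast
  qed
  have sf: "summable f" using absf by (rule summable_norm_cancel)
  define c where "c = suminf f"
  have starf: "star (f n) = f n" for n
  proof -
    have "star (x ^ n) = x ^ n"
      by (induction n) (simp_all add: star_mult assms(2) power_commutes)
    then show ?thesis by (simp add: f_def star_scaleR)
  qed
  have st_c: "star c = c"
    unfolding c_def using bounded_linear.suminf[OF bounded_linear_star sf] starf by simp
  have comm: "y * c = c * y" if "y * x = x * y" for y
  proof -
    have "y * x ^ n = x ^ n * y" for n
      by (induction n) (simp_all, metis mult.assoc that)
    then have "y * f n = f n * y" for n by (simp add: f_def)
    moreover have "y * c = suminf (\<lambda>n. y * f n)"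
      unfolding c_def by (rule bounded_linear.suminf[OF bounded_linear_mult_right sf])
    moreover have "c * y = suminf (\<lambda>n. f n * y)"
      unfolding c_def by (rule bounded_linear.suminf[OF bounded_linear_mult_left sf])
    ultimately show ?thesis by simp
  qed
  have "c * c = 1 - x"
  proof -
    have "(\<lambda>k. \<Sum>i\<le>k. f i * f (k - i)) sums (c * c)"
      unfolding c_def by (rule Cauchy_product_sums[OF absf absf])
    moreover have "(\<Sum>i\<le>k. f i * f (k - i)) = ((1 gchoose k) * (-1) ^ k) *\<^sub>R x ^ k" for k
    proof -
      have "(\<Sum>i\<le>k. f i * f (k - i)) =
          (\<Sum>i\<le>k. (((1/2 gchoose i) * (1/2 gchoose (k - i))) * (-1) ^ k) *\<^sub>R x ^ k)"
      proof (rule sum.cong)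
        fix i assume "i \<in> {..k}"
        then have k: "i + (k - i) = k" by simp
        have p: "(-1::real) ^ k = (-1) ^ i * (-1) ^ (k - i)"
          unfolding power_add[symmetric] k by (rule refl)
        have "f i * f (k - i) = (a i * a (k - i)) *\<^sub>R x ^ k"
          unfolding f_def by (subst (3) k[symmetric], subst power_add) simp
        also have "a i * a (k - i) = ((1/2 gchoose i) * (1/2 gchoose (k - i))) * (-1) ^ k"
          unfolding a_def by (simp only: p mult_ac)
        finally show "f i * f (k - i) = (((1/2 gchoose i) * (1/2 gchoose (k - i))) * (-1) ^ k) *\<^sub>R x ^ k" .
      qed simp
      also have "\<dots> = ((\<Sum>i\<le>k. (1/2 gchoose i) * (1/2 gchoose (k - i))) * (-1) ^ k) *\<^sub>R x ^ k"
        by (simp add: scaleR_left.sum sum_distrib_right)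
      also have "(\<Sum>i\<le>k. ((1/2::real) gchoose i) * (1/2 gchoose (k - i))) = (1 gchoose k)"
        using gbinomial_Vandermonde[of "1/2::real" "1/2" k] by (simp add: atMost_atLeast0)
      finally show ?thesis .
    qed
    ultimately have s1: "(\<lambda>k. ((1 gchoose k) * (-1) ^ k) *\<^sub>R x ^ k) sums (c * c)"
      by (simp only:)
    have "(\<lambda>k. ((1 gchoose k) * (-1) ^ k) *\<^sub>R x ^ k) sums
        (\<Sum>k<2. ((1 gchoose k) * (-1) ^ k :: real) *\<^sub>R x ^ k)"
    proof (rule sums_finite)
      fix k :: nat assume "k \<notin> {..<2}"
      then have "(1::real) gchoose k = 0"
        using binomial_gbinomial[of 1 k, where ?'a = real] by (simp add: binomial_eq_0)
      then show "((1 gchoose k) * (-1) ^ k :: real) *\<^sub>R x ^ k = 0" by simp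
    qed simp
    also have "(\<Sum>k<2. ((1 gchoose k) * (-1) ^ k :: real) *\<^sub>R x ^ k) = 1 - x"
      by (simp add: numeral_2_eq_2)
    finally show ?thesis by (rule sums_unique2[OF s1])
  qed
  with st_c show thesis using comm by (rule that)
qed

definition cstar_seminorm ::
  "(complex \<Rightarrow> 'f \<Rightarrow> 'f) \<Rightarrow> ('f \<Rightarrow> 'f) \<Rightarrow> ('f::ring \<Rightarrow> real) \<Rightarrow> bool" where
  "cstar_seminorm sc st q \<longleftrightarrow>
     (\<forall>x y. q (x + y) \<le> q x + q y) \<and> (\<forall>c x. q (sc c x) = cmod c * q x) \<and>
     (\<forall>x y. q (x * y) \<le> q x * q y) \<and> (\<forall>x. q (st x * x) = (q x)\<^sup>2)"

lemma cstar_seminorm_norm: "cstar_seminorm scaleC star (norm :: 'a::cstar_algebra \<Rightarrow> real)"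
  by (simp add: cstar_seminorm_def norm_triangle_ineq norm_scaleC norm_mult_ineq norm_star_mult)

locale star_alg =
  fixes sc :: "complex \<Rightarrow> 'f::{ring, monoid_mult} \<Rightarrow> 'f" and st :: "'f \<Rightarrow> 'f"
  assumes sc_add: "sc c (x + y) = sc c x + sc c y"
    and sc_add_left: "sc (c + d) x = sc c x + sc d x"
    and sc_sc: "sc c (sc d x) = sc (c * d) x"
    and sc_one: "sc 1 x = x"
    and sc_mult_left: "sc c x * y = sc c (x * y)"
    and sc_mult_right: "x * sc c y = sc c (x * y)"
    and st_add: "st (x + y) = st x + st y"
    and st_sc: "st (sc c x) = sc (cnj c) (st x)"
    and st_mult: "st (x * y) = st y * st x"
    and st_st: "st (st x) = x"
begin

lemma sc_zero: "sc 0 x = 0"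
  using sc_add_left[of 0 0 x] by simp

lemma sc_minus: "sc (-1) x = - x"
  using sc_add_left[of 1 "-1" x] by (simp add: sc_one sc_zero eq_neg_iff_add_eq_0 add.commute)

lemma sc_diff: "sc c (x - y) = sc c x - sc c y"
  by (metis add_diff_cancel_right' diff_add_cancel sc_add)

lemma st_minus: "st (- x) = - st x"
  by (metis sc_minus st_sc complex_cnj_minus complex_cnj_one)

lemma st_diff: "st (x - y) = st x - st y"
  by (metis add_uminus_conv_diff st_add st_minus)

lemma st_zero: "st 0 = 0"
  using st_add[of 0 0] by simp

lemma st_one: "st 1 = 1"
  by (metis mult_1_right mult_1_left st_mult st_st)

context
  fixes q assumes q: "cstar_seminorm sc st q"
begin

lemma q_add: "q (x + y) \<le> q x + q y"
  and q_sc: "q (sc c x) = cmod c * q x"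
  and q_mult: "q (x * y) \<le> q x * q y"
  and q_cstar: "q (st x * x) = (q x)\<^sup>2"
  using q by (auto simp: cstar_seminorm_def)

lemma q_zero: "q 0 = 0"
  using q_sc[of 0 0] by (simp add: sc_zero)

lemma q_minus: "q (- x) = q x"
  using q_sc[of "-1" x] by (simp add: sc_minus)

lemma q_nonneg: "0 \<le> q x"
  using q_add[of x "-x"] by (simp add: q_minus q_zero)

lemma q_diff_commute: "q (x - y) = q (y - x)"
  using q_minus[of "x - y"] by simp

lemma q_diff: "q (x - y) \<le> q x + q y"
  using q_add[of x "- y"] by (simp add: q_minus)

lemma q_tri: "\<bar>q x - q y\<bar> \<le> q (x - y)"
  using q_add[of "x - y" y] q_add[of "y - x" x] q_diff_commute[of x y] by simp

lemma q_st: "q (st x) = q x"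
proof -
  have le: "q y \<le> q (st y)" for y
  proof (cases "q y = 0")
    case False
    have "q y * q y \<le> q (st y) * q y"
      using q_cstar[of y] q_mult[of "st y" y] by (simp add: power2_eq_square)
    then show ?thesis using False q_nonneg[of y] by simp
  qed (simp add: q_nonneg)
  show ?thesis using le[of x] le[of "st x"] by (simp add: st_st)
qed

lemma q_one: "q 1 \<le> 1"
proof -
  have "(q 1)\<^sup>2 = q 1" using q_cstar[of 1] by (simp add: st_one)
  then show ?thesis by (auto simp: power2_eq_square)
qed

lemma q_congD: "q (x - y) = 0 \<Longrightarrow> q x = q y"
  using q_tri[of x y] by simp

text \<open>Every unital star homomorphism from a C*-algebra (here: modulo the null space of \<open>q\<close>) is
  contractive: for selfadjoint \<open>h\<close> of norm below 1, \<open>h + \<i> c\<close> with \<open>c\<^sup>2 = 1 - h\<^sup>2\<close> is unitary.\<close>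

lemma contractive:
  fixes i :: "'a::cstar_algebra \<Rightarrow> 'f"
  assumes add: "\<And>a b. q (i (a + b) - i a - i b) = 0"
    and scal: "\<And>c a. q (i (c *\<^sub>C a) - sc c (i a)) = 0"
    and mul: "\<And>a b. q (i (a * b) - i a * i b) = 0"
    and one: "q (i 1 - 1) = 0"
    and st: "\<And>a. st (i a) = i (star a)"
  shows "q (i a) \<le> norm a"
proof -
  have sa: "q (i h) \<le> 1" if h: "norm h < 1" "star h = h" for h
  proof -
    have "norm (h * h) < 1"
      using norm_mult_ineq[of h h] mult_strict_mono[of "norm h" 1 "norm h" 1] h(1) 
      by (cases "norm h = 0") auto
    moreover have "star (h * h) = h * h" by (simp add: star_mult h)
    ultimately obtain c where c: "star c = c" "c * c = 1 - h * h"
      and comm: "\<And>y. y * (h * h) = (h * h) * y \<Longrightarrow> y * c = c * y"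
      using sqrt_one_minus[of "h * h"] by metis
    have hc: "h * c = c * h" by (rule comm) (simp add: mult.assoc)
    define u where "u = i h + sc \<i> (i c)"
    have stu: "st u = i h - sc \<i> (i c)"
    proof -
      have "sc (- \<i>) (i c) = - sc \<i> (i c)"
        using sc_sc[of "-1" "\<i>" "i c"] by (simp add: sc_minus)
      then show ?thesis by (simp add: u_def st_add st_sc st h c)
    qed
    have "st u * u = i h * i h + i c * i c + sc \<i> (i h * i c - i c * i h)"
    proof -
      have "sc \<i> (sc \<i> z) = - z" for z by (simp add: sc_sc sc_minus)
      then show ?thesis
        unfolding stu by (simp add: u_def sc_diff algebra_simps sc_mult_left sc_mult_right)
    qed
    also have "\<dots> - 1 = (- (i (h * h) - i h * i h)) + (- (i (c * c) - i c * i c)) 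
        + (- (i (h * h + c * c) - i (h * h) - i (c * c))) + (i (h * h + c * c) - 1)
        + sc \<i> ((i (c * h) - i c * i h) - (i (h * c) - i h * i c))"
      by (simp add: hc algebra_simps)
    also have "q \<dots> \<le> 0"
    proof -
      have "h * h + c * c = 1" by (simp add: c)
      then have 4: "q (i (h * h + c * c) - 1) = 0" by (simp add: one)
      have 5: "q ((i (c * h) - i c * i h) - (i (h * c) - i h * i c)) \<le> 0"
        using q_diff[of "i (c * h) - i c * i h" "i (h * c) - i h * i c"] by (simp add: mul)
      have add0: "q (v + w) \<le> 0" if "q v \<le> 0" "q w \<le> 0" for v w
        using q_add[of v w] that by simp
      show ?thesis
        by (intro add0) (use 4 5 in \<open>simp_all add: q_minus mul add q_sc del: minus_diff_eq\<close>)
    qed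
    finally have "q (st u * u - 1) = 0" using q_nonneg order_antisym by blast
    then have "(q u)\<^sup>2 \<le> 1" using q_congD q_cstar q_one by metis
    then have qu: "q u \<le> 1" by (simp add: power2_le_iff_abs_le abs_le_iff[of _ 1] abs_square_le_1)
    have "sc (1/2) (u + st u) = i h"
    proof -
      have "u + st u = sc 1 (i h) + sc 1 (i h)" by (simp add: stu sc_one) (simp add: u_def)
      also have "\<dots> = sc 2 (i h)" unfolding sc_add_left[symmetric] by simp
      finally show ?thesis by (simp add: sc_sc sc_one)
    qed
    then have "q (i h) = 1/2 * q (u + st u)" using q_sc[of "1/2" "u + st u"] by simp
    also have "\<dots> \<le> 1/2 * (q u + q (st u))" using q_add by simp
    also have "\<dots> \<le> 1" using qu by (simp add: q_st)
    finally show ?thesis .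
  qed
  have sa2: "q (i h) \<le> norm h" if h: "star h = h" for h
  proof (rule dense_ge)
    fix t assume t: "norm h < t"
    then have tp: "t > 0" by (meson norm_ge_zero le_less_trans)
    define k where "k = complex_of_real (1 / t) *\<^sub>C h"
    have "norm k < 1" using t tp by (simp add: k_def norm_scaleC norm_divide)
    moreover have "star k = k" by (simp add: k_def star_scaleC h)
    ultimately have "q (i k) \<le> 1" by (rule sa)
    moreover have "q (i k) = 1 / t * q (i h)"
      using q_congD[OF scal[of "complex_of_real (1 / t)" h]] tp
      unfolding q_sc k_def norm_of_real by simp
    ultimately show "q (i h) \<le> t" using tp by (simp add: field_simps)
  qed
  have "(q (i a))\<^sup>2 = q (i (star a) * i a)" using q_cstar[of "i a"] by (simp add: st)
  also have "\<dots> = q (i (star a * a))" using q_congD[OF mul] by metis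
  also have "\<dots> \<le> (norm a)\<^sup>2"
    using sa2[of "star a * a"] by (simp add: star_mult star_star norm_star_mult)
  finally show ?thesis by (simp add: power2_le_iff_abs_le)
qed

end

end

lemma star_alg_cstar: "star_alg (scaleC :: complex \<Rightarrow> 'a::cstar_algebra \<Rightarrow> 'a) star"
  by standard (simp_all add: scaleC_add_right scaleC_add_left scaleC_scaleC mult_scaleC_left
      mult_scaleC_right star_add star_scaleC star_mult star_star)

lemma unital_star_hom_contractive:
  assumes "unital_star_hom (\<pi> :: 'a::cstar_algebra \<Rightarrow> 'b::cstar_algebra)"
  shows "norm (\<pi> a) \<le> norm a"
  by (rule star_alg.contractive[OF star_alg_cstar cstar_seminorm_norm])
    (use assms in \<open>auto simp: unital_star_hom_def clinear_map_def\<close>)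

section \<open>The full free product of unital C*-algebras\<close>

datatype 'g word = Word (letters: "'g list")

instantiation word :: (type) monoid_add
begin

definition zero_word :: "'a word" where "0 = Word []"

definition plus_word :: "'a word \<Rightarrow> 'a word \<Rightarrow> 'a word" where
  "u + v = Word (letters u @ letters v)"

instance by standard (simp_all add: zero_word_def plus_word_def)

end

type_synonym ('a, 'b) free_alg = "('a + 'b) word \<Rightarrow>\<^sub>0 complex"

definition word_star :: "('a::cstar_algebra + 'b::cstar_algebra) word \<Rightarrow> ('a + 'b) word" where
  "word_star w = Word (rev (map (map_sum star star) (letters w)))"

definition fa_scale :: "complex \<Rightarrow> ('a, 'b) free_alg \<Rightarrow> ('a, 'b) free_alg" where
  "fa_scale c f = Poly_Mapping.single 0 c * f"

definition fa_star ::
  "('a::cstar_algebra, 'b::cstar_algebra) free_alg \<Rightarrow> ('a, 'b) free_alg" where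
  "fa_star f = Poly_Mapping.map_key word_star (Poly_Mapping.map cnj f)"

text \<open>The letters \<open>Inl a\<close> and \<open>Inr b\<close> stand for the images of \<open>a\<close> and \<open>b\<close> under the two
  canonical injections.\<close>

definition fa_gen :: "'a + 'b \<Rightarrow> ('a, 'b) free_alg" where
  "fa_gen x = Poly_Mapping.single (Word [x]) 1"

text \<open>The elements whose vanishing makes \<open>i\<close> a unital algebra homomorphism.\<close>

definition hom_relations :: "('c::cstar_algebra \<Rightarrow> ('a, 'b) free_alg) \<Rightarrow> ('a, 'b) free_alg set" where
  "hom_relations i =
     {i (x + y) - i x - i y |x y. True} \<union> {i (c *\<^sub>C x) - fa_scale c (i x) |c x. True} \<union>
     {i (x * y) - i x * i y |x y. True} \<union> {i 1 - 1}"

text \<open>The norm of \<open>'a * 'b\<close> is the largest C*-seminorm for which \<open>'a\<close> and \<open>'b\<close> map by unital star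
  homomorphisms. The supremum is finite because such homomorphisms are contractive.\<close>

definition fp_seminorms :: "(('a::cstar_algebra, 'b::cstar_algebra) free_alg \<Rightarrow> real) set" where
  "fp_seminorms = {q. cstar_seminorm fa_scale fa_star q \<and>
     (\<forall>r \<in> hom_relations (\<lambda>a. fa_gen (Inl a)) \<union> hom_relations (\<lambda>b. fa_gen (Inr b)). q r = 0)}"

definition fp_norm :: "('a::cstar_algebra, 'b::cstar_algebra) free_alg \<Rightarrow> real" where
  "fp_norm f = (SUP q\<in>fp_seminorms. q f)"

lemma poly_mapping_additive_induct:
  fixes f :: "'k \<Rightarrow>\<^sub>0 'c::comm_monoid_add"
  assumes "P 0" "\<And>k c. P (Poly_Mapping.single k c)" "\<And>f g. P f \<Longrightarrow> P g \<Longrightarrow> P (f + g)"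
  shows "P f"
proof -
  have "f = (\<Sum>k\<in>Poly_Mapping.keys f. Poly_Mapping.single k (Poly_Mapping.lookup f k))"
    by (rule poly_mapping_eqI)
      (simp add: lookup_sum lookup_single when_def in_keys_iff)
  moreover have "P (\<Sum>k\<in>A. Poly_Mapping.single k (Poly_Mapping.lookup f k))" if "finite A" for A
    using that by induction (auto simp: assms)
  ultimately show ?thesis by (metis finite_keys)
qed

lemma word_star_star [simp]: "word_star (word_star w) = w"
  by (cases w)
    (simp add: word_star_def rev_map[symmetric] comp_def sum.map_comp star_star sum.map_id0[unfolded id_def])

lemma word_star_add: "word_star (u + v) = word_star v + word_star u"
  by (simp add: word_star_def plus_word_def)

lemma word_star_zero: "word_star 0 = 0"
  by (simp add: word_star_def zero_word_def)

lemma inj_word_star: "inj word_star"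
  by (metis injI word_star_star)

lemma lookup_fa_star: "Poly_Mapping.lookup (fa_star f) w = cnj (Poly_Mapping.lookup f (word_star w))"
  by (simp add: fa_star_def map_key.rep_eq inj_word_star map.rep_eq when_def)

lemma fa_star_single: "fa_star (Poly_Mapping.single w c) = Poly_Mapping.single (word_star w) (cnj c)"
  by (rule poly_mapping_eqI) (auto simp: lookup_fa_star lookup_single when_def)

lemma fa_star_add: "fa_star (f + g) = fa_star f + fa_star g"
  by (rule poly_mapping_eqI) (simp add: lookup_fa_star lookup_add)

lemma fa_star_zero: "fa_star 0 = 0"
  by (rule poly_mapping_eqI) (simp add: lookup_fa_star)

lemma fa_star_mult: "fa_star (f * g) = fa_star g * fa_star f"
proof (induction f rule: poly_mapping_additive_induct)
  case (2 k c)
  show ?case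
    by (induction g rule: poly_mapping_additive_induct)
      (simp_all add: fa_star_zero mult_single fa_star_single word_star_add fa_star_add algebra_simps)
qed (simp_all add: fa_star_zero fa_star_add algebra_simps)

lemma single_zero_commute:
  fixes f :: "'k::monoid_add \<Rightarrow>\<^sub>0 complex"
  shows "f * Poly_Mapping.single 0 c = Poly_Mapping.single 0 c * f"
  by (induction f rule: poly_mapping_additive_induct) (simp_all add: mult_single algebra_simps)

interpretation fa: star_alg fa_scale fa_star
proof
  fix f g :: "('a, 'b) free_alg" and c d
  show "fa_scale c (f + g) = fa_scale c f + fa_scale c g"
    "fa_scale (c + d) f = fa_scale c f + fa_scale d f"
    "fa_scale 1 f = f"
    "fa_scale c f * g = fa_scale c (f * g)"
    by (simp_all add: fa_scale_def algebra_simps single_add)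
  show "fa_scale c (fa_scale d f) = fa_scale (c * d) f"
    by (simp add: fa_scale_def mult_single flip: mult.assoc)
  show "f * fa_scale c g = fa_scale c (f * g)"
    by (metis fa_scale_def single_zero_commute mult.assoc)
  show "fa_star (f + g) = fa_star f + fa_star g" by (rule fa_star_add)
  show "fa_star (fa_scale c f) = fa_scale (cnj c) (fa_star f)"
    by (simp add: fa_scale_def fa_star_mult fa_star_single word_star_zero single_zero_commute)
  show "fa_star (f * g) = fa_star g * fa_star f" by (rule fa_star_mult)
  show "fa_star (fa_star f) = f"
    by (rule poly_mapping_eqI) (simp add: lookup_fa_star)
qed

lemma fa_star_gen: "fa_star (fa_gen x) = fa_gen (map_sum star star x)"
  by (simp add: fa_gen_def fa_star_single word_star_def)

lemma hom_relationsD: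
  assumes "\<forall>r\<in>hom_relations i. q r = 0"
  shows "q (i (x + y) - i x - i y) = 0" "q (i (c *\<^sub>C x) - fa_scale c (i x)) = 0"
    "q (i (x * y) - i x * i y) = 0" "q (i 1 - 1) = 0"
  using assms unfolding hom_relations_def by blast+

lemma fp_seminorms_gen_le:
  assumes "q \<in> fp_seminorms"
  shows "q (fa_gen (Inl a)) \<le> norm a" "q (fa_gen (Inr b)) \<le> norm b"
proof -
  have q: "cstar_seminorm fa_scale fa_star q"
    and l: "\<forall>r\<in>hom_relations (\<lambda>a. fa_gen (Inl a)). q r = 0"
    and r: "\<forall>r\<in>hom_relations (\<lambda>b. fa_gen (Inr b)). q r = 0"
    using assms by (auto simp: fp_seminorms_def)
  show "q (fa_gen (Inl a)) \<le> norm a"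
    by (rule fa.contractive[OF q hom_relationsD[OF l]]) (simp add: fa_star_gen)
  show "q (fa_gen (Inr b)) \<le> norm b"
    by (rule fa.contractive[OF q hom_relationsD[OF r]]) (simp add: fa_star_gen)
qed

lemma single_Word_Cons: "Poly_Mapping.single (Word (x # xs)) c = fa_gen x * Poly_Mapping.single (Word xs) c"
  by (simp add: fa_gen_def mult_single plus_word_def)

lemma single_Word_Nil: "Poly_Mapping.single (Word []) c = fa_scale c 1"
  by (simp add: fa_scale_def zero_word_def)

lemma fp_seminorms_bdd: "bdd_above ((\<lambda>q. q f) ` fp_seminorms)"
proof -
  have "\<exists>B. \<forall>q\<in>fp_seminorms. q f \<le> B"
  proof (induction f rule: poly_mapping_additive_induct)
    case 1
    have "q 0 \<le> 0" if "q \<in> fp_seminorms" for q :: "('a, 'b) free_alg \<Rightarrow> real"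
      using that fa.q_zero[of q] by (simp add: fp_seminorms_def)
    then show ?case by blast
  next
    case (2 w c)
    have "\<exists>B. \<forall>q\<in>fp_seminorms. q (Poly_Mapping.single (Word xs) c) \<le> B" for xs :: "('a + 'b) list"
    proof (induction xs)
      case Nil
      have "q (Poly_Mapping.single (Word []) c) \<le> cmod c" if "q \<in> fp_seminorms" 
        for q :: "('a, 'b) free_alg \<Rightarrow> real"
      proof -
        have q: "cstar_seminorm fa_scale fa_star q" using that by (auto simp: fp_seminorms_def)
        show ?thesis
          using mult_left_mono[OF fa.q_one[OF q], of "cmod c"] by (simp add: single_Word_Nil fa.q_sc[OF q])
      qed
      then show ?case by blast
    next
      case (Cons x xs)
      then obtain B where B: "\<And>q. q \<in> fp_seminorms \<Longrightarrow> q (Poly_Mapping.single (Word xs) c) \<le> B" by blast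
      define C where "C = (case x of Inl a \<Rightarrow> norm a | Inr b \<Rightarrow> norm b)"
      have "q (Poly_Mapping.single (Word (x # xs)) c) \<le> C * B" if "q \<in> fp_seminorms" for q
      proof -
        have q: "cstar_seminorm fa_scale fa_star q" using that by (auto simp: fp_seminorms_def)
        have g: "q (fa_gen x) \<le> C" using fp_seminorms_gen_le[OF that] by (simp add: C_def split: sum.split)
        have "q (Poly_Mapping.single (Word (x # xs)) c) \<le> q (fa_gen x) * q (Poly_Mapping.single (Word xs) c)"
          unfolding single_Word_Cons by (rule fa.q_mult[OF q])
        also have "\<dots> \<le> C * B"
          by (rule mult_mono'[OF g B[OF that]]) (simp_all add: fa.q_nonneg[OF q])
        finally show ?thesis .
      qed
      then show ?case by blast
    qed
    then show ?case by (metis word.collapse)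
  next
    case (3 f g)
    then obtain B C where "\<And>q. q \<in> fp_seminorms \<Longrightarrow> q f \<le> B" "\<And>q. q \<in> fp_seminorms \<Longrightarrow> q g \<le> C"
      by blast
    then have "q (f + g) \<le> B + C" if "q \<in> fp_seminorms" for q
      using fa.q_add[of q f g] that by (smt (verit) fp_seminorms_def mem_Collect_eq)
    then show ?case by blast
  qed
  then show ?thesis by (auto simp: bdd_above_def)
qed

lemma le_fp_norm: "q \<in> fp_seminorms \<Longrightarrow> q f \<le> fp_norm f"
  unfolding fp_norm_def by (rule cSUP_upper[OF _ fp_seminorms_bdd])

lemma zero_fp_seminorm: "(\<lambda>_. 0) \<in> fp_seminorms"
  by (simp add: fp_seminorms_def cstar_seminorm_def)

lemma fp_norm_le: "(\<And>q. q \<in> fp_seminorms \<Longrightarrow> q f \<le> B) \<Longrightarrow> fp_norm f \<le> B"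
  unfolding fp_norm_def using zero_fp_seminorm by (intro cSUP_least) auto

lemma fp_norm_in: "(fp_norm :: ('a::cstar_algebra, 'b::cstar_algebra) free_alg \<Rightarrow> real) \<in> fp_seminorms"
proof -
  let ?N = "fp_norm :: ('a, 'b) free_alg \<Rightarrow> real"
  have S: "cstar_seminorm fa_scale fa_star q" if "q \<in> fp_seminorms" for q :: "('a, 'b) free_alg \<Rightarrow> real"
    using that by (simp add: fp_seminorms_def)
  have nn: "0 \<le> ?N f" for f using le_fp_norm[OF zero_fp_seminorm] .
  have "?N (f + g) \<le> ?N f + ?N g" for f g
  proof (rule fp_norm_le)
    fix q :: "('a, 'b) free_alg \<Rightarrow> real" assume q: "q \<in> fp_seminorms"
    show "q (f + g) \<le> ?N f + ?N g"
      using fa.q_add[OF S[OF q], of f g] le_fp_norm[OF q, of f] le_fp_norm[OF q, of g] by linarith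
  qed
  moreover have "?N (f * g) \<le> ?N f * ?N g" for f g
  proof (rule fp_norm_le)
    fix q :: "('a, 'b) free_alg \<Rightarrow> real" assume q: "q \<in> fp_seminorms"
    have "q (f * g) \<le> q f * q g" by (rule fa.q_mult[OF S[OF q]])
    also have "\<dots> \<le> ?N f * ?N g"
      by (rule mult_mono'[OF le_fp_norm[OF q] le_fp_norm[OF q]]) (simp_all add: fa.q_nonneg[OF S[OF q]])
    finally show "q (f * g) \<le> ?N f * ?N g" .
  qed
  moreover have "?N (fa_scale c f) = cmod c * ?N f" for c f
  proof (rule antisym)
    have le: "?N (fa_scale c f) \<le> cmod c * ?N f" for c f
    proof (rule fp_norm_le)
      fix q :: "('a, 'b) free_alg \<Rightarrow> real" assume q: "q \<in> fp_seminorms"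
      show "q (fa_scale c f) \<le> cmod c * ?N f"
        using le_fp_norm[OF q, of f] by (simp add: fa.q_sc[OF S[OF q]] mult_left_mono)
    qed
    show "?N (fa_scale c f) \<le> cmod c * ?N f" by (rule le)
    show "cmod c * ?N f \<le> ?N (fa_scale c f)"
    proof (cases "c = 0")
      case False
      have "?N f = ?N (fa_scale (1 / c) (fa_scale c f))" using False by (simp add: fa.sc_sc fa.sc_one)
      also have "\<dots> \<le> cmod (1 / c) * ?N (fa_scale c f)" by (rule le)
      finally show ?thesis using False by (simp add: norm_divide field_simps)
    qed (simp add: nn)
  qed
  moreover have "?N (fa_star f * f) = (?N f)\<^sup>2" for f
  proof (rule antisym)
    show "?N (fa_star f * f) \<le> (?N f)\<^sup>2"
    proof (rule fp_norm_le)
      fix q :: "('a, 'b) free_alg \<Rightarrow> real" assume q: "q \<in> fp_seminorms"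
      show "q (fa_star f * f) \<le> (?N f)\<^sup>2"
        using le_fp_norm[OF q, of f] fa.q_nonneg[OF S[OF q]]
        by (simp add: fa.q_cstar[OF S[OF q]] power_mono)
    qed
    have "?N f \<le> sqrt (?N (fa_star f * f))"
    proof (rule fp_norm_le)
      fix q :: "('a, 'b) free_alg \<Rightarrow> real" assume q: "q \<in> fp_seminorms"
      show "q f \<le> sqrt (?N (fa_star f * f))"
        using le_fp_norm[OF q, of "fa_star f * f"]
        by (intro real_le_rsqrt) (simp add: fa.q_cstar[OF S[OF q]])
    qed
    then show "(?N f)\<^sup>2 \<le> ?N (fa_star f * f)"
      using nn by (metis abs_of_nonneg power2_abs power_mono real_sqrt_pow2)
  qed
  moreover have "?N r = 0"
    if "r \<in> hom_relations (\<lambda>a. fa_gen (Inl a)) \<union> hom_relations (\<lambda>b. fa_gen (Inr b))" for r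
  proof (rule antisym)
    show "?N r \<le> 0" by (rule fp_norm_le) (use that in \<open>auto simp: fp_seminorms_def\<close>)
  qed (rule nn)
  ultimately show ?thesis by (simp add: fp_seminorms_def cstar_seminorm_def)
qed

lemma fp_norm_seminorm: "cstar_seminorm fa_scale fa_star fp_norm"
  using fp_norm_in unfolding fp_seminorms_def by blast

lemmas fpn_add = fa.q_add[OF fp_norm_seminorm]
  and fpn_scale = fa.q_sc[OF fp_norm_seminorm]
  and fpn_mult = fa.q_mult[OF fp_norm_seminorm]
  and fpn_cstar = fa.q_cstar[OF fp_norm_seminorm]
  and fpn_zero = fa.q_zero[OF fp_norm_seminorm]
  and fpn_minus = fa.q_minus[OF fp_norm_seminorm]
  and fpn_nonneg = fa.q_nonneg[OF fp_norm_seminorm]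
  and fpn_diff_commute = fa.q_diff_commute[OF fp_norm_seminorm]
  and fpn_tri = fa.q_tri[OF fp_norm_seminorm]
  and fpn_star = fa.q_st[OF fp_norm_seminorm]

text \<open>The free product is the completion of the free star algebra with respect to \<open>fp_norm\<close>.\<close>

definition fp_cauchy :: "(nat \<Rightarrow> ('a::cstar_algebra, 'b::cstar_algebra) free_alg) \<Rightarrow> bool" where
  "fp_cauchy X \<longleftrightarrow> (\<forall>e>0. \<exists>M. \<forall>m\<ge>M. \<forall>n\<ge>M. fp_norm (X m - X n) < e)"

definition fp_rel :: "(nat \<Rightarrow> ('a::cstar_algebra, 'b::cstar_algebra) free_alg) \<Rightarrow>
    (nat \<Rightarrow> ('a, 'b) free_alg) \<Rightarrow> bool" where
  "fp_rel X Y \<longleftrightarrow> fp_cauchy X \<and> fp_cauchy Y \<and> (\<lambda>n. fp_norm (X n - Y n)) \<longlonglongrightarrow> 0"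

lemma fp_cauchy_const: "fp_cauchy (\<lambda>_. f)"
  by (simp add: fp_cauchy_def fpn_zero)

lemma fp_cauchy_lipschitz:
  assumes "fp_cauchy X" "\<And>m n. fp_norm (Y m - Y n) \<le> K * fp_norm (X m - X n)"
  shows "fp_cauchy Y"
  unfolding fp_cauchy_def
proof (intro allI impI)
  fix e :: real assume "e > 0"
  define L where "L = max K 1"
  have "L > 0" "K \<le> L" by (auto simp: L_def)
  with \<open>e > 0\<close> assms(1) obtain M where
    M: "\<And>m n. m \<ge> M \<Longrightarrow> n \<ge> M \<Longrightarrow> fp_norm (X m - X n) < e / L"
    unfolding fp_cauchy_def by (metis divide_pos_pos)
  have "fp_norm (Y m - Y n) < e" if "m \<ge> M" "n \<ge> M" for m n
  proof -
    have "fp_norm (Y m - Y n) \<le> L * fp_norm (X m - X n)"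
      using assms(2)[of m n] mult_right_mono[OF \<open>K \<le> L\<close> fpn_nonneg[of "X m - X n"]] by linarith
    also have "\<dots> < e" using M[OF that] \<open>L > 0\<close> by (simp add: field_simps)
    finally show ?thesis .
  qed
  then show "\<exists>M. \<forall>m\<ge>M. \<forall>n\<ge>M. fp_norm (Y m - Y n) < e" by blast
qed

lemma fp_cauchy_add:
  assumes "fp_cauchy X" "fp_cauchy Y"
  shows "fp_cauchy (\<lambda>n. X n + Y n)"
  unfolding fp_cauchy_def
proof (intro allI impI)
  fix e :: real assume "e > 0"
  then have "e / 2 > 0" by simp
  with assms obtain M M' where
    M: "\<And>m n. m \<ge> M \<Longrightarrow> n \<ge> M \<Longrightarrow> fp_norm (X m - X n) < e / 2" and
    M': "\<And>m n. m \<ge> M' \<Longrightarrow> n \<ge> M' \<Longrightarrow> fp_norm (Y m - Y n) < e / 2"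
    unfolding fp_cauchy_def by metis
  have "fp_norm (X m + Y m - (X n + Y n)) < e" if "m \<ge> max M M'" "n \<ge> max M M'" for m n
    using M[of m n] M'[of m n] fpn_add[of "X m - X n" "Y m - Y n"] that
    by (simp add: algebra_simps)
  then show "\<exists>M. \<forall>m\<ge>M. \<forall>n\<ge>M. fp_norm (X m + Y m - (X n + Y n)) < e" by blast
qed

lemma fp_norm_convergent:
  assumes "fp_cauchy X" shows "convergent (\<lambda>n. fp_norm (X n))"
  unfolding Cauchy_convergent_iff[symmetric]
proof (rule metric_CauchyI)
  fix e :: real assume "e > 0"
  with assms show "\<exists>M. \<forall>m\<ge>M. \<forall>n\<ge>M. dist (fp_norm (X m)) (fp_norm (X n)) < e"
    unfolding fp_cauchy_def dist_real_def by (meson fpn_tri le_less_trans)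
qed

lemma fp_cauchy_bounded:
  assumes "fp_cauchy X" obtains B where "B > 0" "\<And>n. fp_norm (X n) \<le> B"
proof -
  have "Bseq (\<lambda>n. fp_norm (X n))"
    using fp_norm_convergent[OF assms] by (rule convergent_imp_Bseq)
  then obtain B where "B > 0" "\<And>n. \<bar>fp_norm (X n)\<bar> \<le> B" by (auto simp: Bseq_def)
  then show thesis using that by (metis abs_le_D1)
qed

lemma fpn_mult_diff:
  "fp_norm (f * g - f' * g') \<le> fp_norm (f - f') * fp_norm g + fp_norm f' * fp_norm (g - g')"
proof -
  have "f * g - f' * g' = (f - f') * g + f' * (g - g')" by (simp add: algebra_simps)
  then show ?thesis
    using fpn_add[of "(f - f') * g" "f' * (g - g')"] fpn_mult[of "f - f'" g] fpn_mult[of f' "g - g'"]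
    by simp
qed

lemma fp_cauchy_mult:
  assumes "fp_cauchy X" "fp_cauchy Y"
  shows "fp_cauchy (\<lambda>n. X n * Y n)"
  unfolding fp_cauchy_def
proof (intro allI impI)
  fix e :: real assume e: "e > 0"
  obtain B where B: "B > 0" "\<And>n. fp_norm (X n) \<le> B" by (metis fp_cauchy_bounded assms(1))
  obtain C where C: "C > 0" "\<And>n. fp_norm (Y n) \<le> C" by (metis fp_cauchy_bounded assms(2))
  have "e / (2 * C) > 0" "e / (2 * B) > 0" using e B C by simp_all
  with assms obtain M M' where
    M: "\<And>m n. m \<ge> M \<Longrightarrow> n \<ge> M \<Longrightarrow> fp_norm (X m - X n) < e / (2 * C)" and
    M': "\<And>m n. m \<ge> M' \<Longrightarrow> n \<ge> M' \<Longrightarrow> fp_norm (Y m - Y n) < e / (2 * B)"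
    unfolding fp_cauchy_def by metis
  have "fp_norm (X m * Y m - X n * Y n) < e" if "m \<ge> max M M'" "n \<ge> max M M'" for m n
  proof -
    have "fp_norm (X m - X n) * fp_norm (Y m) \<le> fp_norm (X m - X n) * C"
      by (rule mult_left_mono[OF C(2) fpn_nonneg])
    also have "\<dots> < e / 2" using M[of m n] that C(1) by (simp add: field_simps)
    finally have 1: "fp_norm (X m - X n) * fp_norm (Y m) < e / 2" .
    have "fp_norm (X n) * fp_norm (Y m - Y n) \<le> B * fp_norm (Y m - Y n)"
      by (rule mult_right_mono[OF B(2) fpn_nonneg])
    also have "\<dots> < e / 2" using M'[of m n] that B(1) by (simp add: field_simps)
    finally have 2: "fp_norm (X n) * fp_norm (Y m - Y n) < e / 2" .
    show ?thesis using 1 2 fpn_mult_diff[of "X m" "Y m" "X n" "Y n"] by linarith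
  qed
  then show "\<exists>M. \<forall>m\<ge>M. \<forall>n\<ge>M. fp_norm (X m * Y m - X n * Y n) < e" by blast
qed

lemma fp_cauchy_scale: "fp_cauchy X \<Longrightarrow> fp_cauchy (\<lambda>n. fa_scale c (X n))"
  by (erule fp_cauchy_lipschitz[where K = "cmod c"]) (simp add: fpn_scale flip: fa.sc_diff)

lemma fp_cauchy_star: "fp_cauchy X \<Longrightarrow> fp_cauchy (\<lambda>n. fa_star (X n))"
  by (erule fp_cauchy_lipschitz[where K = 1]) (simp add: fpn_star flip: fa.st_diff)

lemma fp_cauchy_minus: "fp_cauchy X \<Longrightarrow> fp_cauchy (\<lambda>n. - X n)"
  using fp_cauchy_scale[of X "-1"] by (simp add: fa.sc_minus)

lemma fp_rel_refl: "fp_cauchy X \<Longrightarrow> fp_rel X X"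
  by (simp add: fp_rel_def fpn_zero)

lemma fp_rel_self [simp]: "fp_rel X X \<longleftrightarrow> fp_cauchy X"
  using fp_rel_refl fp_rel_def by blast

lemma fp_rel_sym: "fp_rel X Y \<Longrightarrow> fp_rel Y X"
  by (simp add: fp_rel_def fpn_diff_commute)

lemma fpn_squeeze:
  assumes "\<And>n. fp_norm (X n) \<le> b n" "b \<longlonglongrightarrow> 0"
  shows "(\<lambda>n. fp_norm (X n)) \<longlonglongrightarrow> 0"
  by (rule tendsto_sandwich[OF _ _ tendsto_const assms(2)]) (simp_all add: assms(1) fpn_nonneg)

lemma fp_rel_trans: "fp_rel X Y \<Longrightarrow> fp_rel Y Z \<Longrightarrow> fp_rel X Z"
  unfolding fp_rel_def
proof (elim conjE, intro conjI)
  assume *: "(\<lambda>n. fp_norm (X n - Y n)) \<longlonglongrightarrow> 0" "(\<lambda>n. fp_norm (Y n - Z n)) \<longlonglongrightarrow> 0"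
  show "(\<lambda>n. fp_norm (X n - Z n)) \<longlonglongrightarrow> 0"
  proof (rule fpn_squeeze)
    show "(\<lambda>n. fp_norm (X n - Y n) + fp_norm (Y n - Z n)) \<longlonglongrightarrow> 0"
      using tendsto_add[OF *] by simp
    show "fp_norm (X n - Z n) \<le> fp_norm (X n - Y n) + fp_norm (Y n - Z n)" for n
      using fpn_add[of "X n - Y n" "Y n - Z n"] by simp
  qed
qed

lemma fp_rel_add:
  assumes "fp_rel X X'" "fp_rel Y Y'"
  shows "fp_rel (\<lambda>n. X n + Y n) (\<lambda>n. X' n + Y' n)"
proof -
  have "(\<lambda>n. fp_norm (X n + Y n - (X' n + Y' n))) \<longlonglongrightarrow> 0"
  proof (rule fpn_squeeze)
    show "(\<lambda>n. fp_norm (X n - X' n) + fp_norm (Y n - Y' n)) \<longlonglongrightarrow> 0"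
      using assms tendsto_add unfolding fp_rel_def by fastforce
    show "fp_norm (X n + Y n - (X' n + Y' n)) \<le> fp_norm (X n - X' n) + fp_norm (Y n - Y' n)" for n
      using fpn_add[of "X n - X' n" "Y n - Y' n"] by (simp add: algebra_simps)
  qed
  with assms show ?thesis by (simp add: fp_rel_def fp_cauchy_add)
qed

lemma fp_rel_mult:
  assumes "fp_rel X X'" "fp_rel Y Y'"
  shows "fp_rel (\<lambda>n. X n * Y n) (\<lambda>n. X' n * Y' n)"
proof -
  have c: "fp_cauchy X'" "fp_cauchy Y" using assms by (auto simp: fp_rel_def)
  obtain B where B: "\<And>n. fp_norm (X' n) \<le> B" by (metis fp_cauchy_bounded c(1))
  obtain C where C: "\<And>n. fp_norm (Y n) \<le> C" by (metis fp_cauchy_bounded c(2))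
  have "(\<lambda>n. fp_norm (X n * Y n - X' n * Y' n)) \<longlonglongrightarrow> 0"
  proof (rule fpn_squeeze)
    have "(\<lambda>n. fp_norm (X n - X' n) * C + B * fp_norm (Y n - Y' n)) \<longlonglongrightarrow> 0 * C + B * 0"
      using assms unfolding fp_rel_def by (intro tendsto_intros) auto
    then show "(\<lambda>n. fp_norm (X n - X' n) * C + B * fp_norm (Y n - Y' n)) \<longlonglongrightarrow> 0" by simp
    show "fp_norm (X n * Y n - X' n * Y' n) \<le> fp_norm (X n - X' n) * C + B * fp_norm (Y n - Y' n)" for n
      using fpn_mult_diff[of "X n" "Y n" "X' n" "Y' n"]
        mult_left_mono[OF C[of n] fpn_nonneg[of "X n - X' n"]]
        mult_right_mono[OF B[of n] fpn_nonneg[of "Y n - Y' n"]] by linarith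
  qed
  with assms show ?thesis by (simp add: fp_rel_def fp_cauchy_mult)
qed

lemma fp_rel_scale: "fp_rel X Y \<Longrightarrow> fp_rel (\<lambda>n. fa_scale c (X n)) (\<lambda>n. fa_scale c (Y n))"
  using tendsto_mult_left[of "\<lambda>n. fp_norm (X n - Y n)" 0 sequentially "cmod c"]
  by (auto simp: fp_rel_def fp_cauchy_scale fpn_scale simp flip: fa.sc_diff)

lemma fp_rel_star: "fp_rel X Y \<Longrightarrow> fp_rel (\<lambda>n. fa_star (X n)) (\<lambda>n. fa_star (Y n))"
  by (auto simp: fp_rel_def fp_cauchy_star fpn_star simp flip: fa.st_diff)

lemma fp_rel_minus: "fp_rel X Y \<Longrightarrow> fp_rel (\<lambda>n. - X n) (\<lambda>n. - Y n)"
  using fp_rel_scale[of X Y "-1"] by (simp add: fa.sc_minus)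

lemma fp_rel_lim_norm:
  assumes "fp_rel X Y" shows "lim (\<lambda>n. fp_norm (X n)) = lim (\<lambda>n. fp_norm (Y n))"
proof -
  have "(\<lambda>n. fp_norm (X n)) \<longlonglongrightarrow> lim (\<lambda>n. fp_norm (X n))"
    using fp_norm_convergent assms unfolding fp_rel_def convergent_LIMSEQ_iff by blast
  moreover have "(\<lambda>n. fp_norm (X n) - fp_norm (Y n)) \<longlonglongrightarrow> 0"
    by (rule Lim_null_comparison[where g = "\<lambda>n. fp_norm (X n - Y n)"])
      (use assms in \<open>simp_all add: fp_rel_def fpn_tri\<close>)
  ultimately have "(\<lambda>n. fp_norm (Y n)) \<longlonglongrightarrow> lim (\<lambda>n. fp_norm (X n))"
    using tendsto_diff by fastforce
  then show ?thesis by (rule limI[symmetric])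
qed

lemma part_equivp_fp_rel: "part_equivp fp_rel"
  by (rule part_equivpI)
    (use fp_cauchy_const fp_rel_self in blast, auto intro!: sympI transpI intro: fp_rel_sym fp_rel_trans)

quotient_type (overloaded) ('a, 'b) free_product =
  "nat \<Rightarrow> ('a::cstar_algebra, 'b::cstar_algebra) free_alg" / partial: fp_rel
  by (rule part_equivp_fp_rel)

instantiation free_product :: (cstar_algebra, cstar_algebra) real_normed_vector
begin

lift_definition zero_free_product :: "('a, 'b) free_product" is "\<lambda>_. 0"
  by (simp add: fp_cauchy_const)

lift_definition plus_free_product :: "('a, 'b) free_product \<Rightarrow> ('a, 'b) free_product \<Rightarrow> ('a, 'b) free_product"
  is "\<lambda>X Y n. X n + Y n" by (rule fp_rel_add)

lift_definition uminus_free_product :: "('a, 'b) free_product \<Rightarrow> ('a, 'b) free_product"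
  is "\<lambda>X n. - X n" by (rule fp_rel_minus)

definition minus_free_product :: "('a, 'b) free_product \<Rightarrow> ('a, 'b) free_product \<Rightarrow> ('a, 'b) free_product"
  where "minus_free_product x y = x + - y"

lift_definition scaleR_free_product :: "real \<Rightarrow> ('a, 'b) free_product \<Rightarrow> ('a, 'b) free_product"
  is "\<lambda>r X n. fa_scale (complex_of_real r) (X n)" by (rule fp_rel_scale)

lift_definition norm_free_product :: "('a, 'b) free_product \<Rightarrow> real"
  is "\<lambda>X. lim (\<lambda>n. fp_norm (X n))" by (rule fp_rel_lim_norm)

definition dist_free_product :: "('a, 'b) free_product \<Rightarrow> ('a, 'b) free_product \<Rightarrow> real"
  where "dist_free_product x y = norm (x - y)"

definition sgn_free_product :: "('a, 'b) free_product \<Rightarrow> ('a, 'b) free_product"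
  where "sgn_free_product x = inverse (norm x) *\<^sub>R x"

definition uniformity_free_product :: "(('a, 'b) free_product \<times> ('a, 'b) free_product) filter"
  where "uniformity_free_product = (INF e\<in>{0<..}. principal {(x, y). dist x y < e})"

definition open_free_product :: "('a, 'b) free_product set \<Rightarrow> bool"
  where "open_free_product U \<longleftrightarrow> (\<forall>x\<in>U. eventually (\<lambda>(x', y). x' = x \<longrightarrow> y \<in> U) uniformity)"

lemma fp_norm_tendsto: "fp_cauchy X \<Longrightarrow> (\<lambda>n. fp_norm (X n)) \<longlonglongrightarrow> lim (\<lambda>n. fp_norm (X n))"
  using fp_norm_convergent convergent_LIMSEQ_iff by blast

instance
proof
  fix x y z :: "('a, 'b) free_product" and r s :: real
  show "x + y + z = x + (y + z)"
    by transfer (simp add: add.assoc fp_cauchy_add)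
  show "x + y = y + x"
    by transfer (simp add: add.commute fp_cauchy_add)
  show "0 + x = x" by transfer simp
  show "- x + x = 0" by transfer (simp add: fp_cauchy_const)
  show "x - y = x + - y" by (rule minus_free_product_def)
  show "r *\<^sub>R (x + y) = r *\<^sub>R x + r *\<^sub>R y"
    by transfer (simp add: fa.sc_add fp_cauchy_add fp_cauchy_scale)
  show "(r + s) *\<^sub>R x = r *\<^sub>R x + s *\<^sub>R x"
    by transfer (simp add: fa.sc_add_left fp_cauchy_add fp_cauchy_scale)
  show "r *\<^sub>R s *\<^sub>R x = (r * s) *\<^sub>R x"
    by transfer (simp add: fa.sc_sc fp_cauchy_scale)
  show "1 *\<^sub>R x = x" by transfer (simp add: fa.sc_one)
  show "dist x y = norm (x - y)" by (rule dist_free_product_def)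
  show "sgn x = inverse (norm x) *\<^sub>R x" by (rule sgn_free_product_def)
  show "uniformity = (INF e\<in>{0<..}. principal {(x, y :: ('a, 'b) free_product). dist x y < e})"
    by (rule uniformity_free_product_def)
  show "open U \<longleftrightarrow> (\<forall>x\<in>U. eventually (\<lambda>(x', y). x' = x \<longrightarrow> y \<in> U) uniformity)"
    for U :: "('a, 'b) free_product set" by (rule open_free_product_def)
  show "norm x = 0 \<longleftrightarrow> x = 0"
  proof transfer
    fix X :: "nat \<Rightarrow> ('a, 'b) free_alg" assume "fp_rel X X"
    then have "fp_cauchy X" by simp
    have "lim (\<lambda>n. fp_norm (X n)) = 0 \<longleftrightarrow> (\<lambda>n. fp_norm (X n)) \<longlonglongrightarrow> 0"
      using fp_norm_tendsto[OF \<open>fp_cauchy X\<close>] limI by metis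
    with \<open>fp_cauchy X\<close> show "lim (\<lambda>n. fp_norm (X n)) = 0 \<longleftrightarrow> fp_rel X (\<lambda>_. 0)"
      by (simp add: fp_rel_def fp_cauchy_const)
  qed
  show "norm (x + y) \<le> norm x + norm y"
  proof transfer
    fix X Y :: "nat \<Rightarrow> ('a, 'b) free_alg" assume "fp_rel X X" "fp_rel Y Y"
    then have "fp_cauchy X" "fp_cauchy Y" by simp_all
    note l = this
    show "lim (\<lambda>n. fp_norm (X n + Y n)) \<le> lim (\<lambda>n. fp_norm (X n)) + lim (\<lambda>n. fp_norm (Y n))"
      by (rule LIMSEQ_le[OF fp_norm_tendsto[OF fp_cauchy_add[OF l]]
            tendsto_add[OF fp_norm_tendsto[OF l(1)] fp_norm_tendsto[OF l(2)]]])
        (simp add: fpn_add)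
  qed
  show "norm (r *\<^sub>R x) = \<bar>r\<bar> * norm x"
  proof transfer
    fix r :: real and X :: "nat \<Rightarrow> ('a, 'b) free_alg" assume "fp_rel X X"
    then show "lim (\<lambda>n. fp_norm (fa_scale (complex_of_real r) (X n))) = \<bar>r\<bar> * lim (\<lambda>n. fp_norm (X n))"
      by (intro limI) (simp add: fpn_scale tendsto_mult_left fp_norm_tendsto)
  qed
qed

end

instantiation free_product :: (cstar_algebra, cstar_algebra) "{real_normed_algebra, monoid_mult}"
begin

lift_definition one_free_product :: "('a, 'b) free_product" is "\<lambda>_. 1"
  by (simp add: fp_cauchy_const)

lift_definition times_free_product :: "('a, 'b) free_product \<Rightarrow> ('a, 'b) free_product \<Rightarrow> ('a, 'b) free_product"
  is "\<lambda>X Y n. X n * Y n" by (rule fp_rel_mult)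

instance
proof
  fix x y z :: "('a, 'b) free_product" and r :: real
  show "x * y * z = x * (y * z)"
    by transfer (simp add: mult.assoc fp_cauchy_mult)
  show "1 * x = x" "x * 1 = x" by (transfer; simp)+
  show "(x + y) * z = x * z + y * z" "x * (y + z) = x * y + x * z"
    by (transfer; simp add: algebra_simps fp_cauchy_add fp_cauchy_mult)+
  show "r *\<^sub>R x * y = r *\<^sub>R (x * y)"
    by transfer (simp add: fa.sc_mult_left fp_cauchy_scale fp_cauchy_mult)
  show "x * r *\<^sub>R y = r *\<^sub>R (x * y)"
    by transfer (simp add: fa.sc_mult_right fp_cauchy_scale fp_cauchy_mult)
  show "norm (x * y) \<le> norm x * norm y"
  proof transfer
    fix X Y :: "nat \<Rightarrow> ('a, 'b) free_alg" assume "fp_rel X X" "fp_rel Y Y"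
    then have "fp_cauchy X" "fp_cauchy Y" by simp_all
    note l = this
    show "lim (\<lambda>n. fp_norm (X n * Y n)) \<le> lim (\<lambda>n. fp_norm (X n)) * lim (\<lambda>n. fp_norm (Y n))"
      by (rule LIMSEQ_le[OF fp_norm_tendsto[OF fp_cauchy_mult[OF l]]
            tendsto_mult[OF fp_norm_tendsto[OF l(1)] fp_norm_tendsto[OF l(2)]]])
        (simp add: fpn_mult)
  qed
qed

end

definition fp_emb :: "('a::cstar_algebra, 'b::cstar_algebra) free_alg \<Rightarrow> ('a, 'b) free_product"
  where "fp_emb f = abs_free_product (\<lambda>_. f)"

lemma norm_fp_emb: "norm (fp_emb f) = fp_norm f"
  by (simp add: fp_emb_def norm_free_product.abs_eq fp_cauchy_const)

lemma fp_emb_add: "fp_emb (f + g) = fp_emb f + fp_emb g"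
  by (simp add: fp_emb_def plus_free_product.abs_eq fp_cauchy_const)

lemma fp_emb_mult: "fp_emb (f * g) = fp_emb f * fp_emb g"
  by (simp add: fp_emb_def times_free_product.abs_eq fp_cauchy_const)

lemma fp_emb_one: "fp_emb 1 = 1"
  by (simp add: fp_emb_def one_free_product_def)

lemma fp_emb_uminus: "fp_emb (- f) = - fp_emb f"
  by (simp add: fp_emb_def uminus_free_product.abs_eq fp_cauchy_const)

lemma fp_emb_diff: "fp_emb (f - g) = fp_emb f - fp_emb g"
  using fp_emb_add[of f "- g"] by (simp add: fp_emb_uminus)

lemma fp_emb_eqI: "fp_norm (f - g) = 0 \<Longrightarrow> fp_emb f = fp_emb g"
  using norm_fp_emb[of "f - g"] by (simp add: fp_emb_diff)

lemma fp_emb_tendsto: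
  assumes "fp_cauchy X"
  shows "(\<lambda>n. fp_emb (X n)) \<longlonglongrightarrow> abs_free_product X"
proof (rule LIMSEQ_I)
  fix e :: real assume "e > 0"
  then have "e / 2 > 0" by simp
  with assms obtain M where M: "\<And>m n. m \<ge> M \<Longrightarrow> n \<ge> M \<Longrightarrow> fp_norm (X m - X n) < e / 2"
    unfolding fp_cauchy_def by blast
  have "norm (fp_emb (X n) - abs_free_product X) < e" if "n \<ge> M" for n
  proof -
    have c: "fp_cauchy (\<lambda>m. X n + - X m)"
      by (intro fp_cauchy_add fp_cauchy_const fp_cauchy_minus assms)
    have "fp_emb (X n) - abs_free_product X = abs_free_product (\<lambda>m. X n + - X m)"
      using assms fp_cauchy_minus[OF assms] unfolding minus_free_product_def fp_emb_def
      by (simp only: uminus_free_product.abs_eq plus_free_product.abs_eq fp_cauchy_const fp_rel_self)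
    then have "norm (fp_emb (X n) - abs_free_product X) = lim (\<lambda>m. fp_norm (X n - X m))"
      using c by (simp add: norm_free_product.abs_eq)
    also have "\<dots> \<le> e / 2"
      using fp_norm_tendsto[OF c] M[OF that] by (intro Lim_bounded[where M = M]) (auto intro: less_imp_le)
    also have "\<dots> < e" using \<open>e > 0\<close> by simp
    finally show ?thesis .
  qed
  then show "\<exists>M. \<forall>n\<ge>M. norm (fp_emb (X n) - abs_free_product X) < e" by blast
qed

lemma fp_emb_seq:
  fixes x :: "('a::cstar_algebra, 'b::cstar_algebra) free_product"
  obtains X where "fp_cauchy X" "(\<lambda>n. fp_emb (X n)) \<longlonglongrightarrow> x"
proof -
  have "x \<in> abs_free_product ` {X. fp_cauchy X}"
    by (induction x rule: free_product.abs_induct) auto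
  then show thesis using fp_emb_tendsto that by blast
qed

lemma fp_emb_approx:
  fixes x :: "('a::cstar_algebra, 'b::cstar_algebra) free_product"
  assumes "e > 0" obtains f where "norm (x - fp_emb f) < e"
proof -
  obtain X where "(\<lambda>n. fp_emb (X n)) \<longlonglongrightarrow> x" by (rule fp_emb_seq)
  then obtain n where "norm (fp_emb (X n) - x) < e" using LIMSEQ_D[OF _ assms] by blast
  then show thesis using that by (simp add: norm_minus_commute)
qed

instance free_product :: (cstar_algebra, cstar_algebra) banach
proof
  fix Z :: "nat \<Rightarrow> ('a, 'b) free_product" assume Z: "Cauchy Z"
  have "\<exists>f. norm (Z n - fp_emb f) < inverse (real (Suc n))" for n
    using fp_emb_approx[of "inverse (real (Suc n))" "Z n"] by auto
  then obtain X where X: "\<And>n. norm (Z n - fp_emb (X n)) < inverse (real (Suc n))" by metis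
  have null: "(\<lambda>n. Z n - fp_emb (X n)) \<longlonglongrightarrow> 0"
    by (rule Lim_null_comparison[OF _ LIMSEQ_inverse_real_of_nat])
      (use less_imp_le[OF X] in \<open>simp add: always_eventually\<close>)
  have "Cauchy (\<lambda>n. fp_emb (X n))"
  proof (rule metric_CauchyI)
    fix e :: real assume "e > 0"
    then have e: "e / 3 > 0" by simp
    obtain M where M: "\<And>m n. m \<ge> M \<Longrightarrow> n \<ge> M \<Longrightarrow> dist (Z m) (Z n) < e / 3"
      using metric_CauchyD[OF Z e] by blast
    obtain M' where M': "\<And>n. n \<ge> M' \<Longrightarrow> dist (Z n) (fp_emb (X n)) < e / 3"
      using LIMSEQ_D[OF null e] by (auto simp: dist_norm)
    have "dist (fp_emb (X m)) (fp_emb (X n)) < e" if "m \<ge> max M M'" "n \<ge> max M M'" for m n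
      using M[of m n] M'[of m] M'[of n] that
        dist_triangle2[of "fp_emb (X m)" "fp_emb (X n)" "Z n"]
        dist_triangle[of "fp_emb (X m)" "Z n" "Z m"]
      by (simp add: dist_commute)
    then show "\<exists>M. \<forall>m\<ge>M. \<forall>n\<ge>M. dist (fp_emb (X m)) (fp_emb (X n)) < e" by blast
  qed
  then have "fp_cauchy X"
    unfolding fp_cauchy_def Cauchy_def dist_norm fp_emb_diff[symmetric] norm_fp_emb .
  then have "(\<lambda>n. Z n - fp_emb (X n) + fp_emb (X n)) \<longlonglongrightarrow> 0 + abs_free_product X"
    by (intro tendsto_add null fp_emb_tendsto)
  then show "convergent Z" by (auto simp: convergent_def)
qed

instantiation free_product :: (cstar_algebra, cstar_algebra) cstar_algebra
begin

lift_definition scaleC_free_product :: "complex \<Rightarrow> ('a, 'b) free_product \<Rightarrow> ('a, 'b) free_product"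
  is "\<lambda>c X n. fa_scale c (X n)" by (rule fp_rel_scale)

lift_definition star_free_product :: "('a, 'b) free_product \<Rightarrow> ('a, 'b) free_product"
  is "\<lambda>X n. fa_star (X n)" by (rule fp_rel_star)

instance
proof
  fix x y :: "('a, 'b) free_product" and c d :: complex and r :: real
  note [simp] = fp_cauchy_add fp_cauchy_mult fp_cauchy_scale fp_cauchy_star
  show "c *\<^sub>C (x + y) = c *\<^sub>C x + c *\<^sub>C y" by transfer (simp add: fa.sc_add)
  show "(c + d) *\<^sub>C x = c *\<^sub>C x + d *\<^sub>C x" by transfer (simp add: fa.sc_add_left)
  show "c *\<^sub>C d *\<^sub>C x = (c * d) *\<^sub>C x" by transfer (simp add: fa.sc_sc)
  show "r *\<^sub>R x = complex_of_real r *\<^sub>C x" by transfer simp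
  show "(c *\<^sub>C x) * y = c *\<^sub>C (x * y)" by transfer (simp add: fa.sc_mult_left)
  show "x * (c *\<^sub>C y) = c *\<^sub>C (x * y)" by transfer (simp add: fa.sc_mult_right)
  show "star (x + y) = star x + star y" by transfer (simp add: fa.st_add)
  show "star (c *\<^sub>C x) = cnj c *\<^sub>C star x" by transfer (simp add: fa.st_sc)
  show "star (x * y) = star y * star x" by transfer (simp add: fa.st_mult)
  show "star (star x) = x" by transfer (simp add: fa.st_st)
  show "norm (c *\<^sub>C x) = cmod c * norm x"
  proof transfer
    fix c and X :: "nat \<Rightarrow> ('a, 'b) free_alg" assume "fp_rel X X"
    then show "lim (\<lambda>n. fp_norm (fa_scale c (X n))) = cmod c * lim (\<lambda>n. fp_norm (X n))"
      by (intro limI) (simp add: fpn_scale tendsto_mult_left fp_norm_tendsto)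
  qed
  show "norm (star x * x) = (norm x)\<^sup>2"
  proof transfer
    fix X :: "nat \<Rightarrow> ('a, 'b) free_alg" assume "fp_rel X X"
    then show "lim (\<lambda>n. fp_norm (fa_star (X n) * X n)) = (lim (\<lambda>n. fp_norm (X n)))\<^sup>2"
      by (intro limI) (simp add: fpn_cstar tendsto_power fp_norm_tendsto)
  qed
qed

end

definition fp_inl :: "'a::cstar_algebra \<Rightarrow> ('a, 'b::cstar_algebra) free_product" where
  "fp_inl a = fp_emb (fa_gen (Inl a))"

definition fp_inr :: "'b::cstar_algebra \<Rightarrow> ('a::cstar_algebra, 'b) free_product" where
  "fp_inr b = fp_emb (fa_gen (Inr b))"

lemma fp_emb_scale: "fp_emb (fa_scale c f) = c *\<^sub>C fp_emb f"
  by (simp add: fp_emb_def scaleC_free_product.abs_eq fp_cauchy_const)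

lemma fp_emb_star: "fp_emb (fa_star f) = star (fp_emb f)"
  by (simp add: fp_emb_def star_free_product.abs_eq fp_cauchy_const)

lemma fp_emb_hom:
  assumes "\<forall>r\<in>hom_relations i. fp_norm r = 0" "\<And>x. fa_star (i x) = i (star x)"
  shows "unital_star_hom (\<lambda>x. fp_emb (i x))"
proof -
  note r = hom_relationsD[of i fp_norm, OF assms(1)]
  have "fp_emb (i (x + y)) = fp_emb (i x) + fp_emb (i y)" for x y
    using fp_emb_eqI[of "i (x + y)" "i x + i y"] r(1) by (simp add: fp_emb_add algebra_simps)
  moreover have "fp_emb (i (c *\<^sub>C x)) = c *\<^sub>C fp_emb (i x)" for c x
    using fp_emb_eqI[OF r(2)] by (simp add: fp_emb_scale)
  moreover have "fp_emb (i (x * y)) = fp_emb (i x) * fp_emb (i y)" for x y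
    using fp_emb_eqI[OF r(3)] by (simp add: fp_emb_mult)
  moreover have "fp_emb (i 1) = 1"
    using fp_emb_eqI[OF r(4)] by (simp add: fp_emb_one)
  moreover have "fp_emb (i (star x)) = star (fp_emb (i x))" for x
    by (simp add: fp_emb_star flip: assms(2))
  ultimately show ?thesis by (simp add: unital_star_hom_def clinear_map_def)
qed

lemma unital_star_hom_fp_inl: "unital_star_hom fp_inl"
  unfolding fp_inl_def[abs_def]
  by (rule fp_emb_hom) (use fp_norm_in in \<open>auto simp: fp_seminorms_def fa_star_gen\<close>)

lemma unital_star_hom_fp_inr: "unital_star_hom fp_inr"
  unfolding fp_inr_def[abs_def]
  by (rule fp_emb_hom) (use fp_norm_in in \<open>auto simp: fp_seminorms_def fa_star_gen\<close>)

definition word_eval :: "('l \<Rightarrow> 'd::monoid_mult) \<Rightarrow> 'l word \<Rightarrow> 'd" where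
  "word_eval p w = foldr (\<lambda>l d. p l * d) (letters w) 1"

definition fa_eval :: 
  "('a::cstar_algebra + 'b::cstar_algebra \<Rightarrow> 'd::cstar_algebra) \<Rightarrow> ('a, 'b) free_alg \<Rightarrow> 'd" where
  "fa_eval p f = Sum_any (\<lambda>w. Poly_Mapping.lookup f w *\<^sub>C word_eval p w)"

lemma word_eval_add: "word_eval p (u + v) = word_eval p u * word_eval p v"
proof -
  have "foldr (\<lambda>l d. p l * d) us e = foldr (\<lambda>l d. p l * d) us 1 * e" for us e
    by (induction us) (simp_all add: mult.assoc)
  from this[of _ "foldr (\<lambda>l d. p l * d) (letters v) 1"] show ?thesis
    by (simp add: word_eval_def plus_word_def)
qed

lemma fa_eval_add: "fa_eval p (f + g) = fa_eval p f + fa_eval p g"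
proof -
  have fin: "finite {w. Poly_Mapping.lookup h w *\<^sub>C word_eval p w \<noteq> 0}" for h
    by (rule finite_subset[OF _ finite_lookup[of h]]) auto
  show ?thesis
    by (simp add: fa_eval_def lookup_add scaleC_add_left Sum_any.distrib[OF fin fin])
qed

lemma fa_eval_single: "fa_eval p (Poly_Mapping.single w c) = c *\<^sub>C word_eval p w"
proof -
  have "(\<lambda>v. Poly_Mapping.lookup (Poly_Mapping.single w c) v *\<^sub>C word_eval p v) =
      (\<lambda>v. c *\<^sub>C word_eval p v when v = w)"
    by (auto simp: lookup_single when_def)
  then show ?thesis unfolding fa_eval_def by (simp only: Sum_any_when_equal)
qed

lemma fa_eval_zero: "fa_eval p 0 = 0"
  by (simp add: fa_eval_def)

lemma fa_eval_mult: "fa_eval p (f * g) = fa_eval p f * fa_eval p g"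
proof (induction f rule: poly_mapping_additive_induct)
  case (2 k c)
  show ?case
    by (induction g rule: poly_mapping_additive_induct)
      (simp_all add: fa_eval_zero mult_single fa_eval_single word_eval_add fa_eval_add
        algebra_simps mult_scaleC_left mult_scaleC_right scaleC_scaleC)
qed (simp_all add: fa_eval_zero fa_eval_add algebra_simps)

lemma fa_eval_one: "fa_eval p 1 = 1"
  using fa_eval_single[of p 0 1] unfolding single_one by (simp add: word_eval_def zero_word_def)

lemma fa_eval_scale: "fa_eval p (fa_scale c f) = c *\<^sub>C fa_eval p f"
  by (simp add: fa_scale_def fa_eval_mult fa_eval_single word_eval_def zero_word_def mult_scaleC_left)

lemma fa_eval_uminus: "fa_eval p (- f) = - fa_eval p f"
  using fa_eval_scale[of p "-1" f] by (simp add: fa.sc_minus scaleC_minus_one)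

lemma fa_eval_diff: "fa_eval p (f - g) = fa_eval p f - fa_eval p g"
  using fa_eval_add[of p f "- g"] by (simp add: fa_eval_uminus)

lemma fa_eval_gen: "fa_eval p (fa_gen l) = p l"
  by (simp add: fa_gen_def fa_eval_single word_eval_def)

lemma fa_eval_star:
  assumes "\<And>l. p (map_sum star star l) = star (p l)"
  shows "fa_eval p (fa_star f) = star (fa_eval p f)"
proof (induction f rule: poly_mapping_additive_induct)
  case (2 w c)
  have "word_eval p (word_star (Word ls)) = star (word_eval p (Word ls))" for ls
  proof (induction ls)
    case (Cons l ls)
    have "word_star (Word (l # ls)) = word_star (Word ls) + Word [map_sum star star l]"
      by (simp add: word_star_def plus_word_def)
    moreover have "word_eval p (Word [map_sum star star l]) = star (p l)"
      by (simp add: word_eval_def assms)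
    moreover have "word_eval p (Word (l # ls)) = p l * word_eval p (Word ls)"
      by (simp add: word_eval_def)
    ultimately show ?case using Cons by (simp add: word_eval_add star_mult)
  qed (simp add: word_star_def word_eval_def)
  from this[of "letters w"] show ?case
    by (simp add: fa_star_single fa_eval_single star_scaleC)
qed (simp_all add: fa_star_zero fa_eval_zero fa_star_add fa_eval_add star_add)

lemma fp_hom_eqI:
  fixes \<pi> \<pi>' :: "('a::cstar_algebra, 'b::cstar_algebra) free_product \<Rightarrow> 'd::cstar_algebra"
  assumes \<pi>: "unital_star_hom \<pi>" and \<pi>': "unital_star_hom \<pi>'"
    and inl: "\<And>a. \<pi> (fp_inl a) = \<pi>' (fp_inl a)" and inr: "\<And>b. \<pi> (fp_inr b) = \<pi>' (fp_inr b)"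
  shows "\<pi> = \<pi>'"
proof
  have gen: "\<pi> (fp_emb (fa_gen l)) = \<pi>' (fp_emb (fa_gen l))" for l
    using inl inr by (cases l) (simp_all add: fp_inl_def fp_inr_def)
  have zero: "\<rho> 0 = 0" if "unital_star_hom \<rho>" 
    for \<rho> :: "('a::cstar_algebra, 'b::cstar_algebra) free_product \<Rightarrow> 'd"
    using unital_star_hom_contractive[OF that, of 0] by simp
  note h = \<pi>[unfolded unital_star_hom_def clinear_map_def] \<pi>'[unfolded unital_star_hom_def clinear_map_def]
  have emb: "\<pi> (fp_emb f) = \<pi>' (fp_emb f)" for f
  proof (induction f rule: poly_mapping_additive_induct)
    case 1
    have "fp_emb 0 = (0 :: ('a, 'b) free_product)" using fp_emb_diff[of 0 0] by simp
    then show ?case using zero[OF \<pi>] zero[OF \<pi>'] by simp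
  next
    case (2 w c)
    have "\<pi> (fp_emb (Poly_Mapping.single (Word ls) c)) = \<pi>' (fp_emb (Poly_Mapping.single (Word ls) c))" for ls
    proof (induction ls)
      case Nil
      show ?case using h by (simp add: single_Word_Nil fp_emb_scale fp_emb_one)
    next
      case (Cons l ls)
      then show ?case using h gen unfolding single_Word_Cons fp_emb_mult by metis
    qed
    from this[of "letters w"] show ?case by simp
  next
    case (3 f g)
    then show ?case using h by (simp add: fp_emb_add)
  qed
  have lim: "(\<lambda>n. \<rho> (fp_emb (X n))) \<longlonglongrightarrow> \<rho> z"
    if "unital_star_hom \<rho>" "(\<lambda>n. fp_emb (X n)) \<longlonglongrightarrow> z" 
    for \<rho> :: "('a, 'b) free_product \<Rightarrow> 'd" and X z
  proof (rule LIM_zero_cancel, rule Lim_null_comparison)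
    show "(\<lambda>n. norm (fp_emb (X n) - z)) \<longlonglongrightarrow> 0"
      using that(2) by (simp add: LIM_zero_iff tendsto_norm_zero)
    have "\<rho> (fp_emb (X n)) - \<rho> z = \<rho> (fp_emb (X n) - z)" for n
    proof -
      have "\<rho> (fp_emb (X n)) = \<rho> (fp_emb (X n) - z + z)" by simp
      also have "\<dots> = \<rho> (fp_emb (X n) - z) + \<rho> z"
        using that(1) unfolding unital_star_hom_def clinear_map_def by blast
      finally show ?thesis by simp
    qed
    then show "\<forall>\<^sub>F n in sequentially. norm (\<rho> (fp_emb (X n)) - \<rho> z) \<le> norm (fp_emb (X n) - z)"
      using unital_star_hom_contractive[OF that(1)] by simp
  qed
  fix z :: "('a, 'b) free_product"
  obtain X where X: "(\<lambda>n. fp_emb (X n)) \<longlonglongrightarrow> z" by (rule fp_emb_seq)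
  have "(\<lambda>n. \<pi> (fp_emb (X n))) \<longlonglongrightarrow> \<pi>' z"
    using lim[OF \<pi>' X] by (simp add: emb)
  then show "\<pi> z = \<pi>' z" using lim[OF \<pi> X] LIMSEQ_unique by blast
qed

text \<open>The universal property characterising the full free product.\<close>

theorem free_product_universal:
  fixes \<pi>1 :: "'a::cstar_algebra \<Rightarrow> 'd::cstar_algebra" and \<pi>2 :: "'b::cstar_algebra \<Rightarrow> 'd"
  assumes \<pi>1: "unital_star_hom \<pi>1" and \<pi>2: "unital_star_hom \<pi>2"
  shows "\<exists>!\<pi>. unital_star_hom \<pi> \<and> \<pi> \<circ> fp_inl = \<pi>1 \<and> \<pi> \<circ> fp_inr = \<pi>2"
proof -
  define p where "p = case_sum \<pi>1 \<pi>2"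
  let ?E = "fa_eval p"
  note h = \<pi>1[unfolded unital_star_hom_def clinear_map_def] \<pi>2[unfolded unital_star_hom_def clinear_map_def]
  have pstar: "p (map_sum star star l) = star (p l)" for l
    using h by (cases l) (simp_all add: p_def)
  have est: "?E (fa_star f) = star (?E f)" for f by (rule fa_eval_star) (rule pstar)
  have "(\<lambda>f. norm (?E f)) \<in> fp_seminorms"
    unfolding fp_seminorms_def
  proof (intro CollectI conjI ballI)
    show "cstar_seminorm fa_scale fa_star (\<lambda>f. norm (?E f))"
      unfolding cstar_seminorm_def
      by (simp add: fa_eval_add fa_eval_mult fa_eval_scale est
          norm_triangle_ineq norm_mult_ineq norm_scaleC norm_star_mult)
    fix r :: "('a, 'b) free_alg"
    assume "r \<in> hom_relations (\<lambda>a. fa_gen (Inl a)) \<union> hom_relations (\<lambda>b. fa_gen (Inr b))"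
    then have "?E r = 0"
      using h unfolding hom_relations_def
      by (auto simp: fa_eval_add fa_eval_diff fa_eval_mult fa_eval_scale fa_eval_gen fa_eval_one p_def)
    then show "norm (?E r) = 0" by simp
  qed
  then have le: "norm (?E f) \<le> fp_norm f" for f by (rule le_fp_norm)
  have dle: "norm (?E f - ?E g) \<le> norm (fp_emb f - fp_emb g)" for f g
    using le[of "f - g"] by (simp add: fa_eval_diff norm_fp_emb flip: fp_emb_diff)
  have ex: "\<exists>d. \<forall>X. (\<lambda>n. fp_emb (X n)) \<longlonglongrightarrow> z \<longrightarrow> (\<lambda>n. ?E (X n)) \<longlonglongrightarrow> d"
    for z :: "('a, 'b) free_product"
  proof -
    obtain Y :: "nat \<Rightarrow> ('a, 'b) free_alg" where Y: "(\<lambda>n. fp_emb (Y n)) \<longlonglongrightarrow> z" by (rule fp_emb_seq)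
    have "Cauchy (\<lambda>n. ?E (Y n))"
      using LIMSEQ_imp_Cauchy[OF Y] dle unfolding Cauchy_def dist_norm by (meson le_less_trans)
    then obtain d where d: "(\<lambda>n. ?E (Y n)) \<longlonglongrightarrow> d"
      using Cauchy_convergent convergent_def by blast
    have "(\<lambda>n. ?E (X n)) \<longlonglongrightarrow> d" if X: "(\<lambda>n. fp_emb (X n)) \<longlonglongrightarrow> z" for X
    proof -
      have "(\<lambda>n. norm (fp_emb (X n) - fp_emb (Y n))) \<longlonglongrightarrow> 0"
        using tendsto_norm_zero[OF LIM_zero[OF X]] tendsto_diff[OF X Y] 
        by (simp add: tendsto_norm_zero)
      then have "(\<lambda>n. ?E (X n) - ?E (Y n)) \<longlonglongrightarrow> 0"
        by (rule Lim_null_comparison[rotated]) (simp add: dle)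
      from tendsto_add[OF this d] show ?thesis by simp
    qed
    then show ?thesis by blast
  qed
  then obtain \<pi> where lim: "\<And>z X. (\<lambda>n. fp_emb (X n)) \<longlonglongrightarrow> z \<Longrightarrow> (\<lambda>n. ?E (X n)) \<longlonglongrightarrow> \<pi> z" by metis
  have emb: "\<pi> (fp_emb f) = ?E f" for f
    using lim[of "\<lambda>_. f" "fp_emb f"] LIMSEQ_unique tendsto_const by blast
  have add: "\<pi> (x + y) = \<pi> x + \<pi> y" for x y
  proof -
    obtain X Y where XY: "(\<lambda>n. fp_emb (X n)) \<longlonglongrightarrow> x" "(\<lambda>n. fp_emb (Y n)) \<longlonglongrightarrow> y" using fp_emb_seq by metis
    show ?thesis
      using lim[of "\<lambda>n. X n + Y n" "x + y"] tendsto_add[OF XY] tendsto_add[OF lim[OF XY(1)] lim[OF XY(2)]]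
      by (simp add: fp_emb_add fa_eval_add LIMSEQ_unique)
  qed
  have mult: "\<pi> (x * y) = \<pi> x * \<pi> y" for x y
  proof -
    obtain X Y where XY: "(\<lambda>n. fp_emb (X n)) \<longlonglongrightarrow> x" "(\<lambda>n. fp_emb (Y n)) \<longlonglongrightarrow> y" using fp_emb_seq by metis
    show ?thesis
      using lim[of "\<lambda>n. X n * Y n" "x * y"] tendsto_mult[OF XY] tendsto_mult[OF lim[OF XY(1)] lim[OF XY(2)]]
      by (simp add: fp_emb_mult fa_eval_mult LIMSEQ_unique)
  qed
  have scale: "\<pi> (c *\<^sub>C x) = c *\<^sub>C \<pi> x" for c x
  proof -
    have bl: "bounded_linear ((*\<^sub>C) c :: 'e \<Rightarrow> 'e::cstar_algebra)"
      by (rule bounded_linear_intro[where K = "cmod c"])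
        (simp_all add: scaleC_add_right scaleR_scaleC scaleC_scaleC norm_scaleC mult.commute)
    obtain X where X: "(\<lambda>n. fp_emb (X n)) \<longlonglongrightarrow> x" by (rule fp_emb_seq)
    show ?thesis
      using lim[of "\<lambda>n. fa_scale c (X n)" "c *\<^sub>C x"] bounded_linear.tendsto[OF bl X]
        bounded_linear.tendsto[OF bl lim[OF X]]
      by (simp add: fp_emb_scale fa_eval_scale LIMSEQ_unique)
  qed
  have st: "\<pi> (star x) = star (\<pi> x)" for x
  proof -
    obtain X where X: "(\<lambda>n. fp_emb (X n)) \<longlonglongrightarrow> x" by (rule fp_emb_seq)
    show ?thesis
      using lim[of "\<lambda>n. fa_star (X n)" "star x"] bounded_linear.tendsto[OF bounded_linear_star X]
        bounded_linear.tendsto[OF bounded_linear_star lim[OF X]]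
      by (simp add: fp_emb_star est LIMSEQ_unique)
  qed
  have "unital_star_hom \<pi>"
    using add mult scale st emb[of 1] by (simp add: unital_star_hom_def clinear_map_def fp_emb_one fa_eval_one)
  moreover have "\<pi> \<circ> fp_inl = \<pi>1" "\<pi> \<circ> fp_inr = \<pi>2"
    by (auto simp: fp_inl_def fp_inr_def emb fa_eval_gen p_def)
  ultimately show ?thesis
  proof (intro ex1I[of _ \<pi>] conjI)
    fix \<pi>' assume *: "unital_star_hom \<pi>' \<and> \<pi>' \<circ> fp_inl = \<pi>1 \<and> \<pi>' \<circ> fp_inr = \<pi>2"
    show "\<pi>' = \<pi>"
      by (rule fp_hom_eqI)
        (use * \<open>unital_star_hom \<pi>\<close> \<open>\<pi> \<circ> fp_inl = \<pi>1\<close> \<open>\<pi> \<circ> fp_inr = \<pi>2\<close>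
          in \<open>auto simp: fun_eq_iff\<close>)
  qed
qed

section \<open>Unital completely positive maps\<close>

definition cstar_pos :: "'a::cstar_algebra \<Rightarrow> bool" where
  "cstar_pos z \<longleftrightarrow> (\<exists>y. z = star y * y)"

text \<open>Positivity of the \<open>n \<times> n\<close> matrix \<open>(Z i j)\<^bsub>i,j<n\<^esub>\<close>: \<open>Z = Y\<^sup>* Y\<close> for some \<open>n \<times> n\<close> matrix \<open>Y\<close>.\<close>

definition mat_pos :: "nat \<Rightarrow> (nat \<Rightarrow> nat \<Rightarrow> 'a::cstar_algebra) \<Rightarrow> bool" where
  "mat_pos n Z \<longleftrightarrow> (\<exists>Y. \<forall>i<n. \<forall>j<n. Z i j = (\<Sum>k<n. star (Y k i) * Y k j))"

definition completely_positive :: "('a::cstar_algebra \<Rightarrow> 'b::cstar_algebra) \<Rightarrow> bool" where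
  "completely_positive \<phi> \<longleftrightarrow> (\<forall>n Z. mat_pos n Z \<longrightarrow> mat_pos n (\<lambda>i j. \<phi> (Z i j)))"

definition UCP :: "('a::cstar_algebra \<Rightarrow> 'b::cstar_algebra) set" where
  "UCP = {\<phi>. clinear_map \<phi> \<and> completely_positive \<phi> \<and> \<phi> 1 = 1}"

definition couplings :: "('a::cstar_algebra \<Rightarrow> 'b::cstar_algebra) \<Rightarrow> ('a \<Rightarrow> 'b) \<Rightarrow>
    (('a, 'a) free_product \<Rightarrow> 'b) set" where
  "couplings \<phi>1 \<phi>2 = {\<phi> \<in> UCP. \<phi> \<circ> fp_inl = \<phi>1 \<and> \<phi> \<circ> fp_inr = \<phi>2}"

section \<open>Hilbert modules\<close>

record ('e, 'b) hmod =
  hcarrier :: "'e set"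
  hzero :: 'e
  hadd :: "'e \<Rightarrow> 'e \<Rightarrow> 'e"
  hscale :: "complex \<Rightarrow> 'e \<Rightarrow> 'e"
  hact :: "'e \<Rightarrow> 'b \<Rightarrow> 'e"
  hinner :: "'e \<Rightarrow> 'e \<Rightarrow> 'b"

definition hdiff :: "('e, 'b) hmod \<Rightarrow> 'e \<Rightarrow> 'e \<Rightarrow> 'e" where
  "hdiff E x y = hadd E x (hscale E (-1) y)"

definition hnorm :: "('e, 'b::cstar_algebra) hmod \<Rightarrow> 'e \<Rightarrow> real" where
  "hnorm E x = sqrt (norm (hinner E x x))"

locale hilbert_module =
  fixes E :: "('e, 'b::cstar_algebra) hmod"
  assumes zero_closed: "hzero E \<in> hcarrier E"
    and add_closed: "x \<in> hcarrier E \<Longrightarrow> y \<in> hcarrier E \<Longrightarrow> hadd E x y \<in> hcarrier E"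
    and scale_closed: "x \<in> hcarrier E \<Longrightarrow> hscale E c x \<in> hcarrier E"
    and act_closed: "x \<in> hcarrier E \<Longrightarrow> hact E x b \<in> hcarrier E"
    and add_assoc: "x \<in> hcarrier E \<Longrightarrow> y \<in> hcarrier E \<Longrightarrow> z \<in> hcarrier E \<Longrightarrow>
      hadd E (hadd E x y) z = hadd E x (hadd E y z)"
    and add_commute: "x \<in> hcarrier E \<Longrightarrow> y \<in> hcarrier E \<Longrightarrow> hadd E x y = hadd E y x"
    and add_zero: "x \<in> hcarrier E \<Longrightarrow> hadd E (hzero E) x = x"
    and add_inverse: "x \<in> hcarrier E \<Longrightarrow> hadd E x (hscale E (-1) x) = hzero E"
    and scale_one: "x \<in> hcarrier E \<Longrightarrow> hscale E 1 x = x"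
    and scale_scale: "x \<in> hcarrier E \<Longrightarrow> hscale E c (hscale E d x) = hscale E (c * d) x"
    and scale_add_right: "x \<in> hcarrier E \<Longrightarrow> y \<in> hcarrier E \<Longrightarrow>
      hscale E c (hadd E x y) = hadd E (hscale E c x) (hscale E c y)"
    and scale_add_left: "x \<in> hcarrier E \<Longrightarrow>
      hscale E (c + d) x = hadd E (hscale E c x) (hscale E d x)"
    and act_one: "x \<in> hcarrier E \<Longrightarrow> hact E x 1 = x"
    and act_mult: "x \<in> hcarrier E \<Longrightarrow> hact E x (a * b) = hact E (hact E x a) b"
    and act_add_left: "x \<in> hcarrier E \<Longrightarrow> y \<in> hcarrier E \<Longrightarrow>
      hact E (hadd E x y) b = hadd E (hact E x b) (hact E y b)"
    and act_add_right: "x \<in> hcarrier E \<Longrightarrow> hact E x (a + b) = hadd E (hact E x a) (hact E x b)"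
    and act_scale_left: "x \<in> hcarrier E \<Longrightarrow> hact E (hscale E c x) b = hscale E c (hact E x b)"
    and act_scale_right: "x \<in> hcarrier E \<Longrightarrow> hact E x (c *\<^sub>C b) = hscale E c (hact E x b)"
    and inner_add_right: "x \<in> hcarrier E \<Longrightarrow> y \<in> hcarrier E \<Longrightarrow> z \<in> hcarrier E \<Longrightarrow>
      hinner E x (hadd E y z) = hinner E x y + hinner E x z"
    and inner_scale_right: "x \<in> hcarrier E \<Longrightarrow> y \<in> hcarrier E \<Longrightarrow>
      hinner E x (hscale E c y) = c *\<^sub>C hinner E x y"
    and inner_act_right: "x \<in> hcarrier E \<Longrightarrow> y \<in> hcarrier E \<Longrightarrow>
      hinner E x (hact E y b) = hinner E x y * b"
    and inner_star: "x \<in> hcarrier E \<Longrightarrow> y \<in> hcarrier E \<Longrightarrow> star (hinner E x y) = hinner E y x"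
    and inner_pos: "x \<in> hcarrier E \<Longrightarrow> cstar_pos (hinner E x x)"
    and inner_eq_zero: "x \<in> hcarrier E \<Longrightarrow> hinner E x x = 0 \<Longrightarrow> x = hzero E"
    and complete: "(\<And>n. X n \<in> hcarrier E) \<Longrightarrow>
      (\<And>e. e > 0 \<Longrightarrow> \<exists>M. \<forall>m\<ge>M. \<forall>n\<ge>M. hnorm E (hdiff E (X m) (X n)) < e) \<Longrightarrow>
      \<exists>l\<in>hcarrier E. (\<lambda>n. hnorm E (hdiff E (X n) l)) \<longlonglongrightarrow> 0"

definition is_adjoint :: "('e, 'b) hmod \<Rightarrow> ('e \<Rightarrow> 'e) \<Rightarrow> ('e \<Rightarrow> 'e) \<Rightarrow> bool" where
  "is_adjoint E T S \<longleftrightarrow>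
     (\<forall>x\<in>hcarrier E. \<forall>y\<in>hcarrier E. hinner E (T x) y = hinner E x (S y))"

text \<open>Adjointability forces \<open>T\<close> to be \<open>\<complex>\<close>-linear and right module linear.\<close>

definition adjointable_maps :: "('e, 'b::cstar_algebra) hmod \<Rightarrow> ('e \<Rightarrow> 'e) set" where
  "adjointable_maps E = {T. T \<in> hcarrier E \<rightarrow> hcarrier E \<and>
     (\<exists>S \<in> hcarrier E \<rightarrow> hcarrier E. is_adjoint E T S) \<and>
     (\<exists>C. \<forall>x\<in>hcarrier E. hnorm E (T x) \<le> C * hnorm E x)}"

text \<open>Unital star homomorphisms into the C*-algebra of bounded adjointable maps, whose elements
  are identified when they agree on the carrier.\<close>

definition left_action :: "('e, 'b::cstar_algebra) hmod \<Rightarrow> ('c::cstar_algebra \<Rightarrow> 'e \<Rightarrow> 'e) \<Rightarrow> bool" where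
  "left_action E \<sigma> \<longleftrightarrow>
     (\<forall>a. \<sigma> a \<in> adjointable_maps E) \<and>
     (\<forall>a. is_adjoint E (\<sigma> a) (\<sigma> (star a))) \<and>
     (\<forall>x\<in>hcarrier E. \<sigma> 1 x = x \<and>
        (\<forall>a b. \<sigma> (a + b) x = hadd E (\<sigma> a x) (\<sigma> b x)) \<and>
        (\<forall>c a. \<sigma> (c *\<^sub>C a) x = hscale E c (\<sigma> a x)) \<and>
        (\<forall>a b. \<sigma> (a * b) x = \<sigma> a (\<sigma> b x)))"

inductive_set hspan :: "('e, 'b) hmod \<Rightarrow> 'e set \<Rightarrow> 'e set" for E S where
  zero: "hzero E \<in> hspan E S"
| insert: "s \<in> S \<Longrightarrow> y \<in> hspan E S \<Longrightarrow> hadd E (hscale E c s) y \<in> hspan E S"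

definition closed_hspan :: "('e, 'b::cstar_algebra) hmod \<Rightarrow> 'e set \<Rightarrow> 'e set" where
  "closed_hspan E S = {y \<in> hcarrier E. \<forall>e>0. \<exists>z\<in>hspan E S. hnorm E (hdiff E y z) < e}"

section \<open>Joint representation modules\<close>

type_synonym ('e, 'a, 'b) joint_rep =
  "('e, 'b) hmod \<times> ('a \<Rightarrow> 'e \<Rightarrow> 'e) \<times> ('a \<Rightarrow> 'e \<Rightarrow> 'e) \<times> 'e"

definition joint_reps :: "('a::cstar_algebra \<Rightarrow> 'b::cstar_algebra) \<Rightarrow> ('a \<Rightarrow> 'b) \<Rightarrow>
    ('e, 'a, 'b) joint_rep set" where
  "joint_reps \<phi>1 \<phi>2 = {(E, \<sigma>1, \<sigma>2, x).
     hilbert_module E \<and> left_action E \<sigma>1 \<and> left_action E \<sigma>2 \<and>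
     x \<in> hcarrier E \<and> hinner E x x = 1 \<and>
     (\<forall>a. \<phi>1 a = hinner E x (\<sigma>1 a x)) \<and> (\<forall>a. \<phi>2 a = hinner E x (\<sigma>2 a x))}"

text \<open>A letter \<open>Inl a\<close> of the word \<open>w\<close> acts by \<open>\<sigma>1 a\<close>, a letter \<open>Inr a\<close> by \<open>\<sigma>2 a\<close>.\<close>

definition minimal_joint_reps :: "('a::cstar_algebra \<Rightarrow> 'b::cstar_algebra) \<Rightarrow> ('a \<Rightarrow> 'b) \<Rightarrow>
    ('e, 'a, 'b) joint_rep set" where
  "minimal_joint_reps \<phi>1 \<phi>2 = {(E, \<sigma>1, \<sigma>2, x) \<in> joint_reps \<phi>1 \<phi>2.
     hcarrier E = closed_hspan E {foldr (case_sum \<sigma>1 \<sigma>2) w (hact E x b) |w b. w \<noteq> []}}"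

fun joint_rep_iso :: "('e, 'a, 'b) joint_rep \<Rightarrow> ('f, 'a, 'b) joint_rep \<Rightarrow> bool" where
  "joint_rep_iso (E, \<sigma>1, \<sigma>2, x) (F, \<tau>1, \<tau>2, y) \<longleftrightarrow>
     (\<exists>U. bij_betw U (hcarrier E) (hcarrier F) \<and>
        (\<forall>u\<in>hcarrier E. \<forall>v\<in>hcarrier E. U (hadd E u v) = hadd F (U u) (U v)) \<and>
        (\<forall>u\<in>hcarrier E. \<forall>c. U (hscale E c u) = hscale F c (U u)) \<and>
        (\<forall>u\<in>hcarrier E. \<forall>b. U (hact E u b) = hact F (U u) b) \<and>
        (\<forall>u\<in>hcarrier E. \<forall>v\<in>hcarrier E. hinner F (U u) (U v) = hinner E u v) \<and>
        (\<forall>u\<in>hcarrier E. \<forall>a. U (\<sigma>1 a u) = \<tau>1 a (U u) \<and> U (\<sigma>2 a u) = \<tau>2 a (U u)) \<and>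
        U x = y)"

definition iso_rel :: "('a::cstar_algebra \<Rightarrow> 'b::cstar_algebra) \<Rightarrow> ('a \<Rightarrow> 'b) \<Rightarrow>
    ('e, 'a, 'b) joint_rep rel" where
  "iso_rel \<phi>1 \<phi>2 = {(R, S). R \<in> minimal_joint_reps \<phi>1 \<phi>2 \<and> S \<in> minimal_joint_reps \<phi>1 \<phi>2 \<and>
     joint_rep_iso R S}"

text \<open>\<open>\<phi>(c) = \<langle>x, (\<sigma>1 * \<sigma>2)(c) x\<rangle>\<close>, where \<open>\<sigma>1 * \<sigma>2\<close> is the action of the free product
  extending \<open>\<sigma>1\<close> and \<open>\<sigma>2\<close>.\<close>

fun induces :: "('e, 'a::cstar_algebra, 'b::cstar_algebra) joint_rep \<Rightarrow>
    (('a, 'a) free_product \<Rightarrow> 'b) \<Rightarrow> bool" where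
  "induces (E, \<sigma>1, \<sigma>2, x) \<phi> \<longleftrightarrow>
     (\<exists>\<sigma>. left_action E \<sigma> \<and>
        (\<forall>a. \<forall>u\<in>hcarrier E. \<sigma> (fp_inl a) u = \<sigma>1 a u \<and> \<sigma> (fp_inr a) u = \<sigma>2 a u) \<and>
        (\<forall>c. \<phi> c = hinner E x (\<sigma> c x)))"

text \<open>All Hilbert modules form a proper class, so the bijection is stated for modules carried by
  subsets of one fixed type. It is large enough for every minimal module: a vector is a limit of a
  sequence of finite sums of vectors \<open>\<sigma>\<^bsub>\<epsilon>1\<^esub>(a1) \<dots> \<sigma>\<^bsub>\<epsilon>k\<^esub>(ak) x b\<close>, and each summand is
  encoded by the pair of the word and \<open>b\<close>.\<close>

type_synonym ('a, 'b) module_universe = "nat \<Rightarrow> (('a + 'a) list \<times> 'b) list"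

end

theory Submission
  imports Defs
begin

text \<open>
  A joint representation \<open>(E, \<sigma>1, \<sigma>2, x)\<close> yields the map \<open>c \<mapsto> \<langle>x, (\<sigma>1 * \<sigma>2)(c) x\<rangle>\<close> on the free product,
  where \<open>\<sigma>1 * \<sigma>2\<close> exists because the operator norm of the action of the free algebra on \<open>E\<close> is one of
  the seminorms defining the free product. This map is determined by the moments \<open>\<langle>x, w x\<rangle>\<close>, \<open>w\<close> a
  word, and these are also the Gram matrix of the vectors \<open>w x b\<close>, which are total in a minimal module;
  so two minimal modules are isomorphic if and only if they induce the same map. Every coupling \<open>\<phi>\<close> is
  induced by the Hilbert module with reproducing kernel \<open>(a, c) \<mapsto> \<phi>(a\<^sup>* c)\<close>, on which the free product
  acts by translation.
\<close>
section \<open>Square roots and positive elements\<close>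

text \<open>Positivity is defined by the existence of a factor, \<open>star y * y\<close> for
  elements and \<open>mat_pos\<close> for matrices, and such a definition says nothing about sums,
  limits or order. The bridge is the binomial series of the square root: for selfadjoint a it turns
  the norm condition norm (t - a) <= t into a factorization, and norm conditions add up and pass to
  limits. Matrices over B are handled by the same series, entry by entry, so that complete
  positivity of a vector state reduces to positivity of a form with values in B. The second obstacle
  is that a Hilbert module is a record on an arbitrary carrier, whose operations are mere fields.
  Vectors are therefore compared, and finite sums and operators constructed, through inner products
  with values in B. The kernel form of the module of a coupling serves the same end: its vectors are
  genuine functions on the free product, so neither a quotient by null vectors nor an abstract
  completion is formed. Representations on different carrier types are compared through their
  moments, which lie in B.\<close>

definition sqrt_coeff :: "nat \<Rightarrow> real" where
  "sqrt_coeff n = (1/2 gchoose n) * (-1) ^ n"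

lemma sqrt_coeff_0 [simp]: "sqrt_coeff 0 = 1"
  by (simp add: sqrt_coeff_def)

lemma sqrt_coeff_pochhammer: "sqrt_coeff n = pochhammer (-1/2) n / fact n"
  by (simp add: sqrt_coeff_def gbinomial_pochhammer flip: power_mult_distrib)

lemma sqrt_coeff_Suc_nonpos: "sqrt_coeff (Suc n) \<le> 0"
  by (simp add: sqrt_coeff_pochhammer pochhammer_rec divide_nonpos_pos pochhammer_nonneg)

text \<open>The terms after the first are nonpositive, so their absolute sum is 1 minus a partial
  sum of the series at x = 1. That partial sum is a coefficient of the series of (1 - x) to the
  power -1/2, hence nonnegative. The constant 1 reappears as the bound on
  \<open>norm (1 - c)\<close> in \<open>sqrt_one_minus_ball\<close>.\<close>

lemma sum_abs_sqrt_coeff_Suc: "(\<Sum>k<n. \<bar>sqrt_coeff (Suc k)\<bar>) \<le> 1"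
proof -
  have "(\<Sum>k\<le>n. sqrt_coeff k) = pochhammer (1/2) n / fact n"
    unfolding sqrt_coeff_def gbinomial_sum_lower_neg
    by (simp add: gbinomial_pochhammer flip: power_mult_distrib)
  then have "0 \<le> (\<Sum>k\<le>n. sqrt_coeff k)"
    by (simp add: pochhammer_nonneg)
  moreover have "(\<Sum>k\<le>n. sqrt_coeff k) = 1 + (\<Sum>k<n. sqrt_coeff (Suc k))"
    by (simp add: sum.atMost_shift)
  moreover have "(\<Sum>k<n. \<bar>sqrt_coeff (Suc k)\<bar>) = - (\<Sum>k<n. sqrt_coeff (Suc k))"
    by (simp add: sum_negf[symmetric] abs_of_nonpos sqrt_coeff_Suc_nonpos)
  ultimately show ?thesis by linarith
qed

lemma summable_abs_sqrt_coeff: "summable (\<lambda>n. \<bar>sqrt_coeff n\<bar>)"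
proof -
  have "summable (\<lambda>n. \<bar>sqrt_coeff (Suc n)\<bar>)"
    by (rule bounded_imp_summable[where B = 1])
      (use sum_abs_sqrt_coeff_Suc[of "Suc _"] in \<open>auto simp: lessThan_Suc_atMost\<close>)
  then show ?thesis by (rule summable_Suc_iff[THEN iffD1])
qed

text \<open>The coefficients of the squared series; by Vandermonde's identity they are those of 1 -
  x.\<close>

lemma sqrt_coeff_convolution:
  "(\<Sum>i\<le>k. sqrt_coeff i * sqrt_coeff (k - i)) = (if k = 0 then 1 else if k = 1 then -1 else 0)"
proof -
  have "(\<Sum>i\<le>k. sqrt_coeff i * sqrt_coeff (k - i)) =
      (\<Sum>i\<le>k. (1/2 gchoose i) * (1/2 gchoose (k - i))) * (-1) ^ k"
    unfolding sum_distrib_right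
  proof (rule sum.cong[OF refl])
    fix i assume "i \<in> {..k}"
    then have "(-1::real) ^ k = (-1) ^ i * (-1) ^ (k - i)" by (simp flip: power_add)
    then show "sqrt_coeff i * sqrt_coeff (k - i) = (1/2 gchoose i) * (1/2 gchoose (k - i)) * (-1) ^ k"
      unfolding sqrt_coeff_def by (simp only: mult_ac)
  qed
  also have "(\<Sum>i\<le>k. ((1/2::real) gchoose i) * (1/2 gchoose (k - i))) = (1 gchoose k)"
    using gbinomial_Vandermonde[of "1/2::real" "1/2" k] by (simp add: atMost_atLeast0)
  also have "(1::real) gchoose k = of_nat (1 choose k)"
    using binomial_gbinomial[of 1 k, where ?'a = real] by simp
  finally show ?thesis by (cases k; cases "k - 1") (auto simp: binomial_eq_0)
qed

text \<open>The binomial series of \<open>\<surd>(1 - x)\<close> converges absolutely up to the boundary of the unit ball,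
  and for matrices it only needs a bound on the entries of the powers \<open>P k\<close> of \<open>P 1\<close>.\<close>

lemma binomial_sqrt:
  fixes P :: "nat \<Rightarrow> nat \<Rightarrow> nat \<Rightarrow> 'a::cstar_algebra"
  assumes bound: "\<And>k i j. i < n \<Longrightarrow> j < n \<Longrightarrow> norm (P k i j) \<le> C"
    and pow: "\<And>k l i j. i < n \<Longrightarrow> j < n \<Longrightarrow> P (k + l) i j = (\<Sum>m<n. P k i m * P l m j)"
  defines "S \<equiv> \<lambda>i j. suminf (\<lambda>k. sqrt_coeff k *\<^sub>R P k i j)"
  shows "\<And>i j. i < n \<Longrightarrow> j < n \<Longrightarrow> summable (\<lambda>k. norm (sqrt_coeff k *\<^sub>R P k i j))"
    and "\<And>i j. i < n \<Longrightarrow> j < n \<Longrightarrow> (\<Sum>m<n. S i m * S m j) = P 0 i j - P 1 i j"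
proof -
  show abs: "summable (\<lambda>k. norm (sqrt_coeff k *\<^sub>R P k i j))" if "i < n" "j < n" for i j
  proof (rule summable_comparison_test)
    show "summable (\<lambda>k. \<bar>sqrt_coeff k\<bar> * C)"
      by (rule summable_mult2[OF summable_abs_sqrt_coeff])
    show "\<exists>N. \<forall>k\<ge>N. norm (norm (sqrt_coeff k *\<^sub>R P k i j)) \<le> \<bar>sqrt_coeff k\<bar> * C"
      using bound[OF that] by (auto intro!: mult_left_mono)
  qed
  show "(\<Sum>m<n. S i m * S m j) = P 0 i j - P 1 i j" if ij: "i < n" "j < n" for i j
  proof -
    have "(\<lambda>k. \<Sum>l\<le>k. (sqrt_coeff l *\<^sub>R P l i m) * (sqrt_coeff (k - l) *\<^sub>R P (k - l) m j)) sums (S i m * S m j)"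
      if "m < n" for m
      unfolding S_def by (rule Cauchy_product_sums) (use abs ij that in auto)
    then have "(\<lambda>k. \<Sum>m<n. \<Sum>l\<le>k. (sqrt_coeff l *\<^sub>R P l i m) * (sqrt_coeff (k - l) *\<^sub>R P (k - l) m j))
        sums (\<Sum>m<n. S i m * S m j)"
      by (intro sums_sum) auto
    moreover have "(\<Sum>m<n. \<Sum>l\<le>k. (sqrt_coeff l *\<^sub>R P l i m) * (sqrt_coeff (k - l) *\<^sub>R P (k - l) m j)) =
        (if k = 0 then 1 else if k = 1 then -1 else 0) *\<^sub>R P k i j" for k
    proof -
      have "(\<Sum>m<n. \<Sum>l\<le>k. (sqrt_coeff l *\<^sub>R P l i m) * (sqrt_coeff (k - l) *\<^sub>R P (k - l) m j)) =
          (\<Sum>l\<le>k. (sqrt_coeff l * sqrt_coeff (k - l)) *\<^sub>R (\<Sum>m<n. P l i m * P (k - l) m j))"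
        by (subst sum.swap) (simp add: scaleR_sum_right mult.commute)
      also have "\<dots> = (\<Sum>l\<le>k. (sqrt_coeff l * sqrt_coeff (k - l)) *\<^sub>R P k i j)"
      proof (rule sum.cong[OF refl])
        fix l assume "l \<in> {..k}"
        then have "P k i j = (\<Sum>m<n. P l i m * P (k - l) m j)"
          using pow[OF ij, of l "k - l"] by simp
        then show "(sqrt_coeff l * sqrt_coeff (k - l)) *\<^sub>R (\<Sum>m<n. P l i m * P (k - l) m j) =
            (sqrt_coeff l * sqrt_coeff (k - l)) *\<^sub>R P k i j" by (simp only:)
      qed
      also have "\<dots> = (\<Sum>l\<le>k. sqrt_coeff l * sqrt_coeff (k - l)) *\<^sub>R P k i j"
        by (simp add: scaleR_left.sum)
      finally show ?thesis by (simp only: sqrt_coeff_convolution)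
    qed
    ultimately have 1: "(\<lambda>k. (if k = 0 then 1 else if k = 1 then -1 else 0::real) *\<^sub>R P k i j) sums (\<Sum>m<n. S i m * S m j)"
      by (simp only:)
    have "(\<lambda>k. (if k = 0 then 1 else if k = 1 then -1 else 0::real) *\<^sub>R P k i j) sums
        (\<Sum>k<2. (if k = 0 then 1 else if k = 1 then -1 else 0::real) *\<^sub>R P k i j)"
      by (rule sums_finite) auto
    from sums_unique2[OF 1 this] show ?thesis by (simp add: numeral_2_eq_2)
  qed
qed

lemma norm_one_le: "norm (1::'a::cstar_algebra) \<le> 1"
  using star_alg.q_one[OF star_alg_cstar cstar_seminorm_norm] .

lemma norm_scaleR_one_le: "0 \<le> t \<Longrightarrow> norm (t *\<^sub>R (1::'a::cstar_algebra)) \<le> t"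
  using mult_left_mono[OF norm_one_le, of t] by simp

lemma norm_power_le_one:
  fixes x :: "'a::cstar_algebra"
  assumes "norm x \<le> 1" shows "norm (x ^ n) \<le> 1"
proof (induction n)
  case (Suc n)
  have "norm (x ^ Suc n) \<le> norm x * norm (x ^ n)" by (simp add: norm_mult_ineq)
  also have "\<dots> \<le> 1" using mult_mono[OF assms Suc] by simp
  finally show ?case .
qed (simp add: norm_one_le)

lemma norm_square: "star (a::'a::cstar_algebra) = a \<Longrightarrow> norm (a * a) = (norm a)\<^sup>2"
  using norm_star_mult[of a] by simp

text \<open>Compared with \<open>sqrt_one_minus\<close> this includes the boundary of the ball. The
  bound on \<open>1 - c\<close> says that c again satisfies the norm condition for positivity, which
  is what allows a root of a root to be taken in \<open>star_mult_is_square\<close>.\<close>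

lemma sqrt_one_minus_ball:
  fixes x :: "'a::cstar_algebra"
  assumes "norm x \<le> 1" "star x = x"
  shows "\<exists>c. star c = c \<and> c * c = 1 - x \<and> norm (1 - c) \<le> 1 \<and> (\<forall>y. y * x = x * y \<longrightarrow> y * c = c * y)"
proof -
  define f where "f k = sqrt_coeff k *\<^sub>R x ^ k" for k
  define c where "c = suminf f"
  have b: "norm (x ^ k) \<le> 1" for k by (rule norm_power_le_one[OF assms(1)])
  \<comment> \<open>An element is a 1 by 1 matrix, so \<open>binomial_sqrt\<close> is used with n =
    1.\<close>
  have abs: "summable (\<lambda>k. norm (f k))" unfolding f_def
    by (rule binomial_sqrt(1)[of 1 "\<lambda>k _ _. x ^ k" 1 0 0]) (simp_all add: power_add b)
  have "(\<Sum>m<1::nat. c * c) = x ^ 0 - x ^ 1" unfolding c_def f_def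
    by (rule binomial_sqrt(2)[of 1 "\<lambda>k _ _. x ^ k" 1 0 0]) (simp_all add: power_add b)
  then have sq: "c * c = 1 - x" by simp
  have sf: "summable f" using abs by (rule summable_norm_cancel)
  have "star (x ^ k) = x ^ k" for k
    by (induction k) (simp_all add: star_mult assms(2) power_commutes)
  then have "star c = c"
    using bounded_linear.suminf[OF bounded_linear_star sf]
    unfolding c_def f_def by (simp add: star_scaleR)
  moreover have "y * c = c * y" if "y * x = x * y" for y
  proof -
    have "y * x ^ n = x ^ n * y" for n
      by (induction n) (simp_all, metis mult.assoc that)
    then have "y * f n = f n * y" for n by (simp add: f_def)
    moreover have "y * c = suminf (\<lambda>n. y * f n)"
      unfolding c_def by (rule bounded_linear.suminf[OF bounded_linear_mult_right sf])
    moreover have "c * y = suminf (\<lambda>n. f n * y)"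
      unfolding c_def by (rule bounded_linear.suminf[OF bounded_linear_mult_left sf])
    ultimately show ?thesis by simp
  qed
  moreover have "norm (1 - c) \<le> 1"
  proof -
    have s: "summable (\<lambda>k. norm (f (Suc k)))" using abs summable_Suc_iff[of "\<lambda>k. norm (f k)"] by simp
    \<comment> \<open>The head of the series is 1, and the coefficients of the tail have absolute
      sum at most 1.\<close>
    have "suminf (\<lambda>k. f (Suc k)) = c - f 0" unfolding c_def by (rule suminf_split_head[OF sf])
    then have "norm (1 - c) = norm (suminf (\<lambda>k. f (Suc k)))" by (simp add: f_def norm_minus_commute)
    also have "\<dots> \<le> suminf (\<lambda>k. norm (f (Suc k)))" by (rule summable_norm[OF s])
    also have "\<dots> \<le> 1"
    proof (rule suminf_le_const[OF s])
      fix n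
      have "(\<Sum>k<n. norm (f (Suc k))) \<le> (\<Sum>k<n. \<bar>sqrt_coeff (Suc k)\<bar> * 1)"
        unfolding f_def norm_scaleR by (intro sum_mono mult_left_mono norm_power_le_one assms) simp
      then show "(\<Sum>k<n. norm (f (Suc k))) \<le> 1" using sum_abs_sqrt_coeff_Suc[of n] by simp
    qed
    finally show ?thesis .
  qed
  ultimately show ?thesis using sq by blast
qed

lemma scaleC_diff_right: "c *\<^sub>C (x - y) = c *\<^sub>C x - c *\<^sub>C (y::'a::cstar_algebra)"
  by (rule star_alg.sc_diff[OF star_alg_cstar])

text \<open>For selfadjoint a the norm condition expresses that the spectrum lies in [0, 2 t]. It
  puts x = 1 - a / t into the closed unit ball, and the root of a is sqrt t times the binomial root
  of 1 - x.\<close>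

lemma sqrt_near_scalar:
  fixes a :: "'a::cstar_algebra"
  assumes "star a = a" "norm (t *\<^sub>R 1 - a) \<le> t"
  shows "\<exists>h. star h = h \<and> h * h = a \<and> norm (sqrt t *\<^sub>R 1 - h) \<le> sqrt t \<and>
    (\<forall>y. y * a = a * y \<longrightarrow> y * h = h * y)"
proof (cases "t = 0")
  case True
  then show ?thesis using assms by (intro exI[of _ 0]) simp
next
  case False
  then have t: "t > 0" using assms(2) norm_ge_zero[of "t *\<^sub>R 1 - a"] by linarith
  define x where "x = 1 - (1/t) *\<^sub>R a"
  have "x = (1/t) *\<^sub>R (t *\<^sub>R 1 - a)" using t by (simp add: x_def algebra_simps)
  then have "norm x = norm (t *\<^sub>R 1 - a) / t" using t by (simp only: norm_scaleR) simp
  then have "norm x \<le> 1" using assms(2) t by simp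
  moreover have "star x = x" by (simp add: x_def star_diff star_scaleR assms)
  ultimately obtain c where c: "star c = c" "c * c = 1 - x" "norm (1 - c) \<le> 1"
    "\<And>y. y * x = x * y \<Longrightarrow> y * c = c * y"
    using sqrt_one_minus_ball by blast
  show ?thesis
  proof (intro exI[of _ "sqrt t *\<^sub>R c"] conjI allI impI)
    show "star (sqrt t *\<^sub>R c) = sqrt t *\<^sub>R c" by (simp add: star_scaleR c)
    show "(sqrt t *\<^sub>R c) * (sqrt t *\<^sub>R c) = a" using t by (simp add: c x_def)
    have "norm (sqrt t *\<^sub>R (1 - c)) \<le> sqrt t" using c(3) t by simp
    then show "norm (sqrt t *\<^sub>R 1 - sqrt t *\<^sub>R c) \<le> sqrt t" by (simp add: scaleR_diff_right)
    show "y * (sqrt t *\<^sub>R c) = (sqrt t *\<^sub>R c) * y" if "y * a = a * y" for y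
      using c(4)[of y] that by (simp add: x_def algebra_simps)
  qed
qed

text \<open>\<open>h + \<i> c\<close> is a multiple of a unitary.\<close>

lemma commuting_squares_bound:
  fixes h c :: "'a::cstar_algebra"
  assumes sa: "star h = h" "star c = c" and hc: "h * c = c * h"
    and s: "h * h + c * c = s *\<^sub>R 1" "0 \<le> s"
  shows "norm (c * c) \<le> s"
proof -
  define u where "u = h + \<i> *\<^sub>C c"
  have stu: "star u = h - \<i> *\<^sub>C c"
    using scaleC_scaleC[of "-1" "\<i>" c] by (simp add: u_def star_add star_scaleC sa scaleC_minus_one)
  have ii: "\<i> *\<^sub>C \<i> *\<^sub>C z = - z" for z :: 'a
    by (simp add: scaleC_scaleC scaleC_minus_one)
  have "star u * u = s *\<^sub>R 1"
    unfolding stu s(1)[symmetric] unfolding u_def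
    by (simp add: algebra_simps mult_scaleC_left mult_scaleC_right hc scaleC_add_right scaleC_diff_right ii)
  then have "(norm u)\<^sup>2 \<le> s"
    using norm_star_mult[of u] norm_scaleR_one_le[OF s(2), where ?'a = 'a] by simp
  then have nu: "norm u \<le> sqrt s" by (simp add: real_le_rsqrt)
  have "2 *\<^sub>R c = (- \<i>) *\<^sub>C (u - star u)"
  proof -
    have "u - star u = 2 *\<^sub>R (\<i> *\<^sub>C c)" unfolding stu by (simp add: u_def scaleR_2)
    then have "(- \<i>) *\<^sub>C (u - star u) = (- (\<i> * \<i>) * 2) *\<^sub>C c"
      by (simp only: scaleR_scaleC scaleC_scaleC) (simp add: mult_ac)
    then show ?thesis by (simp add: scaleR_scaleC)
  qed
  then have "norm (2 *\<^sub>R c) = norm (u - star u)" by (simp add: norm_scaleC)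
  also have "\<dots> \<le> 2 * sqrt s" using norm_triangle_ineq4[of u "star u"] nu by simp
  finally have "norm c \<le> sqrt s" by simp
  then have "(norm c)\<^sup>2 \<le> (sqrt s)\<^sup>2" by (intro power_mono) auto
  then show ?thesis using s(2) norm_square[OF sa(2)] by simp
qed

text \<open>The converse of the norm criterion. The element s - h h differs from s by h h and so has
  a root c commuting with h; then h h + c c = s bounds c c, which is s - h h itself.\<close>

lemma square_near_scalar:
  fixes h :: "'a::cstar_algebra"
  assumes h: "star h = h" and s: "norm (h * h) \<le> s"
  shows "norm (s *\<^sub>R 1 - h * h) \<le> s"
proof -
  have "star (s *\<^sub>R 1 - h * h) = s *\<^sub>R 1 - h * h"
    by (simp add: star_diff star_scaleR star_mult h)
  moreover have "norm (s *\<^sub>R 1 - (s *\<^sub>R 1 - h * h)) \<le> s" using s by simp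
  ultimately obtain c where c: "star c = c" "c * c = s *\<^sub>R 1 - h * h" "norm (sqrt s *\<^sub>R 1 - c) \<le> sqrt s"
    "\<And>y. y * (s *\<^sub>R 1 - h * h) = (s *\<^sub>R 1 - h * h) * y \<Longrightarrow> y * c = c * y"
    using sqrt_near_scalar by blast
  have "h * c = c * h" using c(4) by (simp add: algebra_simps)
  moreover have "h * h + c * c = s *\<^sub>R 1" by (simp add: c)
  moreover have "0 \<le> s" using s norm_ge_zero order_trans by blast
  ultimately have "norm (c * c) \<le> s"
    using h c(1) by (intro commuting_squares_bound[of h c s])
  then show ?thesis by (simp add: c(2))
qed

text \<open>A provisional description of the positive cone: by \<open>sa_squareI\<close> and \<open>sa_squareD\<close> it is a norm
  condition, which passes to sums and limits. That it contains all \<open>y\<^sup>* y\<close> is \<open>star_mult_is_square\<close>.\<close>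

definition sa_square :: "'a::cstar_algebra \<Rightarrow> bool" where
  "sa_square a \<longleftrightarrow> (\<exists>h. star h = h \<and> a = h * h)"

lemma sa_squareI: "star a = a \<Longrightarrow> norm (t *\<^sub>R 1 - a) \<le> t \<Longrightarrow> sa_square a"
  unfolding sa_square_def using sqrt_near_scalar by metis

lemma sa_squareD:
  assumes "sa_square a" shows "star a = a" "norm a \<le> t \<Longrightarrow> norm (t *\<^sub>R 1 - a) \<le> t"
  using assms square_near_scalar by (auto simp: sa_square_def star_mult)

lemma sa_square_add:
  assumes "sa_square a" "sa_square b" shows "sa_square (a + b)"
proof (rule sa_squareI[of _ "norm a + norm b"])
  show "star (a + b) = a + b" using assms by (simp add: star_add sa_squareD)
  have "norm ((norm a *\<^sub>R 1 - a) + (norm b *\<^sub>R 1 - b)) \<le> norm a + norm b"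
    using sa_squareD(2)[OF assms(1) order_refl] sa_squareD(2)[OF assms(2) order_refl]
    by (intro norm_triangle_mono)
  then show "norm ((norm a + norm b) *\<^sub>R 1 - (a + b)) \<le> norm a + norm b"
    by (simp add: algebra_simps)
qed

lemma sa_square_sqrt:
  assumes "sa_square a"
  shows "\<exists>h. star h = h \<and> h * h = a \<and> norm (sqrt (norm a) *\<^sub>R 1 - h) \<le> sqrt (norm a) \<and>
    (\<forall>y. y * a = a * y \<longrightarrow> y * h = h * y)"
  by (rule sqrt_near_scalar[OF sa_squareD(1)[OF assms] sa_squareD(2)[OF assms order_refl]])

text \<open>With p = h h, the element q = s - h h commutes with h, and therefore so does its root k.
  This reduces the claim to \<open>commuting_squares_bound\<close>. Antisymmetry of the order is the
  case s = 0.\<close>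

lemma sa_square_sum_bound:
  assumes p: "sa_square p" and q: "sa_square q" and s: "p + q = s *\<^sub>R 1" "0 \<le> s"
  shows "norm p \<le> s"
proof -
  obtain h where h: "star h = h" "h * h = p"
    using p by (auto simp: sa_square_def)
  obtain k where k: "star k = k" "k * k = q" "norm (sqrt (norm q) *\<^sub>R 1 - k) \<le> sqrt (norm q)" "\<And>y. y * q = q * y \<Longrightarrow> y * k = k * y"
    using sa_square_sqrt[OF q] by blast
  have "q = s *\<^sub>R 1 - h * h" using s(1) h(2) by (simp add: algebra_simps)
  then have "h * q = q * h" by (simp only: left_diff_distrib right_diff_distrib mult.assoc) simp
  then have kh: "k * h = h * k" using k(4) by simp
  have "k * k + h * h = s *\<^sub>R 1" using s(1) h(2) k(2) by (simp add: add.commute)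
  then have "norm (h * h) \<le> s"
    by (intro commuting_squares_bound[OF k(1) h(1) kh _ s(2)])
  then show ?thesis by (simp add: h)
qed

lemma sa_square_antisym: "sa_square p \<Longrightarrow> sa_square (- p) \<Longrightarrow> p = 0"
  using sa_square_sum_bound[of p "- p" 0] by simp

lemma sa_square_eq_0: "star g = g \<Longrightarrow> g * g = 0 \<Longrightarrow> g = (0::'a::cstar_algebra)"
  using norm_square[of g] by simp

lemma sa_square_square: "star g = g \<Longrightarrow> sa_square (g * g)"
  by (auto simp: sa_square_def)

text \<open>The spectral argument (\<open>z\<^sup>* z \<le> 0\<close> implies \<open>z z\<^sup>* \<le> 0\<close>) is avoided by passing to \<open>w = z g\<close>, for
  which both \<open>w\<^sup>* w\<close> and \<open>w w\<^sup>*\<close> are negative, while \<open>w\<^sup>* w + w w\<^sup>* = 2 (Re w)\<^sup>2 + 2 (Im w)\<^sup>2\<close>.\<close>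

lemma star_mult_eq_minus_square:
  fixes z g :: "'a::cstar_algebra"
  assumes g: "star g = g" and z: "star z * z = - (g * g)"
  shows "g = 0"
proof -
  define w where "w = z * g"
  define p where "p = g * g"
  define r where "r = z * star z"
  have sp: "star p = p" "star r = r" by (simp_all add: p_def r_def star_mult g star_star)
  have ww: "star w * w = - (p * p)"
  proof -
    have "star w * w = g * (star z * z) * g" by (simp add: w_def star_mult g mult.assoc)
    then show ?thesis by (simp add: z p_def mult.assoc)
  qed
  have ww': "w * star w = - (r * r)"
  proof -
    have "w * star w = z * (g * g) * star z" by (simp add: w_def star_mult g mult.assoc)
    also have "g * g = - (star z * z)" by (simp add: z)
    finally show ?thesis by (simp add: r_def mult.assoc)
  qed
  define u where "u = w + star w"
  define v where "v = \<i> *\<^sub>C (w - star w)"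
  have su: "star u = u" by (simp add: u_def star_add star_star add.commute)
  have sv: "star v = v"
  proof -
    have "star v = (- \<i>) *\<^sub>C (star w - w)" by (simp add: v_def star_scaleC star_diff star_star)
    also have "star w - w = (-1) *\<^sub>C (w - star w)" by (simp add: scaleC_minus_one)
    finally show ?thesis by (simp add: v_def scaleC_scaleC)
  qed
  have "v * v = - ((w - star w) * (w - star w))"
    by (simp add: v_def mult_scaleC_left mult_scaleC_right scaleC_scaleC scaleC_minus_one)
  then have "u * u + v * v = 2 *\<^sub>R (star w * w + w * star w)"
    by (simp add: u_def algebra_simps scaleR_2)
  also have "\<dots> = - (2 *\<^sub>R (p * p) + 2 *\<^sub>R (r * r))" by (simp add: ww ww' scaleR_diff_right)
  \<comment> \<open>Both p p and its negative are now sums of selfadjoint squares, so antisymmetry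
    makes p p vanish.\<close>
  finally have "- (p * p) = (u * u + v * v) + (p * p + (r * r + r * r))"
    by (simp add: scaleR_2)
  then have "sa_square (- (p * p))"
    using su sv sp by (auto intro!: sa_square_add sa_square_square)
  then have "p * p = 0" using sa_square_antisym sa_square_square sp by blast
  then have "p = 0" using sa_square_eq_0 sp by blast
  then have "g * g = 0" by (simp add: p_def)
  with g show ?thesis by (rule sa_square_eq_0)
qed

text \<open>With \<open>m = \<bar>a\<bar>\<close> for \<open>a = y\<^sup>* y\<close>, the element \<open>n = m - a\<close> satisfies \<open>(y n)\<^sup>* (y n) = - n m n\<close>.\<close>

lemma star_mult_is_square:
  fixes y :: "'a::cstar_algebra"
  shows "sa_square (star y * y)"
proof -
  define a where "a = star y * y"
  have sa: "star a = a" by (simp add: a_def star_mult star_star)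
  obtain m where m: "star m = m" "m * m = a * a" "norm (sqrt (norm (a * a)) *\<^sub>R 1 - m) \<le> sqrt (norm (a * a))"
    "\<And>y. y * (a * a) = (a * a) * y \<Longrightarrow> y * m = m * y"
    using sa_square_sqrt[OF sa_square_square[OF sa]] by blast
  have am: "a * m = m * a" using m(4) by (simp add: mult.assoc)
  have "sa_square m" using m(1,3) by (rule sa_squareI)
  \<comment> \<open>A root of m that commutes with n turns n m n into the square of the selfadjoint
    element k n, the shape required by \<open>star_mult_eq_minus_square\<close>.\<close>
  then obtain k where k: "star k = k" "k * k = m" "norm (sqrt (norm m) *\<^sub>R 1 - k) \<le> sqrt (norm m)"
    "\<And>y. y * m = m * y \<Longrightarrow> y * k = k * y"
    using sa_square_sqrt by blast
  define n where "n = m - a"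
  have sn: "star n = n" by (simp add: n_def star_diff m sa)
  have nm: "n * m = m * n" by (simp add: n_def algebra_simps am)
  then have nk: "n * k = k * n" using k(4) by blast
  have an: "a * n = - (m * n)" by (simp add: n_def algebra_simps m(2) am)
  have "star (y * n) * (y * n) = n * (a * n)"
    by (simp add: star_mult sn a_def mult.assoc)
  also have "\<dots> = - (n * (m * n))" by (simp add: an)
  also have "n * (m * n) = (n * k) * (k * n)" by (simp add: mult.assoc flip: k(2))
  also have "\<dots> = (k * n) * (k * n)" by (simp add: nk)
  finally have "k * n = 0"
    by (intro star_mult_eq_minus_square[of "k * n" "y * n"]) (simp_all add: star_mult k sn nk)
  then have mn: "m * n = 0" by (metis k(2) mult.assoc mult_zero_right)
  then have "n * n = 0" using an by (simp add: n_def left_diff_distrib)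
  then have "n = 0" using sa_square_eq_0 sn by blast
  then have "a = m" by (simp add: n_def)
  then show ?thesis using \<open>sa_square m\<close> by (simp add: a_def)
qed

lemma cstar_pos_iff_sa_square: "cstar_pos a \<longleftrightarrow> sa_square a"
  unfolding cstar_pos_def using star_mult_is_square by (auto simp: sa_square_def) metis

lemma cstar_pos_star_mult: "cstar_pos (star y * y)"
  by (auto simp: cstar_pos_def)

lemma cstar_posI: "star a = a \<Longrightarrow> norm (t *\<^sub>R 1 - a) \<le> t \<Longrightarrow> cstar_pos a"
  unfolding cstar_pos_iff_sa_square by (rule sa_squareI)

lemma cstar_pos_selfadjoint: "cstar_pos a \<Longrightarrow> star a = a"
  by (simp add: cstar_pos_iff_sa_square sa_squareD)

lemma cstar_pos_near_scalar: "cstar_pos a \<Longrightarrow> norm a \<le> t \<Longrightarrow> norm (t *\<^sub>R 1 - a) \<le> t"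
  by (simp add: cstar_pos_iff_sa_square sa_squareD)

lemma cstar_pos_0 [simp]: "cstar_pos 0"
  using cstar_pos_star_mult[of 0] by simp

lemma cstar_pos_add: "cstar_pos a \<Longrightarrow> cstar_pos b \<Longrightarrow> cstar_pos (a + b)"
  by (simp add: cstar_pos_iff_sa_square sa_square_add)

lemma cstar_pos_sum: "(\<And>i. i \<in> A \<Longrightarrow> cstar_pos (f i)) \<Longrightarrow> cstar_pos (sum f A)"
  by (induction A rule: infinite_finite_induct) (auto intro: cstar_pos_add)

lemma cstar_pos_conj: assumes "cstar_pos a" shows "cstar_pos (star b * a * b)"
proof -
  obtain y where "a = star y * y" using assms by (auto simp: cstar_pos_def)
  then have "star b * a * b = star (y * b) * (y * b)" by (simp add: star_mult mult.assoc)
  then show ?thesis by (simp only: cstar_pos_star_mult)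
qed

lemma cstar_pos_scaleR: assumes "cstar_pos a" "0 \<le> r" shows "cstar_pos (r *\<^sub>R a)"
  using cstar_pos_conj[OF assms(1), of "sqrt r *\<^sub>R 1"] assms(2) by (simp add: star_scaleR)

lemma norm_minus_pos: assumes "star a = a" "norm a \<le> t" shows "cstar_pos (t *\<^sub>R 1 - a)"
  by (rule cstar_posI[of _ t]) (use assms in \<open>simp_all add: star_diff star_scaleR\<close>)

lemma norm_square_minus_pos: "cstar_pos ((norm a)\<^sup>2 *\<^sub>R 1 - star a * a)"
  by (rule norm_minus_pos) (simp_all add: star_mult star_star norm_star_mult)

text \<open>The element norm q - p is positive, being the sum of norm q - q and q - p. So p and norm
  q - p are positive with sum norm q, and \<open>sa_square_sum_bound\<close> applies.\<close>

lemma cstar_pos_norm_mono: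
  fixes p q :: "'a::cstar_algebra"
  assumes "cstar_pos p" "cstar_pos (q - p)" shows "norm p \<le> norm q"
proof -
  have "star q = q"
    using assms[THEN cstar_pos_selfadjoint] by (simp add: star_diff)
  then have "cstar_pos (norm q *\<^sub>R 1 - q)" by (rule norm_minus_pos) simp
  from cstar_pos_add[OF this assms(2)] have "cstar_pos (norm q *\<^sub>R 1 - p)" by simp
  with assms(1) show ?thesis
    using sa_square_sum_bound[of p "norm q *\<^sub>R 1 - p" "norm q"] by (simp add: cstar_pos_iff_sa_square)
qed

text \<open>The factors of the f n need not converge. The norm criterion with t = norm (f n) does
  pass to the limit.\<close>

lemma cstar_pos_lim:
  assumes "\<And>n. cstar_pos (f n)" "f \<longlonglongrightarrow> a" shows "cstar_pos a"
proof (rule cstar_posI[of _ "norm a"])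
  have "(\<lambda>n. star (f n)) \<longlonglongrightarrow> star a" by (rule bounded_linear.tendsto[OF bounded_linear_star assms(2)])
  then show "star a = a" using assms LIMSEQ_unique by (simp add: cstar_pos_selfadjoint)
  have n: "(\<lambda>n. norm (f n)) \<longlonglongrightarrow> norm a" by (rule tendsto_norm[OF assms(2)])
  have "(\<lambda>n. norm (norm (f n) *\<^sub>R 1 - f n)) \<longlonglongrightarrow> norm (norm a *\<^sub>R 1 - a)"
    by (intro tendsto_intros n assms(2))
  from this n show "norm (norm a *\<^sub>R 1 - a) \<le> norm a"
    by (rule LIMSEQ_le) (use cstar_pos_near_scalar[OF assms(1) order_refl] in auto)
qed

text \<open>Cauchy--Schwarz for \<open>p = \<langle>x, x\<rangle>\<close>, \<open>g = \<langle>x, y\<rangle>\<close>, \<open>r = \<langle>y, y\<rangle>\<close>; the hypothesis is positivity of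
  \<open>\<langle>y - x b, y - x b\<rangle>\<close>.\<close>

lemma cauchy_schwarz_cstar:
  fixes p g r :: "'a::cstar_algebra"
  assumes p: "cstar_pos p" and r: "cstar_pos r"
    and pos: "\<And>b. cstar_pos (r - star b * g - star g * b + star b * p * b)"
  shows "(norm g)\<^sup>2 \<le> norm p * norm r"
proof -
  have bound: "t * (norm g)\<^sup>2 \<le> norm r" if t: "t \<ge> 0" "t * norm p \<le> 1" for t
  proof -
    \<comment> \<open>The minimizer would be b = (inverse of p) g; a number t with t norm p <= 1
      stands in for the inverse. Of the two positive terms added below, one replaces p by norm p and
      the other cancels what this leaves of second order in t.\<close>
    define b where "b = t *\<^sub>R g"
    have "cstar_pos (star g * (norm p *\<^sub>R 1 - p) * g)"
      by (rule cstar_pos_conj[OF norm_minus_pos]) (simp_all add: cstar_pos_selfadjoint p)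
    then have "cstar_pos (t\<^sup>2 *\<^sub>R (star g * (norm p *\<^sub>R 1 - p) * g))" by (rule cstar_pos_scaleR) simp
    moreover have "cstar_pos ((t * (1 - t * norm p)) *\<^sub>R (star g * g))"
      by (rule cstar_pos_scaleR[OF cstar_pos_star_mult]) (use t in simp)
    ultimately have "cstar_pos ((r - star b * g - star g * b + star b * p * b)
        + (t\<^sup>2 *\<^sub>R (star g * (norm p *\<^sub>R 1 - p) * g) + (t * (1 - t * norm p)) *\<^sub>R (star g * g)))"
      by (intro cstar_pos_add pos)
    also have "\<dots> = r - t *\<^sub>R (star g * g)"
      by (simp add: b_def star_scaleR algebra_simps power2_eq_square)
    finally have "norm (t *\<^sub>R (star g * g)) \<le> norm r"
      using t by (intro cstar_pos_norm_mono cstar_pos_scaleR cstar_pos_star_mult) auto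
    then show ?thesis using t by (simp add: norm_star_mult)
  qed
  show ?thesis
  proof (cases "norm p = 0")
    case True
    have "norm g = 0"
    proof (rule ccontr)
      assume "norm g \<noteq> 0"
      \<comment> \<open>For p = 0 every t >= 0 is admissible, and this one would give norm r + 1 <=
        norm r.\<close>
      then show False
        using bound[of "(norm r + 1) / (norm g)\<^sup>2"] True by (simp add: add_nonneg_nonneg)
    qed
    then show ?thesis by simp
  next
    case False
    then show ?thesis using bound[of "1 / norm p"] by (simp add: field_simps)
  qed
qed

section \<open>Positive matrices\<close>

context
  fixes n :: nat
begin

text \<open>Vectors and matrices are functions on all natural numbers of which only the entries
  below n count; hence the side conditions i < n on identities between entries.\<close>

definition vec_inner :: "(nat \<Rightarrow> 'b::cstar_algebra) \<Rightarrow> (nat \<Rightarrow> 'b) \<Rightarrow> 'b" where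
  "vec_inner v w = (\<Sum>i<n. star (v i) * w i)"

definition mat_vec :: "(nat \<Rightarrow> nat \<Rightarrow> 'b::cstar_algebra) \<Rightarrow> (nat \<Rightarrow> 'b) \<Rightarrow> nat \<Rightarrow> 'b" where
  "mat_vec X v i = (\<Sum>j<n. X i j * v j)"

primrec mat_power :: "(nat \<Rightarrow> nat \<Rightarrow> 'b::cstar_algebra) \<Rightarrow> nat \<Rightarrow> nat \<Rightarrow> nat \<Rightarrow> 'b" where
  "mat_power X 0 i j = (if i = j then 1 else 0)"
| "mat_power X (Suc k) i j = (\<Sum>m<n. X i m * mat_power X k m j)"

lemma mat_power_add:
  "i < n \<Longrightarrow> mat_power X (k + l) i j = (\<Sum>m<n. mat_power X k i m * mat_power X l m j)"
proof (induction k arbitrary: i)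
  case 0
  have "(\<Sum>m<n. mat_power X 0 i m * mat_power X l m j) = (\<Sum>m<n. if m = i then mat_power X l m j else 0)"
    by (rule sum.cong) auto
  then show ?case using 0 by simp
next
  case (Suc k)
  have "mat_power X (Suc k + l) i j = (\<Sum>m<n. X i m * (\<Sum>p<n. mat_power X k m p * mat_power X l p j))"
    using Suc.IH by simp
  also have "\<dots> = (\<Sum>p<n. \<Sum>m<n. X i m * mat_power X k m p * mat_power X l p j)"
    by (simp add: sum_distrib_left mult.assoc) (rule sum.swap)
  finally show ?case by (simp add: sum_distrib_right)
qed

lemma star_sum: "star (sum f A) = (\<Sum>i\<in>A. star (f i :: 'b::cstar_algebra))"
  by (induction A rule: infinite_finite_induct) (simp_all add: star_add)

lemma mat_power_one: "i < n \<Longrightarrow> j < n \<Longrightarrow> mat_power X 1 i j = X i j"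
proof -
  assume "j < n"
  have "(\<Sum>m<n. X i m * (if m = j then 1 else 0)) = (\<Sum>m<n. if m = j then X i m else 0)"
    by (rule sum.cong) auto
  then show ?thesis using \<open>j < n\<close> by simp
qed

lemma star_mat_power:
  assumes "\<And>i j. i < n \<Longrightarrow> j < n \<Longrightarrow> star (X i j) = X j i"
  shows "i < n \<Longrightarrow> j < n \<Longrightarrow> star (mat_power X k i j) = mat_power X k j i"
proof (induction k arbitrary: i j)
  case (Suc k)
  have "star (mat_power X (Suc k) i j) = (\<Sum>m<n. mat_power X k j m * X m i)"
    using Suc by (simp add: star_sum star_mult assms)
  also have "\<dots> = (\<Sum>m<n. mat_power X k j m * mat_power X 1 m i)"
    by (rule sum.cong[OF refl]) (simp only: lessThan_iff mat_power_one Suc.prems)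
  also have "\<dots> = mat_power X (k + 1) j i" by (rule mat_power_add[OF Suc.prems(2), symmetric])
  finally show ?case by simp
qed simp

lemma vec_inner_pos: "cstar_pos (vec_inner v v)"
  by (auto simp: vec_inner_def intro!: cstar_pos_sum cstar_pos_star_mult)

lemma vec_inner_hermitian:
  assumes "\<And>i j. i < n \<Longrightarrow> j < n \<Longrightarrow> star (X i j) = X j i"
  shows "vec_inner (mat_vec X v) w = vec_inner v (mat_vec X w)"
proof -
  have "vec_inner (mat_vec X v) w = (\<Sum>i<n. \<Sum>j<n. star (v j) * X j i * w i)"
    by (simp add: vec_inner_def mat_vec_def star_sum star_mult assms sum_distrib_right)
  also have "\<dots> = (\<Sum>j<n. \<Sum>i<n. star (v j) * X j i * w i)" by (rule sum.swap)
  finally show ?thesis by (simp add: vec_inner_def mat_vec_def sum_distrib_left mult.assoc)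
qed

lemma vec_inner_diff_left: "vec_inner (\<lambda>i. u i - v i) w = vec_inner u w - vec_inner v w"
  by (simp add: vec_inner_def star_diff left_diff_distrib sum_subtractf)

lemma vec_inner_diff_right: "vec_inner w (\<lambda>i. u i - v i) = vec_inner w u - vec_inner w v"
  by (simp add: vec_inner_def right_diff_distrib sum_subtractf)

lemma mat_vec_diff: "mat_vec X (\<lambda>i. u i - v i) = (\<lambda>i. mat_vec X u i - mat_vec X v i)"
  by (simp add: fun_eq_iff mat_vec_def right_diff_distrib sum_subtractf)

text \<open>\<open>1 - X\<^sup>2 = (1 - X) + (1 - X) X (1 - X) + X (1 - X) X\<close>.\<close>

lemma mat_contraction:
  assumes herm: "\<And>i j. i < n \<Longrightarrow> j < n \<Longrightarrow> star (X i j) = X j i"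
    and pos: "\<And>v. cstar_pos (vec_inner v (mat_vec X v))"
    and le_one: "\<And>v. cstar_pos (vec_inner v (\<lambda>i. v i - mat_vec X v i))"
  shows "cstar_pos (vec_inner v v - vec_inner (mat_vec X v) (mat_vec X v))"
proof -
  define y where "y = mat_vec X v"
  define u where "u = (\<lambda>i. v i - y i)"
  have "vec_inner v v - vec_inner y y =
      vec_inner v (\<lambda>i. v i - mat_vec X v i) + vec_inner u (mat_vec X u) + vec_inner y (\<lambda>i. y i - mat_vec X y i)"
    by (simp add: u_def mat_vec_diff vec_inner_diff_left vec_inner_diff_right
        vec_inner_hermitian[OF herm, symmetric] flip: y_def)
  moreover have "cstar_pos \<dots>" by (intro cstar_pos_add pos le_one)
  ultimately show ?thesis by (simp only: y_def)
qed

text \<open>Column j of the powers of X starts as a unit vector, and a contraction does not increase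
  its inner square.\<close>

lemma vec_inner_mat_power_le_one:
  assumes contr: "\<And>v. cstar_pos (vec_inner v v - vec_inner (mat_vec X v) (mat_vec X v))"
    and "j < n"
  shows "cstar_pos (1 - vec_inner (\<lambda>i. mat_power X k i j) (\<lambda>i. mat_power X k i j))"
proof (induction k)
  case 0
  have "vec_inner (\<lambda>i. mat_power X 0 i j) (\<lambda>i. mat_power X 0 i j) = (\<Sum>i<n. if i = j then 1 else 0)"
    unfolding vec_inner_def by (rule sum.cong) auto
  then show ?case using \<open>j < n\<close> by simp
next
  case (Suc k)
  have "(\<lambda>i. mat_power X (Suc k) i j) = mat_vec X (\<lambda>i. mat_power X k i j)"
    by (simp add: fun_eq_iff mat_vec_def)
  then show ?case using cstar_pos_add[OF Suc contr[of "\<lambda>i. mat_power X k i j"]] by simp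
qed

text \<open>A single entry is dominated by the inner square of its column. This entrywise bound is
  all that \<open>binomial_sqrt\<close> asks for, so no norm on matrices enters.\<close>

lemma mat_power_bounded:
  assumes contr: "\<And>v. cstar_pos (vec_inner v v - vec_inner (mat_vec X v) (mat_vec X v))"
    and "i < n" "j < n"
  shows "norm (mat_power X k i j) \<le> 1"
proof -
  let ?v = "\<lambda>i. mat_power X k i j"
  have "vec_inner ?v ?v = star (?v i) * ?v i + (\<Sum>m\<in>{..<n}-{i}. star (?v m) * ?v m)"
    unfolding vec_inner_def using \<open>i < n\<close> by (intro sum.remove) auto
  then have "cstar_pos (vec_inner ?v ?v - star (?v i) * ?v i)"
    by (auto intro!: cstar_pos_sum cstar_pos_star_mult)
  from cstar_pos_add[OF this vec_inner_mat_power_le_one[OF contr \<open>j < n\<close>, of k]]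
  have "cstar_pos (1 - star (?v i) * ?v i)" by simp
  then have "norm (star (?v i) * ?v i) \<le> norm (1::'a)"
    by (intro cstar_pos_norm_mono cstar_pos_star_mult)
  then have "(norm (?v i))\<^sup>2 \<le> 1" using norm_one_le[where ?'a = 'a] by (simp add: norm_star_mult)
  then show ?thesis by (simp add: power2_le_iff_abs_le abs_square_le_1)
qed

text \<open>The series for the root of 1 - X converges in every entry by
  \<open>mat_power_bounded\<close>, and its sum is hermitian because all powers of X are.\<close>

lemma hermitian_sqrt:
  assumes herm: "\<And>i j. i < n \<Longrightarrow> j < n \<Longrightarrow> star (X i j) = X j i"
    and contr: "\<And>v. cstar_pos (vec_inner v v - vec_inner (mat_vec X v) (mat_vec X v))"
  shows "\<exists>S. \<forall>i<n. \<forall>j<n. star (S i j) = S j i \<and>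
    (\<Sum>m<n. S i m * S m j) = (if i = j then 1 else 0) - X i j"
proof -
  define S where "S i j = suminf (\<lambda>k. sqrt_coeff k *\<^sub>R mat_power X k i j)" for i j
  have sm: "summable (\<lambda>k. norm (sqrt_coeff k *\<^sub>R mat_power X k i j))" if "i < n" "j < n" for i j
    by (rule binomial_sqrt(1)[of n "mat_power X" 1])
      (use that in \<open>auto intro: mat_power_bounded[OF contr] mat_power_add\<close>)
  have sq: "(\<Sum>m<n. S i m * S m j) = mat_power X 0 i j - mat_power X 1 i j" if "i < n" "j < n" for i j
    unfolding S_def by (rule binomial_sqrt(2)[of n "mat_power X" 1])
      (use that in \<open>auto intro: mat_power_bounded[OF contr] mat_power_add\<close>)
  have "star (S i j) = S j i" if "i < n" "j < n" for i j
    unfolding S_def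
    using bounded_linear.suminf[OF bounded_linear_star summable_norm_cancel[OF sm[OF that]]] that
    by (simp add: star_scaleR star_mat_power[OF herm])
  moreover have "(\<Sum>m<n. S i m * S m j) = (if i = j then 1 else 0) - X i j" if "i < n" "j < n" for i j
    using sq[OF that] mat_power_one[OF that, of X] by simp
  ultimately show ?thesis by blast
qed

text \<open>An inequality of arithmetic and geometric means: with t = norm g, expand the inner
  square of sqrt t v - g w / sqrt t and estimate \<open>star g * g\<close> by the square of
  t.\<close>

lemma cross_term_le:
  fixes g v w :: "'b::cstar_algebra"
  shows "cstar_pos (norm g *\<^sub>R (star v * v + star w * w) - (star v * g * w + star w * star g * v))"
proof (cases "norm g = 0")
  case False
  define t where "t = norm g"
  have t: "t > 0" using False by (simp add: t_def)
  define z where "z = sqrt t *\<^sub>R v - (1 / sqrt t) *\<^sub>R (g * w)"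
  have "cstar_pos (star z * z + (1 / t) *\<^sub>R (star w * (t\<^sup>2 *\<^sub>R 1 - star g * g) * w))"
    unfolding t_def
    by (intro cstar_pos_add cstar_pos_star_mult cstar_pos_scaleR cstar_pos_conj norm_square_minus_pos) simp
  also have "star z * z = t *\<^sub>R (star v * v) - star v * g * w - star w * star g * v
      + (1 / t) *\<^sub>R (star w * star g * g * w)"
    using t by (simp add: z_def star_diff star_scaleR star_mult algebra_simps)
  also have "(1 / t) *\<^sub>R (star w * (t\<^sup>2 *\<^sub>R 1 - star g * g) * w) =
      t *\<^sub>R (star w * w) - (1 / t) *\<^sub>R (star w * star g * g * w)"
    using t by (simp add: algebra_simps power2_eq_square)
  finally show ?thesis by (simp add: t_def algebra_simps)
qed simp

text \<open>Twice the form is the sum over all i, j of a cross term and its adjoint. By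
  \<open>cross_term_le\<close> each such pair is at most norm (G i j) times the sum of the inner
  squares of v i and v j, and each of these two is at most <v, v>.\<close>

lemma hermitian_form_bounded:
  assumes herm: "\<And>i j. i < n \<Longrightarrow> j < n \<Longrightarrow> star (G i j) = G j i"
  shows "\<exists>t>0. \<forall>v. cstar_pos (t *\<^sub>R vec_inner v v - vec_inner v (mat_vec G v))"
proof -
  \<comment> \<open>The summand 1 makes t positive even for G = 0, so that \<open>mat_posI\<close>
    can divide by t.\<close>
  define t where "t = 1 + (\<Sum>i<n. \<Sum>j<n. norm (G i j))"
  have t: "t > 0" unfolding t_def by (intro add_pos_nonneg sum_nonneg) auto
  have "cstar_pos (t *\<^sub>R vec_inner v v - vec_inner v (mat_vec G v))" for v
  proof -
    let ?N = "\<lambda>i. star (v i) * v i"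
    have le: "cstar_pos (vec_inner v v - ?N i)" if "i < n" for i
    proof -
      have "vec_inner v v = ?N i + (\<Sum>m\<in>{..<n}-{i}. ?N m)"
        unfolding vec_inner_def using that by (intro sum.remove) auto
      then show ?thesis by (auto intro!: cstar_pos_sum cstar_pos_star_mult)
    qed
    have *: "cstar_pos (\<Sum>i<n. \<Sum>j<n. norm (G i j) *\<^sub>R ((vec_inner v v - ?N i) + (vec_inner v v - ?N j)))"
      by (intro cstar_pos_sum cstar_pos_scaleR cstar_pos_add le) auto
    have **: "cstar_pos (\<Sum>i<n. \<Sum>j<n. norm (G i j) *\<^sub>R (?N i + ?N j) -
        (star (v i) * G i j * v j + star (v j) * star (G i j) * v i))"
      by (intro cstar_pos_sum cross_term_le)
    \<comment> \<open>Since G is hermitian, the adjoint terms form the same double sum with i and j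
      exchanged.\<close>
    have swap: "(\<Sum>i<n. \<Sum>j<n. star (v j) * star (G i j) * v i) = (\<Sum>i<n. \<Sum>j<n. star (v i) * G i j * v j)"
    proof -
      have "(\<Sum>i<n. \<Sum>j<n. star (v j) * star (G i j) * v i) = (\<Sum>i<n. \<Sum>j<n. star (v j) * G j i * v i)"
        by (intro sum.cong refl) (simp add: herm)
      then show ?thesis by (subst (asm) (2) sum.swap)
    qed
    have "(\<Sum>i<n. \<Sum>j<n. norm (G i j) *\<^sub>R ((vec_inner v v - ?N i) + (vec_inner v v - ?N j))) +
        (\<Sum>i<n. \<Sum>j<n. norm (G i j) *\<^sub>R (?N i + ?N j) -
          (star (v i) * G i j * v j + star (v j) * star (G i j) * v i)) =
        (\<Sum>i<n. \<Sum>j<n. (2 * norm (G i j)) *\<^sub>R vec_inner v v - (star (v i) * G i j * v j + star (v j) * star (G i j) * v i))"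
      unfolding sum.distrib[symmetric] by (intro sum.cong refl) (simp add: algebra_simps scaleR_2 scaleR_scaleR[symmetric] del: scaleR_scaleR)
    also have "\<dots> = (2 * (t - 1)) *\<^sub>R vec_inner v v - 2 *\<^sub>R vec_inner v (mat_vec G v)"
      by (simp add: sum_subtractf sum.distrib swap[unfolded mult.assoc] t_def vec_inner_def[of v "mat_vec G v"] mat_vec_def
          sum_distrib_left mult.assoc scaleR_2 scaleR_left.sum[symmetric])
    finally have "cstar_pos ((2 * (t - 1)) *\<^sub>R vec_inner v v - 2 *\<^sub>R vec_inner v (mat_vec G v))"
      using cstar_pos_add[OF * **] by simp
    from cstar_pos_add[OF cstar_pos_scaleR[OF this, of "1/2"] vec_inner_pos[of v]]
    show ?thesis by (simp add: algebra_simps)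
  qed
  with t show ?thesis by blast
qed

text \<open>Dividing by the bound t of the form places G / t between 0 and 1, so X = 1 - G / t is a
  positive contraction. If S is the binomial root of 1 - X, then G = t S S, and S is hermitian, so
  sqrt t S is the factor demanded by \<open>mat_pos\<close>.\<close>

lemma mat_posI:
  fixes G :: "nat \<Rightarrow> nat \<Rightarrow> 'b::cstar_algebra"
  assumes herm: "\<And>i j. i < n \<Longrightarrow> j < n \<Longrightarrow> star (G i j) = G j i"
    and pos: "\<And>v. cstar_pos (\<Sum>i<n. \<Sum>j<n. star (v i) * G i j * v j)"
  shows "mat_pos n G"
proof -
  obtain t where t: "t > 0" "\<And>v. cstar_pos (t *\<^sub>R vec_inner v v - vec_inner v (mat_vec G v))"
    using hermitian_form_bounded[of G, OF herm] by blast
  define X where "X i j = (if i = j then 1 else 0) - (1 / t) *\<^sub>R G i j" for i j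
  have X: "mat_vec X v i = v i - (1 / t) *\<^sub>R mat_vec G v i" if "i < n" for v i
  proof -
    have "(\<Sum>j<n. (if i = j then 1 else 0) * v j) = (\<Sum>j<n. if j = i then v j else 0)"
      by (rule sum.cong) auto
    then show ?thesis
      using that by (simp add: mat_vec_def X_def left_diff_distrib sum_subtractf scaleR_sum_right)
  qed
  have hX: "star (X i j) = X j i" if "i < n" "j < n" for i j
    using that by (simp add: X_def star_diff star_scaleR herm)
  have "vec_inner v (mat_vec X v) = (1 / t) *\<^sub>R (t *\<^sub>R vec_inner v v - vec_inner v (mat_vec G v))" for v
    using t(1) by (simp add: vec_inner_def X right_diff_distrib sum_subtractf scaleR_diff_right scaleR_sum_right)
  then have X0: "cstar_pos (vec_inner v (mat_vec X v))" for v
    using t by (simp add: cstar_pos_scaleR)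
  have "vec_inner v (\<lambda>i. v i - mat_vec X v i) = vec_inner v (\<lambda>i. (1 / t) *\<^sub>R mat_vec G v i)" for v
    unfolding vec_inner_def by (intro sum.cong refl) (simp add: X)
  then have "vec_inner v (\<lambda>i. v i - mat_vec X v i) = (1 / t) *\<^sub>R (\<Sum>i<n. \<Sum>j<n. star (v i) * G i j * v j)" for v
    by (simp add: vec_inner_def scaleR_sum_right mat_vec_def sum_distrib_left mult.assoc)
  then have X1: "cstar_pos (vec_inner v (\<lambda>i. v i - mat_vec X v i))" for v
    using t pos by (simp add: cstar_pos_scaleR)
  obtain S where S: "\<And>i j. i < n \<Longrightarrow> j < n \<Longrightarrow> star (S i j) = S j i"
    "\<And>i j. i < n \<Longrightarrow> j < n \<Longrightarrow> (\<Sum>m<n. S i m * S m j) = (if i = j then 1 else 0) - X i j"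
    using hermitian_sqrt[OF hX mat_contraction[OF hX X0 X1]] by blast
  have "G i j = (\<Sum>k<n. star (sqrt t *\<^sub>R S k i) * (sqrt t *\<^sub>R S k j))" if "i < n" "j < n" for i j
  proof -
    have "(\<Sum>k<n. star (sqrt t *\<^sub>R S k i) * (sqrt t *\<^sub>R S k j)) = t *\<^sub>R (\<Sum>k<n. S i k * S k j)"
      unfolding scaleR_sum_right
      by (intro sum.cong refl) (use t that in \<open>simp add: star_scaleR S\<close>)
    then show ?thesis using t that by (simp add: S X_def)
  qed
  then show ?thesis unfolding mat_pos_def by (intro exI[of _ "\<lambda>k i. sqrt t *\<^sub>R S k i"]) blast
qed

end

section \<open>Hilbert modules\<close>

lemma scaleC_zero_right [simp]: "c *\<^sub>C (0::'a::cstar_algebra) = 0"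
  by (metis mult_zero_right scaleC_scaleC scaleC_zero)

lemma bounded_linear_scaleC: "bounded_linear ((*\<^sub>C) s :: 'd \<Rightarrow> 'd::cstar_algebra)"
  by (rule bounded_linear_intro[where K = "cmod s"])
    (simp_all add: scaleC_add_right scaleR_scaleC scaleC_scaleC norm_scaleC mult.commute)

context hilbert_module
begin

lemma inner_add_left:
  assumes "x \<in> hcarrier E" "y \<in> hcarrier E" "z \<in> hcarrier E"
  shows "hinner E (hadd E x y) z = hinner E x z + hinner E y z"
proof -
  have "star (hinner E z (hadd E x y)) = star (hinner E z x) + star (hinner E z y)"
    using assms by (simp add: inner_add_right star_add)
  then show ?thesis using assms by (simp add: inner_star add_closed)
qed

lemma inner_scale_left:
  assumes "x \<in> hcarrier E" "y \<in> hcarrier E"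
  shows "hinner E (hscale E c x) y = cnj c *\<^sub>C hinner E x y"
proof -
  have "star (hinner E y (hscale E c x)) = cnj c *\<^sub>C star (hinner E y x)"
    using assms by (simp add: inner_scale_right star_scaleC)
  then show ?thesis using assms by (simp add: inner_star scale_closed)
qed

lemma inner_act_left:
  assumes "x \<in> hcarrier E" "y \<in> hcarrier E"
  shows "hinner E (hact E x b) y = star b * hinner E x y"
proof -
  have "star (hinner E y (hact E x b)) = star b * star (hinner E y x)"
    using assms by (simp add: inner_act_right star_mult)
  then show ?thesis using assms by (simp add: inner_star act_closed)
qed

lemma diff_closed: "x \<in> hcarrier E \<Longrightarrow> y \<in> hcarrier E \<Longrightarrow> hdiff E x y \<in> hcarrier E"
  by (simp add: hdiff_def add_closed scale_closed)

lemma inner_diff_right: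
  "x \<in> hcarrier E \<Longrightarrow> y \<in> hcarrier E \<Longrightarrow> z \<in> hcarrier E \<Longrightarrow>
    hinner E z (hdiff E x y) = hinner E z x - hinner E z y"
  by (simp add: hdiff_def inner_add_right inner_scale_right scale_closed scaleC_minus_one)

lemma inner_diff_left:
  "x \<in> hcarrier E \<Longrightarrow> y \<in> hcarrier E \<Longrightarrow> z \<in> hcarrier E \<Longrightarrow>
    hinner E (hdiff E x y) z = hinner E x z - hinner E y z"
  by (simp add: hdiff_def inner_add_left inner_scale_left scale_closed scaleC_minus_one)

lemma inner_zero_right: "x \<in> hcarrier E \<Longrightarrow> hinner E x (hzero E) = 0"
  by (metis add_zero inner_add_right add_cancel_left_left zero_closed)

lemma inner_zero_left: "x \<in> hcarrier E \<Longrightarrow> hinner E (hzero E) x = 0"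
  by (metis inner_star inner_zero_right star_zero zero_closed)

lemmas closed = zero_closed add_closed scale_closed act_closed diff_closed

lemmas inner_simps = inner_add_right inner_scale_right inner_act_right inner_add_left
  inner_scale_left inner_act_left inner_diff_right inner_diff_left inner_zero_right inner_zero_left

lemma diff_zero_iff:
  assumes "x \<in> hcarrier E" "y \<in> hcarrier E" shows "hdiff E x y = hzero E \<longleftrightarrow> x = y"
proof
  assume *: "hdiff E x y = hzero E"
  have m: "hscale E (-1) y \<in> hcarrier E" using assms by (simp add: closed)
  have "y = hadd E (hadd E x (hscale E (-1) y)) y" using * assms by (simp add: hdiff_def add_zero)
  also have "\<dots> = hadd E x (hadd E y (hscale E (-1) y))"
    using assms m by (simp add: add_assoc add_commute)
  also have "\<dots> = x" using assms by (simp add: add_inverse add_commute[of x] zero_closed add_zero)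
  finally show "x = y" by simp
qed (simp add: hdiff_def add_inverse assms)

text \<open>Vector identities are proved with this rule throughout: after pairing with z they become
  identities in the algebra B.\<close>

lemma inner_eqI:
  assumes "x \<in> hcarrier E" "y \<in> hcarrier E" "\<And>z. z \<in> hcarrier E \<Longrightarrow> hinner E z x = hinner E z y"
  shows "x = y"
proof -
  have "hinner E (hdiff E x y) (hdiff E x y) = 0"
    using assms by (simp add: inner_diff_right diff_closed)
  then have "hdiff E x y = hzero E" using assms by (simp add: inner_eq_zero diff_closed)
  then show ?thesis using assms by (simp add: diff_zero_iff)
qed

lemma hnorm_nonneg: "0 \<le> hnorm E x"
  by (simp add: hnorm_def)

lemma hnorm_power2: "(hnorm E x)\<^sup>2 = norm (hinner E x x)"
  by (simp add: hnorm_def)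

lemma cauchy_schwarz:
  assumes x: "x \<in> hcarrier E" and y: "y \<in> hcarrier E"
  shows "norm (hinner E x y) \<le> hnorm E x * hnorm E y"
proof -
  have "(norm (hinner E x y))\<^sup>2 \<le> norm (hinner E x x) * norm (hinner E y y)"
  proof (rule cauchy_schwarz_cstar)
    fix b
    have "hinner E (hdiff E y (hact E x b)) (hdiff E y (hact E x b)) =
        hinner E y y - star b * hinner E x y - star (hinner E x y) * b + star b * hinner E x x * b"
      using x y by (simp add: inner_simps closed inner_star mult.assoc algebra_simps)
    then show "cstar_pos (hinner E y y - star b * hinner E x y - star (hinner E x y) * b + star b * hinner E x x * b)"
      using inner_pos[of "hdiff E y (hact E x b)"] x y by (simp add: closed)
  qed (use x y in \<open>simp_all add: inner_pos\<close>)
  then have "(norm (hinner E x y))\<^sup>2 \<le> (hnorm E x * hnorm E y)\<^sup>2"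
    by (simp add: power_mult_distrib hnorm_power2)
  then show ?thesis by (rule power2_le_imp_le) (simp add: hnorm_nonneg)
qed

lemma hnorm_add:
  assumes x: "x \<in> hcarrier E" and y: "y \<in> hcarrier E"
  shows "hnorm E (hadd E x y) \<le> hnorm E x + hnorm E y"
proof (rule power2_le_imp_le)
  have "(hnorm E (hadd E x y))\<^sup>2 = norm ((hinner E x x + hinner E x y) + (hinner E y x + hinner E y y))"
    using x y by (simp add: hnorm_power2 inner_simps closed algebra_simps)
  also have "\<dots> \<le> (norm (hinner E x x) + norm (hinner E x y)) + (norm (hinner E y x) + norm (hinner E y y))"
    by (intro norm_triangle_mono norm_triangle_ineq)
  also have "\<dots> \<le> (hnorm E x)\<^sup>2 + hnorm E x * hnorm E y + (hnorm E y * hnorm E x + (hnorm E y)\<^sup>2)"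
    unfolding hnorm_power2 by (intro add_mono cauchy_schwarz x y order_refl)
  also have "\<dots> = (hnorm E x + hnorm E y)\<^sup>2" by (simp add: power2_eq_square algebra_simps)
  finally show "(hnorm E (hadd E x y))\<^sup>2 \<le> (hnorm E x + hnorm E y)\<^sup>2" .
qed (simp add: hnorm_nonneg)

lemma hnorm_scale: "x \<in> hcarrier E \<Longrightarrow> hnorm E (hscale E c x) = cmod c * hnorm E x"
  by (simp add: hnorm_def inner_simps closed norm_scaleC real_sqrt_mult scaleC_scaleC norm_mult)

lemma hnorm_eq_0: "x \<in> hcarrier E \<Longrightarrow> hnorm E x = 0 \<longleftrightarrow> x = hzero E"
  using inner_eq_zero by (auto simp: hnorm_def inner_zero_right zero_closed)

lemma hnorm_diff_eq_0: "x \<in> hcarrier E \<Longrightarrow> y \<in> hcarrier E \<Longrightarrow> hnorm E (hdiff E x y) = 0 \<longleftrightarrow> x = y"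
  by (simp add: hnorm_eq_0 diff_closed diff_zero_iff)

lemma hnorm_diff_commute:
  "x \<in> hcarrier E \<Longrightarrow> y \<in> hcarrier E \<Longrightarrow> hnorm E (hdiff E x y) = hnorm E (hdiff E y x)"
  unfolding hnorm_def by (simp add: inner_simps closed algebra_simps)

lemma hnorm_diff_triangle:
  assumes "x \<in> hcarrier E" "y \<in> hcarrier E" "z \<in> hcarrier E"
  shows "hnorm E (hdiff E x z) \<le> hnorm E (hdiff E x y) + hnorm E (hdiff E y z)"
proof -
  have "hdiff E x z = hadd E (hdiff E x y) (hdiff E y z)"
    using assms by (intro inner_eqI) (simp_all add: closed inner_simps)
  then show ?thesis using assms by (simp add: hnorm_add diff_closed)
qed

section \<open>Convergence in a Hilbert module\<close>

definition hlim :: "(nat \<Rightarrow> 'e) \<Rightarrow> 'e \<Rightarrow> bool" where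
  "hlim X l \<longleftrightarrow> (\<forall>n. X n \<in> hcarrier E) \<and> l \<in> hcarrier E \<and> (\<lambda>n. hnorm E (hdiff E (X n) l)) \<longlonglongrightarrow> 0"

lemma hlimI:
  assumes "\<And>n. X n \<in> hcarrier E" "l \<in> hcarrier E" "\<And>n. hnorm E (hdiff E (X n) l) \<le> r n" "r \<longlonglongrightarrow> 0"
  shows "hlim X l"
proof -
  have "(\<lambda>n. hnorm E (hdiff E (X n) l)) \<longlonglongrightarrow> 0"
    by (rule tendsto_sandwich[OF _ _ tendsto_const assms(4)]) (simp_all add: hnorm_nonneg assms(3))
  with assms show ?thesis by (simp add: hlim_def)
qed

lemma hlim_closed: "hlim X l \<Longrightarrow> X n \<in> hcarrier E" "hlim X l \<Longrightarrow> l \<in> hcarrier E"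
  by (simp_all add: hlim_def)

lemma hlim_inner_right:
  assumes "hlim X l" "y \<in> hcarrier E"
  shows "(\<lambda>n. hinner E y (X n)) \<longlonglongrightarrow> hinner E y l"
proof (rule LIM_zero_cancel, rule Lim_null_comparison)
  show "(\<lambda>n. hnorm E y * hnorm E (hdiff E (X n) l)) \<longlonglongrightarrow> 0"
    using assms(1) unfolding hlim_def by (intro tendsto_mult_right_zero) auto
  show "\<forall>\<^sub>F n in sequentially. norm (hinner E y (X n) - hinner E y l) \<le> hnorm E y * hnorm E (hdiff E (X n) l)"
    using cauchy_schwarz[OF assms(2), of "hdiff E (X _) l"] assms
    by (simp add: hlim_def diff_closed inner_diff_right)
qed

lemma hlim_inner_left:
  assumes "hlim X l" "y \<in> hcarrier E"
  shows "(\<lambda>n. hinner E (X n) y) \<longlonglongrightarrow> hinner E l y"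
  using bounded_linear.tendsto[OF bounded_linear_star hlim_inner_right[OF assms]] assms
  by (simp add: inner_star hlim_def)

lemma hlim_hnorm:
  assumes "hlim X l" shows "(\<lambda>n. hnorm E (X n)) \<longlonglongrightarrow> hnorm E l"
proof (rule LIM_zero_cancel, rule Lim_null_comparison)
  show "(\<lambda>n. hnorm E (hdiff E (X n) l)) \<longlonglongrightarrow> 0" using assms by (simp add: hlim_def)
  have "\<bar>hnorm E x - hnorm E l\<bar> \<le> hnorm E (hdiff E x l)" if "x \<in> hcarrier E" "l \<in> hcarrier E" for x l
  proof -
    have "x = hadd E (hdiff E x l) l" "l = hadd E (hdiff E l x) x"
      using that by (auto intro!: inner_eqI simp: closed inner_simps)
    then have "hnorm E x \<le> hnorm E (hdiff E x l) + hnorm E l" "hnorm E l \<le> hnorm E (hdiff E l x) + hnorm E x"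
      using that by (metis hnorm_add diff_closed)+
    then show ?thesis using hnorm_diff_commute[OF that] by linarith
  qed
  then show "\<forall>\<^sub>F n in sequentially. norm (hnorm E (X n) - hnorm E l) \<le> hnorm E (hdiff E (X n) l)"
    using assms by (simp add: hlim_def)
qed

lemma hlim_const: "x \<in> hcarrier E \<Longrightarrow> hlim (\<lambda>_. x) x"
  using hnorm_diff_eq_0[of x x] by (simp add: hlim_def)

lemma hlim_unique:
  assumes "hlim X l" "hlim X m" shows "l = m"
proof (rule inner_eqI)
  fix z assume "z \<in> hcarrier E"
  then show "hinner E z l = hinner E z m"
    using hlim_inner_right[OF assms(1)] hlim_inner_right[OF assms(2)] LIMSEQ_unique by blast
qed (use assms in \<open>auto simp: hlim_def\<close>)

lemma hlim_inner:
  assumes X: "hlim X l" and Y: "hlim Y m"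
  shows "(\<lambda>n. hinner E (X n) (Y n)) \<longlonglongrightarrow> hinner E l m"
proof -
  have "(\<lambda>n. hinner E (X n) (hdiff E (Y n) m)) \<longlonglongrightarrow> 0"
  proof (rule Lim_null_comparison)
    have "(\<lambda>n. hnorm E (X n) * hnorm E (hdiff E (Y n) m)) \<longlonglongrightarrow> hnorm E l * 0"
      using Y by (intro tendsto_mult hlim_hnorm[OF X]) (simp add: hlim_def)
    then show "(\<lambda>n. hnorm E (X n) * hnorm E (hdiff E (Y n) m)) \<longlonglongrightarrow> 0" by simp
    show "\<forall>\<^sub>F n in sequentially. norm (hinner E (X n) (hdiff E (Y n) m)) \<le> hnorm E (X n) * hnorm E (hdiff E (Y n) m)"
      using X Y by (simp add: hlim_def cauchy_schwarz diff_closed)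
  qed
  from tendsto_add[OF this hlim_inner_left[OF X hlim_closed(2)[OF Y]]]
  show ?thesis using X Y by (simp add: hlim_def inner_diff_right)
qed

lemma Cauchy_hlim:
  assumes "\<And>n. X n \<in> hcarrier E"
    "\<And>e. e > 0 \<Longrightarrow> \<exists>M. \<forall>m\<ge>M. \<forall>n\<ge>M. hnorm E (hdiff E (X m) (X n)) < e"
  shows "\<exists>l. hlim X l"
  using complete[OF assms] assms(1) by (auto simp: hlim_def)

lemma hlim_Cauchy:
  assumes "hlim X l" "e > 0"
  shows "\<exists>M. \<forall>m\<ge>M. \<forall>n\<ge>M. hnorm E (hdiff E (X m) (X n)) < e"
proof -
  have "(\<lambda>n. hnorm E (hdiff E (X n) l)) \<longlonglongrightarrow> 0" using assms(1) by (simp add: hlim_def)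
  from LIMSEQ_D[OF this, of "e/2"] obtain M where M: "\<And>n. n \<ge> M \<Longrightarrow> hnorm E (hdiff E (X n) l) < e/2"
    using assms(2) by (auto simp: hnorm_nonneg)
  have "hnorm E (hdiff E (X m) (X n)) < e" if "m \<ge> M" "n \<ge> M" for m n
  proof -
    have c: "X m \<in> hcarrier E" "X n \<in> hcarrier E" "l \<in> hcarrier E" using assms(1) by (simp_all add: hlim_def)
    show ?thesis
      using hnorm_diff_triangle[OF c(1,3,2)] hnorm_diff_commute[OF c(3,2)] M[OF that(1)] M[OF that(2)]
      by linarith
  qed
  then show ?thesis by blast
qed

section \<open>Spans, closed spans and total sets\<close>

lemma hspan_closed:
  assumes "S \<subseteq> hcarrier E" shows "hspan E S \<subseteq> hcarrier E"
proof
  fix x assume "x \<in> hspan E S"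
  then show "x \<in> hcarrier E" by induction (use assms in \<open>auto simp: closed\<close>)
qed

lemma hspan_add:
  assumes S: "S \<subseteq> hcarrier E" and x: "x \<in> hspan E S" and y: "y \<in> hspan E S"
  shows "hadd E x y \<in> hspan E S"
  using x
proof induction
  case zero
  then show ?case using y hspan_closed[OF S] by (auto simp: add_zero)
next
  case (insert s x c)
  then have "hadd E (hadd E (hscale E c s) x) y = hadd E (hscale E c s) (hadd E x y)"
    using S y hspan_closed[OF S] by (intro add_assoc) (auto simp: closed)
  then show ?case using insert by (simp add: hspan.insert)
qed

lemma hspan_base:
  assumes "S \<subseteq> hcarrier E" "s \<in> S" shows "s \<in> hspan E S"
proof -
  have "s \<in> hcarrier E" using assms by blast
  then have "hadd E (hscale E 1 s) (hzero E) = s"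
    by (intro inner_eqI) (simp_all add: closed inner_simps)
  moreover have "hadd E (hscale E 1 s) (hzero E) \<in> hspan E S"
    by (rule hspan.insert[OF assms(2) hspan.zero])
  ultimately show ?thesis by simp
qed

lemma hspan_scale:
  assumes S: "S \<subseteq> hcarrier E" and x: "x \<in> hspan E S"
  shows "hscale E c x \<in> hspan E S"
  using x
proof induction
  case zero
  have "hscale E c (hzero E) = hzero E" by (rule inner_eqI) (simp_all add: closed inner_simps)
  then show ?case by (simp add: hspan.zero)
next
  case (insert s x d)
  then have "hscale E c (hadd E (hscale E d s) x) = hadd E (hscale E (c * d) s) (hscale E c x)"
    using subsetD[OF S insert(1)] subsetD[OF hspan_closed[OF S] insert(2)]
    by (intro inner_eqI) (simp_all add: closed inner_simps scaleC_scaleC scaleC_add_right)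
  then show ?case using insert by (simp add: hspan.insert)
qed

lemma closed_hspan_hlim:
  assumes S: "S \<subseteq> hcarrier E" and y: "y \<in> closed_hspan E S"
  obtains Z where "\<And>n. Z n \<in> hspan E S" "hlim Z y"
proof -
  have "\<exists>z\<in>hspan E S. hnorm E (hdiff E y z) < inverse (real (Suc n))" for n
    using y by (simp add: closed_hspan_def)
  then obtain Z where Z: "\<And>n. Z n \<in> hspan E S" "\<And>n. hnorm E (hdiff E y (Z n)) < inverse (real (Suc n))"
    by metis
  have "hlim Z y"
  proof (rule hlimI[OF _ _ _ LIMSEQ_inverse_real_of_nat])
    show c: "Z n \<in> hcarrier E" "y \<in> hcarrier E" for n
      using Z(1) y hspan_closed[OF S] by (auto simp: closed_hspan_def)
    show "hnorm E (hdiff E (Z n) y) \<le> inverse (real (Suc n))" for n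
      using Z(2)[of n] hnorm_diff_commute[OF c, of n] by simp
  qed
  with Z(1) show thesis by (rule that)
qed

lemma hlim_closed_hspan:
  assumes S: "S \<subseteq> hcarrier E" and Z: "\<And>n. Z n \<in> hspan E S" "hlim Z y"
  shows "y \<in> closed_hspan E S"
  unfolding closed_hspan_def
proof (intro CollectI conjI allI impI)
  show "y \<in> hcarrier E" using Z by (simp add: hlim_def)
  fix e :: real assume "e > 0"
  moreover have "(\<lambda>n. hnorm E (hdiff E (Z n) y)) \<longlonglongrightarrow> 0" using Z by (simp add: hlim_def)
  ultimately obtain n where "hnorm E (hdiff E (Z n) y) < e"
    using LIMSEQ_D[of "\<lambda>n. hnorm E (hdiff E (Z n) y)" 0 e] by (auto simp: hnorm_nonneg)
  then show "\<exists>z\<in>hspan E S. hnorm E (hdiff E y z) < e"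
    using Z by (intro bexI[of _ "Z n"]) (auto simp: hnorm_diff_commute hlim_def)
qed

lemma total_eqI:
  assumes tot: "hcarrier E = closed_hspan E S" and S: "S \<subseteq> hcarrier E"
    and x: "x \<in> hcarrier E" and y: "y \<in> hcarrier E" and eq: "\<And>s. s \<in> S \<Longrightarrow> hinner E s x = hinner E s y"
  shows "x = y"
proof (rule inner_eqI[OF x y])
  fix z assume "z \<in> hcarrier E"
  then obtain Z where Z: "\<And>n. Z n \<in> hspan E S" "hlim Z z" using tot closed_hspan_hlim[OF S] by blast
  have "hinner E v x = hinner E v y" if "v \<in> hspan E S" for v
    using that
  proof induction
    case zero
    then show ?case using x y by (simp add: inner_zero_left)
  next
    case (insert s v c)
    then show ?case using S hspan_closed[OF S] x y by (auto simp: inner_simps closed eq subset_iff)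
  qed
  then show "hinner E z x = hinner E z y"
    using hlim_inner_left[OF Z(2) x] hlim_inner_left[OF Z(2) y] Z(1) LIMSEQ_unique by simp
qed

section \<open>Linearity and contractivity of left actions\<close>

lemma left_actionD:
  assumes "left_action E \<sigma>"
  shows "x \<in> hcarrier E \<Longrightarrow> \<sigma> a x \<in> hcarrier E"
    and "x \<in> hcarrier E \<Longrightarrow> y \<in> hcarrier E \<Longrightarrow> hinner E (\<sigma> a x) y = hinner E x (\<sigma> (star a) y)"
    and "x \<in> hcarrier E \<Longrightarrow> \<sigma> 1 x = x"
    and "x \<in> hcarrier E \<Longrightarrow> \<sigma> (a + b) x = hadd E (\<sigma> a x) (\<sigma> b x)"
    and "x \<in> hcarrier E \<Longrightarrow> \<sigma> (c *\<^sub>C a) x = hscale E c (\<sigma> a x)"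
    and "x \<in> hcarrier E \<Longrightarrow> \<sigma> (a * b) x = \<sigma> a (\<sigma> b x)"
  using assms by (auto simp: left_action_def adjointable_maps_def is_adjoint_def)

context
  fixes \<sigma> assumes \<sigma>: "left_action E \<sigma>"
begin

lemmas action_closed = left_actionD(1)[OF \<sigma>]

lemma action_adjoint:
  "x \<in> hcarrier E \<Longrightarrow> y \<in> hcarrier E \<Longrightarrow> hinner E x (\<sigma> a y) = hinner E (\<sigma> (star a) x) y"
  using left_actionD(2)[OF \<sigma>, of x y "star a"] by (simp add: star_star)

lemma action_scale: "x \<in> hcarrier E \<Longrightarrow> \<sigma> a (hscale E c x) = hscale E c (\<sigma> a x)"
  by (rule inner_eqI) (simp_all add: closed action_closed action_adjoint inner_simps)

lemma action_act: "x \<in> hcarrier E \<Longrightarrow> \<sigma> a (hact E x b) = hact E (\<sigma> a x) b"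
  by (rule inner_eqI) (simp_all add: closed action_closed action_adjoint inner_simps)

text \<open>The definition of \<open>adjointable_maps\<close> provides some bound for each operator;
  the bound norm a comes from positivity. If h is a factor of (norm a)^2 -
  \<open>star a * a\<close>, then <a x, a x> + <h x, h x> = (norm a)^2 <x, x>, and both summands are
  positive.\<close>

lemma action_contractive:
  assumes x: "x \<in> hcarrier E" shows "hnorm E (\<sigma> a x) \<le> norm a * hnorm E x"
proof -
  obtain h where h: "(norm a)\<^sup>2 *\<^sub>R 1 - star a * a = star h * h"
    using norm_square_minus_pos[of a] by (auto simp: cstar_pos_def)
  have aa: "star a * a + star h * h = complex_of_real ((norm a)\<^sup>2) *\<^sub>C 1"
    using h unfolding scaleR_scaleC[symmetric] by (simp add: algebra_simps)
  have ih: "hinner E x (\<sigma> (star b * b) x) = hinner E (\<sigma> b x) (\<sigma> b x)" for b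
    using x by (simp add: left_actionD(6)[OF \<sigma>] action_adjoint action_closed star_star)
  have "hinner E (\<sigma> a x) (\<sigma> a x) + hinner E (\<sigma> h x) (\<sigma> h x) = hinner E x (\<sigma> (star a * a + star h * h) x)"
    using x by (simp add: left_actionD(4)[OF \<sigma>] inner_add_right action_closed ih)
  also have "\<dots> = (norm a)\<^sup>2 *\<^sub>R hinner E x x"
    unfolding aa using x by (simp add: left_actionD(3,5)[OF \<sigma>] inner_scale_right scaleR_scaleC)
  finally have "(norm a)\<^sup>2 *\<^sub>R hinner E x x - hinner E (\<sigma> a x) (\<sigma> a x) = hinner E (\<sigma> h x) (\<sigma> h x)"
    by (simp add: algebra_simps)
  then have "norm (hinner E (\<sigma> a x) (\<sigma> a x)) \<le> norm ((norm a)\<^sup>2 *\<^sub>R hinner E x x)"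
    using x by (intro cstar_pos_norm_mono) (simp_all add: inner_pos action_closed)
  then have "(hnorm E (\<sigma> a x))\<^sup>2 \<le> (norm a * hnorm E x)\<^sup>2"
    by (simp add: hnorm_power2 power_mult_distrib)
  then show ?thesis by (rule power2_le_imp_le) (simp add: hnorm_nonneg)
qed

end

end

section \<open>Unitaries between Hilbert modules with equal Gram matrices\<close>

text \<open>The vector v is the combination of the f i with the coefficients of u. Membership in
  \<open>hspan\<close> keeps no coefficients, so what is recorded is that u and v pair alike with
  every matching pair u', v'. Applied to e i, f i and to further vectors built this way, it yields
  all inner products needed for an isometry.\<close>

lemma matching_span_vector:
  assumes E: "hilbert_module E" and F: "hilbert_module F"
    and e: "range e \<subseteq> hcarrier E" and f: "range f \<subseteq> hcarrier F"
    and u: "u \<in> hspan E (range e)"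
  shows "\<exists>v\<in>hspan F (range f). \<forall>u'\<in>hcarrier E. \<forall>v'\<in>hcarrier F.
    (\<forall>i. hinner E (e i) u' = hinner F (f i) v') \<longrightarrow> hinner E u u' = hinner F v v'"
  using u
proof induction
  case zero
  then show ?case
    by (intro bexI[of _ "hzero F"])
      (simp_all add: hspan.zero hilbert_module.inner_zero_left[OF E] hilbert_module.inner_zero_left[OF F])
next
  case (insert s u c)
  then obtain i v where s: "s = e i" and v: "v \<in> hspan F (range f)"
    "\<forall>u'\<in>hcarrier E. \<forall>v'\<in>hcarrier F. (\<forall>i. hinner E (e i) u' = hinner F (f i) v') \<longrightarrow> hinner E u u' = hinner F v v'"
    by blast
  have [simp]: "e i \<in> hcarrier E" "f i \<in> hcarrier F" "u \<in> hcarrier E" "v \<in> hcarrier F" for i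
    using e f hilbert_module.hspan_closed[OF E e] hilbert_module.hspan_closed[OF F f] insert(2) v(1) by auto
  show ?case
    using v
    by (intro bexI[of _ "hadd F (hscale F c (f i)) v"])
      (auto simp: s hilbert_module.inner_simps[OF E] hilbert_module.inner_simps[OF F]
        hilbert_module.closed[OF E] hilbert_module.closed[OF F] intro: hspan.insert)
qed

text \<open>Approximate u by span vectors Z n and take partners W n. Equal inner products make W a
  Cauchy sequence along with Z, and its limit is the partner of u.\<close>

lemma matching_vector:
  assumes E: "hilbert_module E" and F: "hilbert_module F"
    and e: "range e \<subseteq> hcarrier E" and f: "range f \<subseteq> hcarrier F"
    and tot: "hcarrier E = closed_hspan E (range e)"
    and gram: "\<And>i j. hinner E (e i) (e j) = hinner F (f i) (f j)"
    and u: "u \<in> hcarrier E"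
  shows "\<exists>v\<in>hcarrier F. (\<forall>i. hinner E (e i) u = hinner F (f i) v) \<and>
    (\<forall>u'\<in>hcarrier E. \<forall>v'\<in>hcarrier F.
      (\<forall>i. hinner E (e i) u' = hinner F (f i) v') \<longrightarrow> hinner E u u' = hinner F v v')"
proof -
  interpret E: hilbert_module E by (rule E)
  interpret F: hilbert_module F by (rule F)
  obtain Z where Z: "\<And>n. Z n \<in> hspan E (range e)" "E.hlim Z u"
    using E.closed_hspan_hlim[OF e] u tot by blast
  obtain W where W: "\<And>n. W n \<in> hspan F (range f)"
    and m: "\<And>n u' v'. u' \<in> hcarrier E \<Longrightarrow> v' \<in> hcarrier F \<Longrightarrow>
      (\<And>i. hinner E (e i) u' = hinner F (f i) v') \<Longrightarrow> hinner E (Z n) u' = hinner F (W n) v'"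
    using matching_span_vector[OF E F e f Z(1)] by metis
  have [simp]: "e i \<in> hcarrier E" "f i \<in> hcarrier F" for i using e f by auto
  have [simp]: "Z n \<in> hcarrier E" "W n \<in> hcarrier F" for n
    using E.hspan_closed[OF e] F.hspan_closed[OF f] Z(1) W by auto
  have ZW: "hinner E (e i) (Z n) = hinner F (f i) (W n)" for i n
  proof -
    have "star (hinner E (Z n) (e i)) = star (hinner F (W n) (f i))"
      using m[of "e i" "f i" n] gram by simp
    then show ?thesis by (simp add: E.inner_star F.inner_star)
  qed
  \<comment> \<open>By \<open>ZW\<close> the vectors Z n and W n form a matching pair, so the
    property of Z m and W m applies to them.\<close>
  have ip: "hinner E (Z m) (Z n) = hinner F (W m) (W n)" for m n by (rule m) (simp_all add: ZW)
  have "hnorm F (hdiff F (W m) (W n)) = hnorm E (hdiff E (Z m) (Z n))" for m n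
    by (simp add: hnorm_def E.inner_simps F.inner_simps E.closed F.closed ip)
  then obtain v where v: "F.hlim W v"
    using F.Cauchy_hlim[of W] E.hlim_Cauchy[OF Z(2)] by auto
  have "hinner E (e i) u = hinner F (f i) v" for i
    using LIMSEQ_unique[OF E.hlim_inner_right[OF Z(2), of "e i"]] F.hlim_inner_right[OF v, of "f i"]
    by (simp add: ZW)
  moreover have "hinner E u u' = hinner F v v'"
    if "u' \<in> hcarrier E" "v' \<in> hcarrier F" "\<forall>i. hinner E (e i) u' = hinner F (f i) v'" for u' v'
    using LIMSEQ_unique[OF E.hlim_inner_left[OF Z(2) that(1)]] F.hlim_inner_left[OF v that(2)] m that
    by simp
  ultimately show ?thesis using F.hlim_closed(2)[OF v] by blast
qed

text \<open>The last conjunct determines U u by its inner products with the family f. Linearity and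
  intertwining are then checked on these inner products, which is why they are not listed among the
  conclusions.\<close>

lemma unitary_of_equal_gram:
  assumes E: "hilbert_module E" and F: "hilbert_module F"
    and e: "range e \<subseteq> hcarrier E" and f: "range f \<subseteq> hcarrier F"
    and totE: "hcarrier E = closed_hspan E (range e)" and totF: "hcarrier F = closed_hspan F (range f)"
    and gram: "\<And>i j. hinner E (e i) (e j) = hinner F (f i) (f j)"
  shows "\<exists>U. bij_betw U (hcarrier E) (hcarrier F) \<and>
    (\<forall>u\<in>hcarrier E. \<forall>v\<in>hcarrier E. hinner F (U u) (U v) = hinner E u v) \<and>
    (\<forall>u\<in>hcarrier E. \<forall>v\<in>hcarrier F. U u = v \<longleftrightarrow> (\<forall>i. hinner E (e i) u = hinner F (f i) v))"
proof -
  interpret E: hilbert_module E by (rule E)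
  interpret F: hilbert_module F by (rule F)
  note mE = matching_vector[OF E F e f totE gram]
  obtain U where U: "\<And>u. u \<in> hcarrier E \<Longrightarrow> U u \<in> hcarrier F"
    and Ue: "\<And>u i. u \<in> hcarrier E \<Longrightarrow> hinner E (e i) u = hinner F (f i) (U u)"
    and Ui: "\<And>u u' v'. u \<in> hcarrier E \<Longrightarrow> u' \<in> hcarrier E \<Longrightarrow> v' \<in> hcarrier F \<Longrightarrow>
      (\<forall>i. hinner E (e i) u' = hinner F (f i) v') \<Longrightarrow> hinner E u u' = hinner F (U u) v'"
    using mE by metis
  have uniq: "U u = v" if "u \<in> hcarrier E" "v \<in> hcarrier F" "\<forall>i. hinner E (e i) u = hinner F (f i) v" for u v
    by (rule F.total_eqI[OF totF f]) (use U Ue that in auto)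
  have "inj_on U (hcarrier E)"
  proof (rule inj_onI)
    fix u v assume uv: "u \<in> hcarrier E" "v \<in> hcarrier E" "U u = U v"
    show "u = v" by (rule E.total_eqI[OF totE e]) (use uv Ue in auto)
  qed
  moreover have "v \<in> U ` hcarrier E" if v: "v \<in> hcarrier F" for v
  proof -
    obtain u where "u \<in> hcarrier E" "\<forall>i. hinner F (f i) v = hinner E (e i) u"
      using matching_vector[OF F E f e totF gram[symmetric] v] by blast
    then show ?thesis using uniq v by (intro image_eqI[of _ _ u]) auto
  qed
  ultimately have "bij_betw U (hcarrier E) (hcarrier F)" using U by (auto simp: bij_betw_def)
  moreover have "hinner F (U u) (U v) = hinner E u v" if "u \<in> hcarrier E" "v \<in> hcarrier E" for u v
    using Ui[OF that U[OF that(2)]] Ue[OF that(2)] by simp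
  moreover have "U u = v \<longleftrightarrow> (\<forall>i. hinner E (e i) u = hinner F (f i) v)"
    if "u \<in> hcarrier E" "v \<in> hcarrier F" for u v
    using uniq[OF that] Ue[OF that(1)] by blast
  ultimately show ?thesis by blast
qed

section \<open>Words in two left actions, and the isomorphism of minimal representations\<close>

locale two_actions = hilbert_module E
  for E :: "('e, 'b::cstar_algebra) hmod" +
  fixes \<sigma>1 \<sigma>2 :: "'a::cstar_algebra \<Rightarrow> 'e \<Rightarrow> 'e"
  assumes \<sigma>1: "left_action E \<sigma>1" and \<sigma>2: "left_action E \<sigma>2"
begin

abbreviation letter :: "'a + 'a \<Rightarrow> 'e \<Rightarrow> 'e" where
  "letter \<equiv> case_sum \<sigma>1 \<sigma>2"

abbreviation wact :: "('a + 'a) list \<Rightarrow> 'e \<Rightarrow> 'e" where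
  "wact \<equiv> foldr letter"

lemma letter_closed: "u \<in> hcarrier E \<Longrightarrow> letter l u \<in> hcarrier E"
  by (cases l) (simp_all add: action_closed \<sigma>1 \<sigma>2)

lemma letter_adjoint:
  "u \<in> hcarrier E \<Longrightarrow> v \<in> hcarrier E \<Longrightarrow>
    hinner E (letter l u) v = hinner E u (letter (map_sum star star l) v)"
  by (cases l) (simp_all add: left_actionD(2) \<sigma>1 \<sigma>2)

lemma wact_closed: "u \<in> hcarrier E \<Longrightarrow> wact w u \<in> hcarrier E"
  by (induction w) (simp_all add: letter_closed)

lemma wact_adjoint:
  "u \<in> hcarrier E \<Longrightarrow> v \<in> hcarrier E \<Longrightarrow>
    hinner E (wact w u) v = hinner E u (wact (rev (map (map_sum star star) w)) v)"
  by (induction w arbitrary: v) (simp_all add: letter_closed wact_closed letter_adjoint)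

lemma wact_scale: "u \<in> hcarrier E \<Longrightarrow> wact w (hscale E c u) = hscale E c (wact w u)"
proof (induction w)
  case (Cons l w)
  then show ?case by (cases l) (simp_all add: action_scale \<sigma>1 \<sigma>2 wact_closed)
qed simp

lemma wact_act: "u \<in> hcarrier E \<Longrightarrow> wact w (hact E u b) = hact E (wact w u) b"
proof (induction w)
  case (Cons l w)
  then show ?case by (cases l) (simp_all add: action_act \<sigma>1 \<sigma>2 wact_closed)
qed simp

text \<open>The left word moves to the other side as its reversed adjoint, and b and c leave the
  inner product by module linearity. So the moments of x are all that enters the Gram
  matrix.\<close>

lemma inner_words:
  assumes "x \<in> hcarrier E"
  shows "hinner E (wact v (hact E x b)) (wact w (hact E x c)) =
    star b * hinner E x (wact (rev (map (map_sum star star) v) @ w) x) * c"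
  using assms
  by (simp add: wact_act wact_closed closed inner_act_left inner_act_right wact_adjoint mult.assoc)

end

text \<open>In the last clause a nonempty word is split into first letter and rest, which exhibits
  the total set as the range of a function, the form used by
  \<open>unitary_of_equal_gram\<close>.\<close>

lemma minimal_joint_repsD:
  assumes "(E, \<sigma>1, \<sigma>2, x) \<in> minimal_joint_reps \<phi>1 \<phi>2"
  shows "two_actions E \<sigma>1 \<sigma>2" "x \<in> hcarrier E" "hinner E x x = 1"
    "\<phi>1 a = hinner E x (\<sigma>1 a x)" "\<phi>2 a = hinner E x (\<sigma>2 a x)"
    "hcarrier E = closed_hspan E (range (\<lambda>(l, w, b). foldr (case_sum \<sigma>1 \<sigma>2) (l # w) (hact E x b)))"
proof -
  have "{foldr (case_sum \<sigma>1 \<sigma>2) w (hact E x b) |w b. w \<noteq> []} =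
      range (\<lambda>(l, w, b). foldr (case_sum \<sigma>1 \<sigma>2) (l # w) (hact E x b))"
    by (auto simp: image_iff neq_Nil_conv simp del: foldr.simps) (metis list.distinct(1))
  with assms show "hcarrier E = closed_hspan E (range (\<lambda>(l, w, b). foldr (case_sum \<sigma>1 \<sigma>2) (l # w) (hact E x b)))"
    by (simp add: minimal_joint_reps_def)
qed (use assms in \<open>auto simp: minimal_joint_reps_def joint_reps_def two_actions_def two_actions_axioms_def\<close>)

lemma joint_rep_iso_if_equal_moments:
  assumes R: "(E, \<sigma>1, \<sigma>2, x) \<in> minimal_joint_reps \<phi>1 \<phi>2"
    and S: "(F, \<tau>1, \<tau>2, y) \<in> minimal_joint_reps \<psi>1 \<psi>2"
    and eq: "\<And>w. hinner E x (foldr (case_sum \<sigma>1 \<sigma>2) w x) = hinner F y (foldr (case_sum \<tau>1 \<tau>2) w y)"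
  shows "joint_rep_iso (E, \<sigma>1, \<sigma>2, x) (F, \<tau>1, \<tau>2, y)"
proof -
  note R = minimal_joint_repsD[OF R] and S = minimal_joint_repsD[OF S]
  interpret E: two_actions E \<sigma>1 \<sigma>2 by (rule R)
  interpret F: two_actions F \<tau>1 \<tau>2 by (rule S)
  define e where "e = (\<lambda>(l, w, b). E.wact (l # w) (hact E x b))"
  define f where "f = (\<lambda>(l, w, b). F.wact (l # w) (hact F y b))"
  have e: "e i \<in> hcarrier E" and f: "f i \<in> hcarrier F" for i
    by (cases i, simp add: e_def f_def E.wact_closed F.wact_closed E.letter_closed F.letter_closed
        E.closed F.closed R(2) S(2))+
  have re: "range e \<subseteq> hcarrier E" and rf: "range f \<subseteq> hcarrier F" using e f by auto
  have gram: "hinner E (e i) (e j) = hinner F (f i) (f j)" for i j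
    unfolding e_def f_def
    by (cases i, cases j) (simp only: prod.case E.inner_words F.inner_words R(2) S(2) eq)
  obtain U where bij: "bij_betw U (hcarrier E) (hcarrier F)"
    and ip: "\<And>u v. u \<in> hcarrier E \<Longrightarrow> v \<in> hcarrier E \<Longrightarrow> hinner F (U u) (U v) = hinner E u v"
    and U: "\<And>u v. u \<in> hcarrier E \<Longrightarrow> v \<in> hcarrier F \<Longrightarrow>
      U u = v \<longleftrightarrow> (\<forall>i. hinner E (e i) u = hinner F (f i) v)"
    using unitary_of_equal_gram[OF E.hilbert_module_axioms F.hilbert_module_axioms re rf
        R(6)[folded e_def] S(6)[folded f_def] gram] by blast
  have cl: "U u \<in> hcarrier F" if "u \<in> hcarrier E" for u using bij that by (auto simp: bij_betw_def)
  have Ue: "hinner E (e i) u = hinner F (f i) (U u)" if "u \<in> hcarrier E" for u i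
    using iffD1[OF U[OF that cl[OF that]] refl] by blast
  have letter: "U (E.letter l u) = F.letter l (U u)" if u: "u \<in> hcarrier E" for l u
  proof (rule iffD2[OF U])
    have "hinner E (e i) (E.letter l u) = hinner F (f i) (F.letter l (U u))" for i
    proof -
      obtain k w b where i: "i = (k, w, b)" by (cases i)
      \<comment> \<open>Moving the letter l to the left puts its adjoint in front of e i, and the
        result is again a member of the total family.\<close>
      define i' where "i' = (map_sum star star l, k # w, b)"
      have ss: "map_sum star star (map_sum star star l) = l"
        by (cases l) (simp_all add: star_star)
      have "e i' = E.letter (map_sum star star l) (e i)" "f i' = F.letter (map_sum star star l) (f i)"
        by (simp_all add: e_def f_def i i'_def)
      then have "hinner E (e i) (E.letter l u) = hinner E (e i') u"
        "hinner F (f i) (F.letter l (U u)) = hinner F (f i') (U u)"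
        using e f u cl by (simp_all add: E.letter_adjoint F.letter_adjoint ss)
      then show ?thesis using Ue[OF u] by simp
    qed
    then show "\<forall>i. hinner E (e i) (E.letter l u) = hinner F (f i) (F.letter l (U u))" by blast
  qed (use u cl in \<open>simp_all add: E.letter_closed F.letter_closed\<close>)
  have "U (hadd E u v) = hadd F (U u) (U v)" if "u \<in> hcarrier E" "v \<in> hcarrier E" for u v
    using that by (subst U) (simp_all add: E.closed F.closed cl e f E.inner_simps F.inner_simps Ue)
  moreover have "U (hscale E c u) = hscale F c (U u)" if "u \<in> hcarrier E" for u c
    using that by (subst U) (simp_all add: E.closed F.closed cl e f E.inner_simps F.inner_simps Ue)
  moreover have "U (hact E u b) = hact F (U u) b" if "u \<in> hcarrier E" for u b
    using that by (subst U) (simp_all add: E.closed F.closed cl e f E.inner_simps F.inner_simps Ue)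
  moreover have "U (\<sigma>1 a u) = \<tau>1 a (U u)" "U (\<sigma>2 a u) = \<tau>2 a (U u)" if "u \<in> hcarrier E" for u a
    using letter[OF that, of "Inl a"] letter[OF that, of "Inr a"] by simp_all
  moreover have "U x = y"
  proof (subst U)
    \<comment> \<open>The family contains only nonempty words; x is reached through the one-letter
      word of the unit.\<close>
    have "e (Inl 1, [], 1) = x" "f (Inl 1, [], 1) = y"
      by (simp_all add: e_def f_def E.act_one F.act_one E.left_actionD(3)[OF E.\<sigma>1] F.left_actionD(3)[OF F.\<sigma>1] R(2) S(2))
    then show "\<forall>i. hinner E (e i) x = hinner F (f i) y" using gram by metis
  qed (rule R(2) S(2))+
  ultimately show ?thesis using bij ip by auto
qed

section \<open>The free product of two left actions\<close>

context two_actions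
begin

definition fa_form :: "('a, 'a) free_alg \<Rightarrow> 'e \<Rightarrow> 'e \<Rightarrow> 'b" where
  "fa_form f y u = Sum_any (\<lambda>w. Poly_Mapping.lookup f w *\<^sub>C hinner E y (wact (letters w) u))"

lemma fa_form_add: "fa_form (f + g) y u = fa_form f y u + fa_form g y u"
proof -
  have fin: "finite {w. Poly_Mapping.lookup h w *\<^sub>C hinner E y (wact (letters w) u) \<noteq> 0}" for h
    by (rule finite_subset[OF _ finite_lookup[of h]]) auto
  show ?thesis by (simp add: fa_form_def lookup_add scaleC_add_left Sum_any.distrib[OF fin fin])
qed

lemma fa_form_single:
  "fa_form (Poly_Mapping.single w c) y u = c *\<^sub>C hinner E y (wact (letters w) u)"
proof -
  have "(\<lambda>v. Poly_Mapping.lookup (Poly_Mapping.single w c) v *\<^sub>C hinner E y (wact (letters v) u)) =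
      (\<lambda>v. c *\<^sub>C hinner E y (wact (letters w) u) when v = w)"
    by (auto simp: lookup_single when_def)
  then show ?thesis unfolding fa_form_def by (simp only: Sum_any_when_equal)
qed

text \<open>The carrier has no type class structure, so the sum \<open>\<Sum>\<^sub>w f(w) w u\<close> is determined by its inner
  products instead.\<close>

lemma fa_act_ex:
  assumes u: "u \<in> hcarrier E"
  shows "\<exists>z\<in>hcarrier E. \<forall>y\<in>hcarrier E. hinner E y z = fa_form f y u"
proof (induction f rule: poly_mapping_additive_induct)
  case 1
  then show ?case by (intro bexI[of _ "hzero E"]) (simp_all add: inner_zero_right closed fa_form_def)
next
  case (2 w c)
  then show ?case using u
    by (intro bexI[of _ "hscale E c (wact (letters w) u)"])
      (simp_all add: fa_form_single inner_scale_right wact_closed closed)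
next
  case (3 f g)
  then obtain z z' where "z \<in> hcarrier E" "\<forall>y\<in>hcarrier E. hinner E y z = fa_form f y u"
    "z' \<in> hcarrier E" "\<forall>y\<in>hcarrier E. hinner E y z' = fa_form g y u" by blast
  then show ?case
    by (intro bexI[of _ "hadd E z z'"]) (simp_all add: fa_form_add inner_add_right closed)
qed

definition fa_act :: "('a, 'a) free_alg \<Rightarrow> 'e \<Rightarrow> 'e" where
  "fa_act f u = (SOME z. z \<in> hcarrier E \<and> (\<forall>y\<in>hcarrier E. hinner E y z = fa_form f y u))"

lemma fa_act:
  assumes "u \<in> hcarrier E"
  shows fa_act_closed: "fa_act f u \<in> hcarrier E"
    and inner_fa_act: "y \<in> hcarrier E \<Longrightarrow> hinner E y (fa_act f u) = fa_form f y u"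
proof -
  have "\<exists>z. z \<in> hcarrier E \<and> (\<forall>y\<in>hcarrier E. hinner E y z = fa_form f y u)"
    using fa_act_ex[OF assms, of f] by blast
  from someI_ex[OF this] show "fa_act f u \<in> hcarrier E"
    "y \<in> hcarrier E \<Longrightarrow> hinner E y (fa_act f u) = fa_form f y u"
    by (simp_all add: fa_act_def)
qed

lemma fa_act_add_left:
  "u \<in> hcarrier E \<Longrightarrow> fa_act (f + g) u = hadd E (fa_act f u) (fa_act g u)"
  by (rule inner_eqI) (simp_all add: fa_act_closed closed inner_add_right inner_fa_act fa_form_add)

lemma fa_act_single:
  "u \<in> hcarrier E \<Longrightarrow> fa_act (Poly_Mapping.single w c) u = hscale E c (wact (letters w) u)"
  by (rule inner_eqI)
    (simp_all add: fa_act_closed closed inner_scale_right inner_fa_act fa_form_single wact_closed)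

lemma fa_act_zero: "u \<in> hcarrier E \<Longrightarrow> fa_act 0 u = hzero E"
  by (rule inner_eqI) (simp_all add: fa_act_closed closed inner_fa_act inner_zero_right fa_form_def)

lemma fa_act_adjoint:
  assumes u: "u \<in> hcarrier E" and v: "v \<in> hcarrier E"
  shows "hinner E (fa_act f u) v = hinner E u (fa_act (fa_star f) v)"
proof (induction f rule: poly_mapping_additive_induct)
  case 1
  then show ?case using u v by (simp add: fa_star_zero fa_act_zero inner_zero_left inner_zero_right)
next
  case (2 w c)
  show ?case using u v
    by (simp add: fa_star_single fa_act_single inner_scale_left inner_scale_right wact_closed
        wact_adjoint word_star_def)
next
  case (3 f g)
  then show ?case using u v
    by (simp add: fa_star_add fa_act_add_left inner_add_left inner_add_right fa_act_closed)
qed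

lemma fa_act_adjoint': "u \<in> hcarrier E \<Longrightarrow> v \<in> hcarrier E \<Longrightarrow>
    hinner E u (fa_act f v) = hinner E (fa_act (fa_star f) u) v"
  using fa_act_adjoint[of u v "fa_star f"] by (simp add: fa.st_st)

lemma fa_act_add:
  "u \<in> hcarrier E \<Longrightarrow> v \<in> hcarrier E \<Longrightarrow> fa_act f (hadd E u v) = hadd E (fa_act f u) (fa_act f v)"
  by (rule inner_eqI) (simp_all add: closed fa_act_closed fa_act_adjoint' inner_simps)

lemma fa_act_scale: "u \<in> hcarrier E \<Longrightarrow> fa_act f (hscale E c u) = hscale E c (fa_act f u)"
  by (rule inner_eqI) (simp_all add: closed fa_act_closed fa_act_adjoint' inner_simps)

lemma fa_act_mult:
  assumes u: "u \<in> hcarrier E" shows "fa_act (f * g) u = fa_act f (fa_act g u)"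
proof (induction f rule: poly_mapping_additive_induct)
  case 1
  then show ?case using u by (simp add: fa_act_zero fa_act_closed)
next
  case (2 v c)
  show ?case
  proof (induction g rule: poly_mapping_additive_induct)
    case 1
    have "hscale E c (wact (letters v) (hzero E)) = hzero E"
      using fa_act_single[of "hzero E" v c] fa_act_adjoint'[of _ "hzero E" "Poly_Mapping.single v c"]
      by (intro inner_eqI) (simp_all add: closed wact_closed fa_act_closed inner_zero_right)
    then show ?case using u by (simp add: fa_act_zero fa_act_single closed)
  next
    case (2 w d)
    show ?case using u
      by (simp add: mult_single fa_act_single wact_closed closed wact_scale scale_scale plus_word_def)
  next
    case (3 g h)
    then show ?case using u by (simp add: distrib_left fa_act_add_left fa_act_add fa_act_closed)
  qed
next
  case (3 f g)
  then show ?case using u by (simp add: distrib_right fa_act_add_left fa_act_closed)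
qed

lemma fa_act_fa_scale:
  "u \<in> hcarrier E \<Longrightarrow> fa_act (fa_scale c f) u = hscale E c (fa_act f u)"
  by (simp add: fa_scale_def fa_act_mult fa_act_single fa_act_closed zero_word_def)

lemma fa_act_one: "u \<in> hcarrier E \<Longrightarrow> fa_act 1 u = u"
  using fa_act_single[of u 0 1, unfolded single_one] by (simp add: zero_word_def scale_one)

lemma fa_act_diff:
  "u \<in> hcarrier E \<Longrightarrow> fa_act (f - g) u = hdiff E (fa_act f u) (fa_act g u)"
  using fa_act_add_left[of u f "fa_scale (-1) g"] fa_act_fa_scale[of u "-1" g]
  by (simp add: fa.sc_minus hdiff_def)

lemma fa_act_gen: "u \<in> hcarrier E \<Longrightarrow> fa_act (fa_gen l) u = letter l u"
  by (simp add: fa_gen_def fa_act_single scale_one letter_closed)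

lemma wact_bounded: "\<exists>B\<ge>0. \<forall>u\<in>hcarrier E. hnorm E (wact w u) \<le> B * hnorm E u"
proof (induction w)
  case Nil
  then show ?case by (intro exI[of _ 1]) simp
next
  case (Cons l w)
  then obtain B where B: "B \<ge> 0" "\<And>u. u \<in> hcarrier E \<Longrightarrow> hnorm E (wact w u) \<le> B * hnorm E u" by blast
  define C where "C = (case l of Inl a \<Rightarrow> norm a | Inr a \<Rightarrow> norm a)"
  have C: "C \<ge> 0" "\<And>u. u \<in> hcarrier E \<Longrightarrow> hnorm E (letter l u) \<le> C * hnorm E u"
    using action_contractive[OF \<sigma>1] action_contractive[OF \<sigma>2] by (auto simp: C_def split: sum.split)
  have "hnorm E (wact (l # w) u) \<le> (C * B) * hnorm E u" if "u \<in> hcarrier E" for u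
    using order_trans[OF C(2)[OF wact_closed[OF that, of w]] mult_left_mono[OF B(2)[OF that] C(1)]]
    by (simp add: mult.assoc)
  then show ?case using B C by (intro exI[of _ "C * B"]) auto
qed

text \<open>Any bound will do here; it makes the supremum \<open>fa_opnorm\<close> finite.\<close>

lemma fa_act_bounded: "\<exists>B\<ge>0. \<forall>u\<in>hcarrier E. hnorm E (fa_act f u) \<le> B * hnorm E u"
proof (induction f rule: poly_mapping_additive_induct)
  case 1
  then show ?case
    by (intro exI[of _ 0]) (simp add: fa_act_zero hnorm_eq_0[THEN iffD2] closed)
next
  case (2 w c)
  obtain B where B: "B \<ge> 0" "\<And>u. u \<in> hcarrier E \<Longrightarrow> hnorm E (wact (letters w) u) \<le> B * hnorm E u"
    using wact_bounded by blast
  have "hnorm E (fa_act (Poly_Mapping.single w c) u) \<le> (cmod c * B) * hnorm E u" if "u \<in> hcarrier E" for u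
    using mult_left_mono[OF B(2)[OF that], of "cmod c"] that
    by (simp add: fa_act_single hnorm_scale wact_closed mult.assoc)
  then show ?case using B by (intro exI[of _ "cmod c * B"]) auto
next
  case (3 f g)
  then obtain B C where B: "B \<ge> 0" "\<And>u. u \<in> hcarrier E \<Longrightarrow> hnorm E (fa_act f u) \<le> B * hnorm E u"
    and C: "C \<ge> 0" "\<And>u. u \<in> hcarrier E \<Longrightarrow> hnorm E (fa_act g u) \<le> C * hnorm E u" by metis
  have "hnorm E (fa_act (f + g) u) \<le> (B + C) * hnorm E u" if u: "u \<in> hcarrier E" for u
    using hnorm_add[OF fa_act_closed fa_act_closed, OF u u, of f g] B(2)[OF u] C(2)[OF u]
    by (simp add: fa_act_add_left u distrib_right)
  then show ?case using B C by (intro exI[of _ "B + C"]) auto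
qed

section \<open>The operator norm of the action as a C*-seminorm on the free algebra\<close>

definition fa_opnorm :: "('a, 'a) free_alg \<Rightarrow> real" where
  "fa_opnorm f = (SUP u\<in>{u \<in> hcarrier E. hnorm E u \<le> 1}. hnorm E (fa_act f u))"

lemma fa_opnorm_bdd: "bdd_above ((\<lambda>u. hnorm E (fa_act f u)) ` {u \<in> hcarrier E. hnorm E u \<le> 1})"
proof -
  obtain B where B: "B \<ge> 0" "\<And>u. u \<in> hcarrier E \<Longrightarrow> hnorm E (fa_act f u) \<le> B * hnorm E u"
    using fa_act_bounded by blast
  show ?thesis
  proof (rule bdd_aboveI2)
    fix u assume "u \<in> {u \<in> hcarrier E. hnorm E u \<le> 1}"
    then show "hnorm E (fa_act f u) \<le> B"
      using B(2)[of u] mult_left_mono[OF _ B(1), of "hnorm E u" 1] by auto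
  qed
qed

lemma fa_opnorm_le:
  assumes "B \<ge> 0" "\<And>u. u \<in> hcarrier E \<Longrightarrow> hnorm E (fa_act f u) \<le> B * hnorm E u"
  shows "fa_opnorm f \<le> B"
  unfolding fa_opnorm_def
proof (rule cSUP_least)
  show "{u \<in> hcarrier E. hnorm E u \<le> 1} \<noteq> {}"
    using hnorm_eq_0[OF zero_closed] zero_closed by force
  fix u assume u: "u \<in> {u \<in> hcarrier E. hnorm E u \<le> 1}"
  then show "hnorm E (fa_act f u) \<le> B"
    using assms(2)[of u] mult_left_mono[OF _ assms(1), of "hnorm E u" 1] by auto
qed

lemma le_fa_opnorm:
  assumes u: "u \<in> hcarrier E"
  shows "hnorm E (fa_act f u) \<le> fa_opnorm f * hnorm E u"
proof (cases "hnorm E u = 0")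
  case True
  obtain B where "hnorm E (fa_act f u) \<le> B * hnorm E u" using fa_act_bounded u by blast
  then show ?thesis using True by simp
next
  case False
  then have p: "hnorm E u > 0" using hnorm_nonneg[of u] by simp
  let ?v = "hscale E (complex_of_real (1 / hnorm E u)) u"
  have "hnorm E ?v = 1" using p u by (simp add: hnorm_scale norm_divide)
  then have "hnorm E (fa_act f ?v) \<le> fa_opnorm f"
    unfolding fa_opnorm_def using u by (intro cSUP_upper[OF _ fa_opnorm_bdd]) (simp add: closed)
  moreover have "hnorm E (fa_act f ?v) = hnorm E (fa_act f u) / hnorm E u"
    using p u by (simp add: fa_act_scale hnorm_scale fa_act_closed norm_divide)
  ultimately show ?thesis using p by (simp only: pos_divide_le_eq)
qed

lemma fa_opnorm_nonneg: "0 \<le> fa_opnorm f"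
proof -
  have "hzero E \<in> {u \<in> hcarrier E. hnorm E u \<le> 1}"
    using hnorm_eq_0[OF zero_closed] zero_closed by simp
  from cSUP_upper[OF this fa_opnorm_bdd[of f]] show ?thesis
    using hnorm_nonneg order_trans unfolding fa_opnorm_def by blast
qed

lemma fa_opnorm_mult: "fa_opnorm (f * g) \<le> fa_opnorm f * fa_opnorm g"
proof (rule fa_opnorm_le)
  fix u assume u: "u \<in> hcarrier E"
  have "hnorm E (fa_act f (fa_act g u)) \<le> fa_opnorm f * hnorm E (fa_act g u)"
    by (rule le_fa_opnorm[OF fa_act_closed[OF u]])
  also have "\<dots> \<le> fa_opnorm f * (fa_opnorm g * hnorm E u)"
    by (rule mult_left_mono[OF le_fa_opnorm[OF u] fa_opnorm_nonneg])
  finally show "hnorm E (fa_act (f * g) u) \<le> fa_opnorm f * fa_opnorm g * hnorm E u"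
    by (simp add: fa_act_mult u mult.assoc)
qed (simp add: fa_opnorm_nonneg)

text \<open>Cauchy-Schwarz for <u, \<open>fa_star f * f\<close> u>, whose norm is the square of the
  norm of f u. The isometry estimate \<open>fa_opnorm_star\<close> is deduced from this half of the
  C*-identity and then gives the other half.\<close>

lemma fa_opnorm_star_mult: "(fa_opnorm f)\<^sup>2 \<le> fa_opnorm (fa_star f * f)"
proof -
  have "fa_opnorm f \<le> sqrt (fa_opnorm (fa_star f * f))"
  proof (rule fa_opnorm_le)
    fix u assume u: "u \<in> hcarrier E"
    have "(hnorm E (fa_act f u))\<^sup>2 = norm (hinner E u (fa_act (fa_star f * f) u))"
      using u by (simp add: hnorm_power2 fa_act_adjoint fa_act_mult fa_act_closed)
    also have "\<dots> \<le> hnorm E u * hnorm E (fa_act (fa_star f * f) u)"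
      by (rule cauchy_schwarz[OF u fa_act_closed[OF u]])
    also have "\<dots> \<le> hnorm E u * (fa_opnorm (fa_star f * f) * hnorm E u)"
      by (rule mult_left_mono[OF le_fa_opnorm[OF u] hnorm_nonneg])
    also have "\<dots> = (sqrt (fa_opnorm (fa_star f * f)) * hnorm E u)\<^sup>2"
      by (simp add: power_mult_distrib fa_opnorm_nonneg power2_eq_square[of "hnorm E u"])
    finally show "hnorm E (fa_act f u) \<le> sqrt (fa_opnorm (fa_star f * f)) * hnorm E u"
      by (rule power2_le_imp_le) (simp add: hnorm_nonneg fa_opnorm_nonneg)
  qed (simp add: fa_opnorm_nonneg)
  then show ?thesis
    using power_mono[OF _ fa_opnorm_nonneg, of f _ 2] fa_opnorm_nonneg by fastforce
qed

lemma fa_opnorm_star: "fa_opnorm (fa_star f) \<le> fa_opnorm f"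
proof (rule fa_opnorm_le)
  fix u assume u: "u \<in> hcarrier E"
  have "(fa_opnorm (fa_star f))\<^sup>2 \<le> fa_opnorm f * fa_opnorm (fa_star f)"
    using order_trans[OF fa_opnorm_star_mult fa_opnorm_mult, of "fa_star f"] by (simp add: fa.st_st)
  then have "fa_opnorm (fa_star f) \<le> fa_opnorm f"
    using fa_opnorm_nonneg[of "fa_star f"] fa_opnorm_nonneg[of f]
    by (cases "fa_opnorm (fa_star f) = 0") (auto simp: power2_eq_square)
  then show "hnorm E (fa_act (fa_star f) u) \<le> fa_opnorm f * hnorm E u"
    using order_trans[OF le_fa_opnorm[OF u] mult_right_mono[OF _ hnorm_nonneg]] by blast
qed (rule fa_opnorm_nonneg)

lemma fa_opnorm_scale: "fa_opnorm (fa_scale c f) = cmod c * fa_opnorm f"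
proof (rule antisym)
  have le: "fa_opnorm (fa_scale c f) \<le> cmod c * fa_opnorm f" for c f
    using mult_left_mono[OF le_fa_opnorm[of _ f], of _ "cmod c"]
    by (intro fa_opnorm_le) (simp_all add: fa_opnorm_nonneg fa_act_fa_scale hnorm_scale fa_act_closed mult.assoc)
  show "fa_opnorm (fa_scale c f) \<le> cmod c * fa_opnorm f" by (rule le)
  show "cmod c * fa_opnorm f \<le> fa_opnorm (fa_scale c f)"
  proof (cases "c = 0")
    case False
    have "fa_opnorm f = fa_opnorm (fa_scale (1 / c) (fa_scale c f))" using False by (simp add: fa.sc_sc fa.sc_one)
    also have "\<dots> \<le> cmod (1 / c) * fa_opnorm (fa_scale c f)" by (rule le)
    finally show ?thesis using False by (simp add: norm_divide field_simps)
  qed (simp add: fa_opnorm_nonneg)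
qed

text \<open>The defining relations act as zero because \<sigma>1 and \<sigma>2 are unital
  homomorphisms, so their operator norm vanishes.\<close>

lemma fa_opnorm_seminorm: "fa_opnorm \<in> fp_seminorms"
  unfolding fp_seminorms_def cstar_seminorm_def
proof (intro CollectI conjI allI ballI)
  show "fa_opnorm (f + g) \<le> fa_opnorm f + fa_opnorm g" for f g
  proof (rule fa_opnorm_le)
    fix u assume u: "u \<in> hcarrier E"
    show "hnorm E (fa_act (f + g) u) \<le> (fa_opnorm f + fa_opnorm g) * hnorm E u"
      using hnorm_add[OF fa_act_closed fa_act_closed, OF u u, of f g] le_fa_opnorm[OF u, of f] le_fa_opnorm[OF u, of g]
      by (simp add: fa_act_add_left u distrib_right)
  qed (simp add: fa_opnorm_nonneg)
  show "fa_opnorm (fa_star f * f) = (fa_opnorm f)\<^sup>2" for f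
  proof (rule antisym)
    show "fa_opnorm (fa_star f * f) \<le> (fa_opnorm f)\<^sup>2"
      using order_trans[OF fa_opnorm_mult mult_right_mono[OF fa_opnorm_star fa_opnorm_nonneg]]
      by (simp add: power2_eq_square)
  qed (rule fa_opnorm_star_mult)
  fix r :: "('a, 'a) free_alg"
  assume r: "r \<in> hom_relations (\<lambda>a. fa_gen (Inl a)) \<union> hom_relations (\<lambda>b. fa_gen (Inr b))"
  have "fa_act r u = hzero E" if u: "u \<in> hcarrier E" for u
  proof -
    \<comment> \<open>Both families of relations are treated at once: j is \<open>Inl\<close> or
      \<open>Inr\<close>, and \<tau> is the action belonging to it.\<close>
    have "fa_act r u = hzero E" if "r \<in> hom_relations (\<lambda>a. fa_gen (j a))" and a: "left_action E \<tau>"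
      and j: "\<And>a u. letter (j a) u = \<tau> a u" for j \<tau>
      using that(1) u left_actionD[OF a] unfolding hom_relations_def
      by (auto simp: fa_act_diff fa_act_fa_scale fa_act_mult fa_act_one fa_act_gen j diff_zero_iff closed
          fa_act_closed intro!: inner_eqI simp: inner_simps)
    from this[OF _ \<sigma>1, of Inl] this[OF _ \<sigma>2, of Inr] r show ?thesis by auto
  qed
  then have "fa_opnorm r \<le> 0"
    by (intro fa_opnorm_le) (simp_all add: hnorm_eq_0[THEN iffD2] closed)
  then show "fa_opnorm r = 0" using fa_opnorm_nonneg by (rule antisym)
qed (auto simp: fa_opnorm_mult fa_opnorm_scale)

section \<open>Extension of the action to the completion\<close>

lemma fa_act_le: "u \<in> hcarrier E \<Longrightarrow> hnorm E (fa_act f u) \<le> fp_norm f * hnorm E u"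
  using order_trans[OF le_fa_opnorm mult_right_mono[OF le_fp_norm[OF fa_opnorm_seminorm] hnorm_nonneg]] .

text \<open>By \<open>fa_act_le\<close> the map from f to f u is Lipschitz, so approximating
  sequences have Cauchy images. The limit z is fixed before X is, since each algebraic law below
  uses an approximating sequence of its own, such as X n * Y n for a product.\<close>

lemma fp_act_ex:
  assumes u: "u \<in> hcarrier E"
  shows "\<exists>z. \<forall>X. (\<lambda>n. fp_emb (X n)) \<longlonglongrightarrow> c \<longrightarrow> hlim (\<lambda>n. fa_act (X n) u) z"
proof -
  have d: "hnorm E (hdiff E (fa_act f u) (fa_act g u)) \<le> norm (fp_emb f - fp_emb g) * hnorm E u" for f g
    using fa_act_le[OF u, of "f - g"] by (simp add: fa_act_diff u norm_fp_emb flip: fp_emb_diff)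
  obtain Y :: "nat \<Rightarrow> ('a, 'a) free_alg" where Y: "(\<lambda>n. fp_emb (Y n)) \<longlonglongrightarrow> c" by (rule fp_emb_seq)
  have "\<exists>z. hlim (\<lambda>n. fa_act (Y n) u) z"
  proof (rule Cauchy_hlim)
    fix e :: real assume e: "e > 0"
    \<comment> \<open>Adding 1 permits the division also for u = 0.\<close>
    have n: "0 < hnorm E u + 1" using hnorm_nonneg[of u] by simp
    obtain M where M: "\<And>m n. m \<ge> M \<Longrightarrow> n \<ge> M \<Longrightarrow> norm (fp_emb (Y m) - fp_emb (Y n)) < e / (hnorm E u + 1)"
      using LIMSEQ_imp_Cauchy[OF Y] e n unfolding Cauchy_def dist_norm by (metis divide_pos_pos)
    have "hnorm E (hdiff E (fa_act (Y m) u) (fa_act (Y n) u)) < e" if "m \<ge> M" "n \<ge> M" for m n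
    proof -
      have "norm (fp_emb (Y m) - fp_emb (Y n)) * hnorm E u \<le> norm (fp_emb (Y m) - fp_emb (Y n)) * (hnorm E u + 1)"
        by (rule mult_left_mono) auto
      also have "\<dots> < e" using M[OF that] n by (simp add: pos_less_divide_eq)
      finally show ?thesis using d order_le_less_trans by blast
    qed
    then show "\<exists>M. \<forall>m\<ge>M. \<forall>n\<ge>M. hnorm E (hdiff E (fa_act (Y m) u) (fa_act (Y n) u)) < e" by blast
  qed (rule fa_act_closed[OF u])
  then obtain z where z: "hlim (\<lambda>n. fa_act (Y n) u) z" by blast
  have "hlim (\<lambda>n. fa_act (X n) u) z" if X: "(\<lambda>n. fp_emb (X n)) \<longlonglongrightarrow> c" for X
  proof (rule hlimI)
    show "hnorm E (hdiff E (fa_act (X n) u) z) \<le>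
        norm (fp_emb (X n) - fp_emb (Y n)) * hnorm E u + hnorm E (hdiff E (fa_act (Y n) u) z)" for n
      using hnorm_diff_triangle[OF fa_act_closed[OF u] fa_act_closed[OF u] hlim_closed(2)[OF z], of "X n" "Y n"]
        d[of "X n" "Y n"] by linarith
    have "(\<lambda>n. norm (fp_emb (X n) - fp_emb (Y n)) * hnorm E u + hnorm E (hdiff E (fa_act (Y n) u) z)) \<longlonglongrightarrow>
        norm (c - c) * hnorm E u + 0"
      using z by (intro tendsto_intros X Y) (simp add: hlim_def)
    then show "(\<lambda>n. norm (fp_emb (X n) - fp_emb (Y n)) * hnorm E u + hnorm E (hdiff E (fa_act (Y n) u) z)) \<longlonglongrightarrow> 0"
      by simp
  qed (use u z in \<open>simp_all add: fa_act_closed hlim_def\<close>)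
  then show ?thesis by blast
qed

definition fp_act :: "('a, 'a) free_product \<Rightarrow> 'e \<Rightarrow> 'e" where
  "fp_act c u = (SOME z. \<forall>X. (\<lambda>n. fp_emb (X n)) \<longlonglongrightarrow> c \<longrightarrow> hlim (\<lambda>n. fa_act (X n) u) z)"

lemma fp_act_hlim:
  assumes "u \<in> hcarrier E" "(\<lambda>n. fp_emb (X n)) \<longlonglongrightarrow> c"
  shows "hlim (\<lambda>n. fa_act (X n) u) (fp_act c u)"
proof -
  have "\<forall>X. (\<lambda>n. fp_emb (X n)) \<longlonglongrightarrow> c \<longrightarrow> hlim (\<lambda>n. fa_act (X n) u) (fp_act c u)"
    unfolding fp_act_def by (rule someI_ex[OF fp_act_ex[OF assms(1)]])
  with assms(2) show ?thesis by blast
qed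

lemma fp_act_closed:
  assumes "u \<in> hcarrier E" shows "fp_act c u \<in> hcarrier E"
proof -
  obtain X where "(\<lambda>n. fp_emb (X n)) \<longlonglongrightarrow> c" by (rule fp_emb_seq)
  from hlim_closed(2)[OF fp_act_hlim[OF assms this]] show ?thesis .
qed

lemma fp_act_emb: "u \<in> hcarrier E \<Longrightarrow> fp_act (fp_emb f) u = fa_act f u"
  using fp_act_hlim[of u "\<lambda>_. f" "fp_emb f"] hlim_const[OF fa_act_closed[of u f]] hlim_unique by simp

lemma fp_act_adjoint:
  assumes "u \<in> hcarrier E" "v \<in> hcarrier E"
  shows "hinner E (fp_act c u) v = hinner E u (fp_act (star c) v)"
proof -
  obtain X where X: "(\<lambda>n. fp_emb (X n)) \<longlonglongrightarrow> c" by (rule fp_emb_seq)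
  then have "(\<lambda>n. fp_emb (fa_star (X n))) \<longlonglongrightarrow> star c"
    using bounded_linear.tendsto[OF bounded_linear_star] by (simp add: fp_emb_star)
  from hlim_inner_right[OF fp_act_hlim[OF assms(2) this] assms(1)]
    hlim_inner_left[OF fp_act_hlim[OF assms(1) X] assms(2)]
  show ?thesis using assms LIMSEQ_unique by (simp add: fa_act_adjoint)
qed

lemma fp_act_contractive:
  assumes u: "u \<in> hcarrier E" shows "hnorm E (fp_act c u) \<le> norm c * hnorm E u"
proof -
  obtain X where X: "(\<lambda>n. fp_emb (X n)) \<longlonglongrightarrow> c" by (rule fp_emb_seq)
  have "(\<lambda>n. norm (fp_emb (X n)) * hnorm E u) \<longlonglongrightarrow> norm c * hnorm E u"
    by (intro tendsto_intros X)
  from LIMSEQ_le[OF hlim_hnorm[OF fp_act_hlim[OF u X]] this] show ?thesis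
    using fa_act_le[OF u] by (auto simp: norm_fp_emb)
qed

text \<open>In X n (Y n u) both the operator and the vector vary. Moving X n to the left as an
  adjoint leaves an inner product of two convergent sequences of vectors, which
  \<open>hlim_inner\<close> handles.\<close>

lemma fp_act_mult:
  assumes u: "u \<in> hcarrier E" shows "fp_act (c * d) u = fp_act c (fp_act d u)"
proof (rule inner_eqI)
  obtain X where X: "(\<lambda>n. fp_emb (X n)) \<longlonglongrightarrow> c" by (rule fp_emb_seq)
  obtain Y where Y: "(\<lambda>n. fp_emb (Y n)) \<longlonglongrightarrow> d" by (rule fp_emb_seq)
  fix z assume z: "z \<in> hcarrier E"
  have "(\<lambda>n. fp_emb (X n * Y n)) \<longlonglongrightarrow> c * d" using tendsto_mult[OF X Y] by (simp add: fp_emb_mult)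
  from hlim_inner_right[OF fp_act_hlim[OF u this] z]
  have 1: "(\<lambda>n. hinner E (fa_act (fa_star (X n)) z) (fa_act (Y n) u)) \<longlonglongrightarrow> hinner E z (fp_act (c * d) u)"
    using u z by (simp add: fa_act_mult fa_act_adjoint' fa_act_closed)
  have "(\<lambda>n. fp_emb (fa_star (X n))) \<longlonglongrightarrow> star c"
    using bounded_linear.tendsto[OF bounded_linear_star X] by (simp add: fp_emb_star)
  from hlim_inner[OF fp_act_hlim[OF z this] fp_act_hlim[OF u Y]] 1
  have "hinner E z (fp_act (c * d) u) = hinner E (fp_act (star c) z) (fp_act d u)"
    using LIMSEQ_unique by blast
  then show "hinner E z (fp_act (c * d) u) = hinner E z (fp_act c (fp_act d u))"
    using u z by (simp add: fp_act_adjoint fp_act_closed star_star)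
qed (use u in \<open>simp_all add: fp_act_closed\<close>)

lemma left_action_fp_act: "left_action E fp_act"
  unfolding left_action_def
proof (intro conjI allI ballI)
  show "fp_act c \<in> adjointable_maps E" for c
    unfolding adjointable_maps_def is_adjoint_def
    using fp_act_closed fp_act_adjoint fp_act_contractive by blast
  show "is_adjoint E (fp_act c) (fp_act (star c))" for c
    by (simp add: is_adjoint_def fp_act_adjoint)
  fix u assume u: "u \<in> hcarrier E"
  show "fp_act 1 u = u" using fp_act_emb[OF u, of 1] by (simp add: fp_emb_one fa_act_one u)
  fix c d :: "('a, 'a) free_product"
  obtain X where X: "(\<lambda>n. fp_emb (X n)) \<longlonglongrightarrow> c" by (rule fp_emb_seq)
  obtain Y where Y: "(\<lambda>n. fp_emb (Y n)) \<longlonglongrightarrow> d" by (rule fp_emb_seq)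
  show "fp_act (c + d) u = hadd E (fp_act c u) (fp_act d u)"
  proof (rule inner_eqI)
    fix z assume z: "z \<in> hcarrier E"
    have "(\<lambda>n. fp_emb (X n + Y n)) \<longlonglongrightarrow> c + d" using tendsto_add[OF X Y] by (simp add: fp_emb_add)
    from hlim_inner_right[OF fp_act_hlim[OF u this] z]
      tendsto_add[OF hlim_inner_right[OF fp_act_hlim[OF u X] z] hlim_inner_right[OF fp_act_hlim[OF u Y] z]]
    show "hinner E z (fp_act (c + d) u) = hinner E z (hadd E (fp_act c u) (fp_act d u))"
      using u z LIMSEQ_unique by (simp add: fa_act_add_left inner_add_right fa_act_closed fp_act_closed)
  qed (use u in \<open>simp_all add: fp_act_closed closed\<close>)
  show "fp_act (c * d) u = fp_act c (fp_act d u)" by (rule fp_act_mult[OF u])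
  fix s :: complex
  \<comment> \<open>Scalar multiplication is multiplication by an embedded scalar, so homogeneity
    follows from multiplicativity.\<close>
  have "s *\<^sub>C d = fp_emb (fa_scale s 1) * d" for d :: "('a, 'a) free_product"
    by (simp add: fp_emb_scale fp_emb_one mult_scaleC_left)
  then show "fp_act (s *\<^sub>C c) u = hscale E s (fp_act c u)"
    using u by (simp add: fp_act_mult fp_act_emb fp_act_closed fa_act_fa_scale fa_act_one)
qed

lemma fp_act_inl: "u \<in> hcarrier E \<Longrightarrow> fp_act (fp_inl a) u = \<sigma>1 a u"
  by (simp add: fp_inl_def fp_act_emb fa_act_gen)

lemma fp_act_inr: "u \<in> hcarrier E \<Longrightarrow> fp_act (fp_inr a) u = \<sigma>2 a u"
  by (simp add: fp_inr_def fp_act_emb fa_act_gen)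

end

section \<open>The coupling induced by a joint representation\<close>

context hilbert_module
begin

lemma finite_sum_ex:
  fixes n :: nat
  assumes "\<And>i. i < n \<Longrightarrow> g i \<in> hcarrier E"
  shows "\<exists>z\<in>hcarrier E. \<forall>y\<in>hcarrier E. hinner E y z = (\<Sum>i<n. hinner E y (g i))"
  using assms
proof (induction n)
  case 0
  then show ?case by (intro bexI[of _ "hzero E"]) (simp_all add: inner_zero_right closed)
next
  case (Suc n)
  then obtain z where "z \<in> hcarrier E" "\<forall>y\<in>hcarrier E. hinner E y z = (\<Sum>i<n. hinner E y (g i))"
    using less_Suc_eq by blast
  then show ?case using Suc.prems[of n]
    by (intro bexI[of _ "hadd E z (g n)"]) (simp_all add: inner_add_right closed)
qed

text \<open>If Z has the factor Y, its image has entries sum over k of <Y k i x, Y k j x>, and the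
  form of this matrix at v is the sum over k of <u k, u k>, where u k is the sum over i of (Y k i x)
  v i. The factor required by \<open>mat_pos\<close> has to lie in B, while the u k lie in E;
  \<open>mat_posI\<close> bridges this gap.\<close>

lemma vector_state_completely_positive:
  assumes \<sigma>: "left_action E \<sigma>" and x: "x \<in> hcarrier E"
  shows "completely_positive (\<lambda>c. hinner E x (\<sigma> c x))"
  unfolding completely_positive_def
proof (intro allI impI)
  fix n and Z :: "nat \<Rightarrow> nat \<Rightarrow> 'a" assume "mat_pos n Z"
  then obtain Y where Y: "\<And>i j. i < n \<Longrightarrow> j < n \<Longrightarrow> Z i j = (\<Sum>k<n. star (Y k i) * Y k j)"
    unfolding mat_pos_def by blast
  have sum: "hinner E x (\<sigma> (\<Sum>k<m. f k) x) = (\<Sum>k<m. hinner E x (\<sigma> (f k) x))" for f and m :: nat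
  proof (induction m)
    case 0
    \<comment> \<open>That \<sigma> 0 x contributes nothing follows from additivity at 0 = 0 +
      0.\<close>
    have "hinner E x (\<sigma> (0 + 0) x) = hinner E x (\<sigma> 0 x) + hinner E x (\<sigma> 0 x)"
      using x by (simp only: left_actionD(4)[OF \<sigma>] inner_add_right action_closed[OF \<sigma>])
    then show ?case by simp
  next
    case (Suc m)
    then show ?case using x by (simp add: left_actionD(4)[OF \<sigma>] inner_add_right action_closed[OF \<sigma>])
  qed
  have Z: "hinner E x (\<sigma> (Z i j) x) = (\<Sum>k<n. hinner E (\<sigma> (Y k i) x) (\<sigma> (Y k j) x))"
    if "i < n" "j < n" for i j
    using x by (simp add: Y[OF that] sum left_actionD(6)[OF \<sigma>] action_adjoint[OF \<sigma>] action_closed[OF \<sigma>] star_star)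
  show "mat_pos n (\<lambda>i j. hinner E x (\<sigma> (Z i j) x))"
  proof (rule mat_posI)
    show "star (hinner E x (\<sigma> (Z i j) x)) = hinner E x (\<sigma> (Z j i) x)" if "i < n" "j < n" for i j
      using x that by (simp add: Z star_sum inner_star action_closed[OF \<sigma>])
    fix v :: "nat \<Rightarrow> 'b"
    have "\<exists>z\<in>hcarrier E. \<forall>y\<in>hcarrier E. hinner E y z = (\<Sum>i<n. hinner E y (hact E (\<sigma> (Y k i) x) (v i)))" for k
      by (rule finite_sum_ex) (simp add: closed action_closed[OF \<sigma>] x)
    then obtain u where u: "\<And>k. u k \<in> hcarrier E"
      "\<And>k y. y \<in> hcarrier E \<Longrightarrow> hinner E y (u k) = (\<Sum>i<n. hinner E y (hact E (\<sigma> (Y k i) x) (v i)))"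
      by metis
    have u': "hinner E (u k) y = (\<Sum>i<n. star (v i) * hinner E (\<sigma> (Y k i) x) y)" if "y \<in> hcarrier E" for k y
    proof -
      have "hinner E (u k) y = star (hinner E y (u k))" by (rule inner_star[OF that u(1), symmetric])
      also have "\<dots> = (\<Sum>i<n. hinner E (hact E (\<sigma> (Y k i) x) (v i)) y)"
        using that x by (simp add: u(2) star_sum inner_star closed action_closed[OF \<sigma>])
      finally show ?thesis using that x by (simp add: inner_act_left action_closed[OF \<sigma>])
    qed
    have "(\<Sum>i<n. \<Sum>j<n. star (v i) * hinner E x (\<sigma> (Z i j) x) * v j) =
        (\<Sum>i<n. \<Sum>j<n. \<Sum>k<n. star (v i) * hinner E (\<sigma> (Y k i) x) (\<sigma> (Y k j) x) * v j)"
      by (intro sum.cong refl) (simp add: Z sum_distrib_left sum_distrib_right)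
    also have "\<dots> = (\<Sum>i<n. \<Sum>k<n. \<Sum>j<n. star (v i) * hinner E (\<sigma> (Y k i) x) (\<sigma> (Y k j) x) * v j)"
      by (intro sum.cong refl sum.swap)
    also have "\<dots> = (\<Sum>k<n. \<Sum>i<n. \<Sum>j<n. star (v i) * hinner E (\<sigma> (Y k i) x) (\<sigma> (Y k j) x) * v j)"
      by (rule sum.swap)
    also have "\<dots> = (\<Sum>k<n. hinner E (u k) (u k))"
    proof (rule sum.cong[OF refl])
      fix k
      have "hinner E (u k) (u k) = (\<Sum>i<n. star (v i) * hinner E (\<sigma> (Y k i) x) (u k))"
        by (rule u'[OF u(1)])
      also have "\<dots> = (\<Sum>i<n. \<Sum>j<n. star (v i) * hinner E (\<sigma> (Y k i) x) (\<sigma> (Y k j) x) * v j)"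
        by (intro sum.cong refl)
          (simp add: x u(2) inner_act_right action_closed[OF \<sigma>] sum_distrib_left mult.assoc)
      finally show "(\<Sum>i<n. \<Sum>j<n. star (v i) * hinner E (\<sigma> (Y k i) x) (\<sigma> (Y k j) x) * v j) =
        hinner E (u k) (u k)" by simp
    qed
    finally show "cstar_pos (\<Sum>i<n. \<Sum>j<n. star (v i) * hinner E x (\<sigma> (Z i j) x) * v j)"
      using cstar_pos_sum[of "{..<n}" "\<lambda>k. hinner E (u k) (u k)"] u(1) by (simp add: inner_pos)
  qed
qed

lemma vector_state_UCP:
  assumes \<sigma>: "left_action E \<sigma>" and x: "x \<in> hcarrier E" "hinner E x x = 1"
  shows "(\<lambda>c. hinner E x (\<sigma> c x)) \<in> UCP"
  using x vector_state_completely_positive[OF \<sigma> x(1)]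
  by (simp add: UCP_def clinear_map_def left_actionD(3-5)[OF \<sigma>] action_closed[OF \<sigma>] inner_add_right inner_scale_right)

lemma vector_state_bounded:
  assumes \<sigma>: "left_action E \<sigma>" and x: "x \<in> hcarrier E"
  shows "norm (hinner E x (\<sigma> c x)) \<le> norm c * (hnorm E x)\<^sup>2"
proof -
  have "norm (hinner E x (\<sigma> c x)) \<le> hnorm E x * hnorm E (\<sigma> c x)"
    using x by (simp add: cauchy_schwarz action_closed[OF \<sigma>])
  also have "\<dots> \<le> hnorm E x * (norm c * hnorm E x)"
    by (rule mult_left_mono[OF action_contractive[OF \<sigma> x] hnorm_nonneg])
  finally show ?thesis by (simp add: power2_eq_square mult_ac)
qed

end

section \<open>Words are total in the free product\<close>

abbreviation fp_word :: "('a + 'b) list \<Rightarrow> ('a::cstar_algebra, 'b::cstar_algebra) free_product" where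
  "fp_word w \<equiv> fp_emb (Poly_Mapping.single (Word w) 1)"

lemma fp_word_Nil: "fp_word [] = 1"
  unfolding zero_word_def[symmetric] single_one by (rule fp_emb_one)

lemma fp_word_Cons: "fp_word (l # w) = case_sum fp_inl fp_inr l * fp_word w"
  by (cases l) (simp_all add: single_Word_Cons fp_emb_mult fp_inl_def fp_inr_def)

text \<open>Words span the image of the free algebra, which is dense. The rule serves twice: for
  equality of bounded linear maps, and for the minimality of the module built from a
  coupling.\<close>

lemma fp_induct [case_names word scale add limit]:
  assumes word: "\<And>w. P (fp_word w)"
    and scale: "\<And>c x. P x \<Longrightarrow> P (c *\<^sub>C x)"
    and add: "\<And>x y. P x \<Longrightarrow> P y \<Longrightarrow> P (x + y)"
    and limit: "\<And>X x. (\<And>n. P (X n)) \<Longrightarrow> X \<longlonglongrightarrow> x \<Longrightarrow> P x"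
  shows "P x"
proof -
  have single: "P (fp_emb (Poly_Mapping.single w c))" for w c
  proof -
    have "fp_emb (Poly_Mapping.single w c) = c *\<^sub>C fp_word (letters w)"
      by (simp add: fa_scale_def mult_single flip: fp_emb_scale)
    then show ?thesis by (simp only: scale[OF word])
  qed
  have "P (fp_emb f)" for f
  proof (induction f rule: poly_mapping_additive_induct)
    case 1
    then show ?case using single[of 0 0] by simp
  qed (simp_all add: single add fp_emb_add)
  moreover obtain X where "(\<lambda>n. fp_emb (X n)) \<longlonglongrightarrow> x" by (rule fp_emb_seq)
  ultimately show ?thesis by (rule limit)
qed

text \<open>The bounds provide the continuity used in the limit case; for induced maps they come
  from \<open>vector_state_bounded\<close>.\<close>

lemma bounded_clinear_fp_eqI:
  fixes \<phi> \<psi> :: "('a::cstar_algebra, 'b::cstar_algebra) free_product \<Rightarrow> 'd::cstar_algebra"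
  assumes \<phi>: "clinear_map \<phi>" "\<And>c. norm (\<phi> c) \<le> norm c * K"
    and \<psi>: "clinear_map \<psi>" "\<And>c. norm (\<psi> c) \<le> norm c * L"
    and eq: "\<And>w. \<phi> (fp_word w) = \<psi> (fp_word w)"
  shows "\<phi> = \<psi>"
proof
  have bl: "bounded_linear \<theta>" if "clinear_map \<theta>" "\<And>c. norm (\<theta> c) \<le> norm c * M"
    for \<theta> :: "('a, 'b) free_product \<Rightarrow> 'd" and M
    using that by (intro bounded_linear_intro[where K = M]) (simp_all add: clinear_map_def scaleR_scaleC)
  fix c
  show "\<phi> c = \<psi> c"
  proof (induction c rule: fp_induct)
    case (limit X x)
    then show ?case
      using bounded_linear.tendsto[OF bl[OF \<phi>] limit(2)] bounded_linear.tendsto[OF bl[OF \<psi>] limit(2)]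
        LIMSEQ_unique by simp
  qed (use eq \<phi>(1) \<psi>(1) in \<open>simp_all add: clinear_map_def\<close>)
qed

text \<open>Stated for an arbitrary extension \<sigma>, because \<open>induces\<close> only asserts
  that some extension exists.\<close>

lemma (in hilbert_module) free_action_word:
  assumes \<sigma>: "left_action E \<sigma>" and u: "u \<in> hcarrier E"
    and ext: "\<And>a v. v \<in> hcarrier E \<Longrightarrow> \<sigma> (fp_inl a) v = \<sigma>1 a v \<and> \<sigma> (fp_inr a) v = \<sigma>2 a v"
  shows "\<sigma> (fp_word w) u = foldr (case_sum \<sigma>1 \<sigma>2) w u"
proof (induction w)
  case Nil
  then show ?case using u by (simp add: fp_word_Nil left_actionD(3)[OF \<sigma>])
next
  case (Cons l w)
  have "\<sigma> (fp_word w) u \<in> hcarrier E" using u by (rule action_closed[OF \<sigma>])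
  then show ?case using u ext Cons
    by (cases l) (simp_all add: fp_word_Cons left_actionD(6)[OF \<sigma>])
qed

lemma induces_moments:
  assumes R: "(E, \<sigma>1, \<sigma>2, x) \<in> joint_reps \<phi>1 \<phi>2" and ind: "induces (E, \<sigma>1, \<sigma>2, x) \<phi>"
  shows "\<phi> \<in> couplings \<phi>1 \<phi>2" "norm (\<phi> c) \<le> norm c * (hnorm E x)\<^sup>2"
    "\<phi> (fp_word w) = hinner E x (foldr (case_sum \<sigma>1 \<sigma>2) w x)"
proof -
  have E: "hilbert_module E" and x: "x \<in> hcarrier E" "hinner E x x = 1"
    and \<phi>12: "\<And>a. \<phi>1 a = hinner E x (\<sigma>1 a x)" "\<And>a. \<phi>2 a = hinner E x (\<sigma>2 a x)"
    using R by (auto simp: joint_reps_def)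
  interpret hilbert_module E by (rule E)
  obtain \<sigma> where \<sigma>: "left_action E \<sigma>"
    and ext: "\<And>a u. u \<in> hcarrier E \<Longrightarrow> \<sigma> (fp_inl a) u = \<sigma>1 a u \<and> \<sigma> (fp_inr a) u = \<sigma>2 a u"
    and \<phi>: "\<And>c. \<phi> c = hinner E x (\<sigma> c x)"
    using ind by auto
  have \<phi>': "\<phi> = (\<lambda>c. hinner E x (\<sigma> c x))" using \<phi> by blast
  show "\<phi> \<in> couplings \<phi>1 \<phi>2"
    unfolding couplings_def using vector_state_UCP[OF \<sigma> x] ext[OF x(1)]
    by (auto simp: \<phi>' fun_eq_iff \<phi>12)
  show "norm (\<phi> c) \<le> norm c * (hnorm E x)\<^sup>2" unfolding \<phi>' by (rule vector_state_bounded[OF \<sigma> x(1)])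
  show "\<phi> (fp_word w) = hinner E x (foldr (case_sum \<sigma>1 \<sigma>2) w x)"
    using free_action_word[OF \<sigma> x(1) ext] by (simp add: \<phi>)
qed

lemma induces_ex:
  assumes "R \<in> joint_reps \<phi>1 \<phi>2" shows "\<exists>\<phi>. induces R \<phi>"
proof -
  obtain E \<sigma>1 \<sigma>2 x where R: "R = (E, \<sigma>1, \<sigma>2, x)" by (cases R)
  interpret two_actions E \<sigma>1 \<sigma>2
    using assms unfolding R joint_reps_def two_actions_def two_actions_axioms_def by blast
  have "induces R (\<lambda>c. hinner E x (fp_act c x))"
    unfolding R induces.simps by (intro exI[of _ fp_act]) (simp add: left_action_fp_act fp_act_inl fp_act_inr)
  then show ?thesis by blast
qed

lemma induced_eq_iff_moments:
  assumes R: "(E, \<sigma>1, \<sigma>2, x) \<in> joint_reps \<phi>1 \<phi>2" "induces (E, \<sigma>1, \<sigma>2, x) \<phi>"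
    and S: "(F, \<tau>1, \<tau>2, y) \<in> joint_reps \<psi>1 \<psi>2" "induces (F, \<tau>1, \<tau>2, y) \<psi>"
  shows "\<phi> = \<psi> \<longleftrightarrow>
    (\<forall>w. hinner E x (foldr (case_sum \<sigma>1 \<sigma>2) w x) = hinner F y (foldr (case_sum \<tau>1 \<tau>2) w y))"
proof
  assume "\<phi> = \<psi>"
  then show "\<forall>w. hinner E x (foldr (case_sum \<sigma>1 \<sigma>2) w x) = hinner F y (foldr (case_sum \<tau>1 \<tau>2) w y)"
    using induces_moments(3)[OF R] induces_moments(3)[OF S] by metis
next
  assume "\<forall>w. hinner E x (foldr (case_sum \<sigma>1 \<sigma>2) w x) = hinner F y (foldr (case_sum \<tau>1 \<tau>2) w y)"
  moreover have "clinear_map \<phi>" "clinear_map \<psi>"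
    using induces_moments(1)[OF R] induces_moments(1)[OF S] by (auto simp: couplings_def UCP_def)
  ultimately show "\<phi> = \<psi>"
    by (intro bounded_clinear_fp_eqI[OF _ induces_moments(2)[OF R] _ induces_moments(2)[OF S]])
      (simp_all add: induces_moments(3)[OF R] induces_moments(3)[OF S])
qed

lemma joint_rep_iso_moments:
  assumes R: "(E, \<sigma>1, \<sigma>2, x) \<in> joint_reps \<phi>1 \<phi>2" and iso: "joint_rep_iso (E, \<sigma>1, \<sigma>2, x) (F, \<tau>1, \<tau>2, y)"
  shows "hinner E x (foldr (case_sum \<sigma>1 \<sigma>2) w x) = hinner F y (foldr (case_sum \<tau>1 \<tau>2) w y)"
proof -
  interpret two_actions E \<sigma>1 \<sigma>2
    using R unfolding joint_reps_def two_actions_def two_actions_axioms_def by blast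
  have x: "x \<in> hcarrier E" using R by (auto simp: joint_reps_def)
  obtain U where U: "\<And>u v. u \<in> hcarrier E \<Longrightarrow> v \<in> hcarrier E \<Longrightarrow> hinner F (U u) (U v) = hinner E u v"
    "\<And>u a. u \<in> hcarrier E \<Longrightarrow> U (\<sigma>1 a u) = \<tau>1 a (U u) \<and> U (\<sigma>2 a u) = \<tau>2 a (U u)" "U x = y"
    using iso unfolding joint_rep_iso.simps by blast
  have "U (wact w x) = foldr (case_sum \<tau>1 \<tau>2) w y"
  proof (induction w)
    case (Cons l w)
    then show ?case using U(2)[OF wact_closed[OF x, of w]] by (cases l) auto
  qed (simp add: U)
  then show ?thesis using U(1)[OF x wact_closed[OF x, of w]] by (simp add: U(3))
qed

section \<open>The Hilbert module of a positive kernel\<close>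

text \<open>A list of pairs \<open>(j, b)\<close> represents the function \<open>\<Sum> \<kappa>(\<cdot>, j) b\<close>; the module consists of the
  pointwise limits of sequences of such functions that are Cauchy for the kernel inner product.\<close>

locale positive_kernel =
  fixes \<kappa> :: "'i \<Rightarrow> 'i \<Rightarrow> 'b::cstar_algebra"
  assumes kernel_star: "star (\<kappa> i j) = \<kappa> j i"
    and kernel_pos: "cstar_pos (\<Sum>(i, b)\<leftarrow>l. star b * (\<Sum>(j, c)\<leftarrow>l. \<kappa> i j * c))"
begin

definition kfun :: "('i \<times> 'b) list \<Rightarrow> 'i \<Rightarrow> 'b" where
  "kfun l i = (\<Sum>(j, b)\<leftarrow>l. \<kappa> i j * b)"

definition kip :: "('i \<times> 'b) list \<Rightarrow> ('i \<times> 'b) list \<Rightarrow> 'b" where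
  "kip l m = (\<Sum>(i, b)\<leftarrow>l. star b * kfun m i)"

definition kmul :: "('i \<times> 'b) list \<Rightarrow> 'b \<Rightarrow> ('i \<times> 'b) list" where
  "kmul l c = map (\<lambda>(i, b). (i, b * c)) l"

text \<open>Lists have no subtraction. This is a formal difference, and cancellation becomes visible
  only after applying \<open>kfun\<close>.\<close>

definition kdiff :: "('i \<times> 'b) list \<Rightarrow> ('i \<times> 'b) list \<Rightarrow> ('i \<times> 'b) list" where
  "kdiff l m = l @ kmul m (- 1)"

definition knorm :: "('i \<times> 'b) list \<Rightarrow> real" where
  "knorm l = sqrt (norm (kip l l))"

lemma kfun_simps [simp]:
  "kfun [] i = 0" "kfun ((j, b) # l) i = \<kappa> i j * b + kfun l i" "kfun (l @ m) i = kfun l i + kfun m i"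
  by (simp_all add: kfun_def)

lemma kfun_kmul [simp]: "kfun (kmul l c) i = kfun l i * c"
  by (induction l) (auto simp: kmul_def algebra_simps)

lemma kfun_kdiff [simp]: "kfun (kdiff l m) i = kfun l i - kfun m i"
  by (simp add: kdiff_def)

lemma kip_left_simps [simp]:
  "kip [] m = 0" "kip ((i, b) # l) m = star b * kfun m i + kip l m" "kip (l @ l') m = kip l m + kip l' m"
  by (simp_all add: kip_def)

lemma star_kip: "star (kip l m) = kip m l"
proof (induction l)
  case Nil
  show ?case by (induction m) auto
next
  case (Cons p l)
  obtain j c where p: "p = (j, c)" by (cases p)
  have "star (star c * kfun m j) = kip m [p]"
    unfolding p by (induction m) (auto simp: star_mult star_add star_star kernel_star algebra_simps)
  moreover have "kip m (p # l) = kip m [p] + kip m l"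
    by (induction m) (auto simp: algebra_simps split_def kip_def kfun_def)
  ultimately show ?case using Cons by (simp add: p star_add)
qed

lemma kip_cong_right: "kfun m = kfun m' \<Longrightarrow> kip l m = kip l m'"
  by (simp add: kip_def)

text \<open>In the right argument this is the definition of \<open>kip\<close>, in the left it
  follows by symmetry. It allows lists that represent the same function to be exchanged, and takes
  the place of a quotient by null vectors.\<close>

lemma kip_cong: "kfun l = kfun l' \<Longrightarrow> kfun m = kfun m' \<Longrightarrow> kip l m = kip l' m'"
  by (metis kip_cong_right star_kip)

lemma knorm_cong: "(\<And>i. kfun l i = kfun l' i) \<Longrightarrow> knorm l = knorm l'"
  using kip_cong[of l l' l l'] by (simp add: knorm_def fun_eq_iff)

lemma kip_append_right [simp]: "kip l (m @ m') = kip l m + kip l m'"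
  by (induction l) (auto simp: algebra_simps)

lemma kip_kmul_right [simp]: "kip l (kmul m c) = kip l m * c"
  by (induction l) (auto simp: algebra_simps)

lemma kip_kmul_left [simp]: "kip (kmul l c) m = star c * kip l m"
  using star_kip[of m "kmul l c"] by (simp add: star_mult star_kip)

lemma kip_kdiff_left [simp]: "kip (kdiff l l') m = kip l m - kip l' m"
  by (simp add: kdiff_def star_minus)

lemma kip_kdiff_right [simp]: "kip l (kdiff m m') = kip l m - kip l m'"
  by (simp add: kdiff_def)

lemma kip_pos: "cstar_pos (kip l l)"
  using kernel_pos[of l] by (simp add: kip_def kfun_def)

lemma knorm_nonneg: "0 \<le> knorm l"
  by (simp add: knorm_def)

lemma knorm_power2: "(knorm l)\<^sup>2 = norm (kip l l)"
  by (simp add: knorm_def)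

lemma kip_cauchy_schwarz: "norm (kip l m) \<le> knorm l * knorm m"
proof (rule power2_le_imp_le)
  have "(norm (kip l m))\<^sup>2 \<le> norm (kip l l) * norm (kip m m)"
  proof (rule cauchy_schwarz_cstar[OF kip_pos kip_pos])
    fix b
    show "cstar_pos (kip m m - star b * kip l m - star (kip l m) * b + star b * kip l l * b)"
      using kip_pos[of "kdiff m (kmul l b)"] by (simp add: star_kip algebra_simps)
  qed
  then show "(norm (kip l m))\<^sup>2 \<le> (knorm l * knorm m)\<^sup>2"
    by (simp add: power_mult_distrib knorm_power2)
qed (simp add: knorm_nonneg)

lemma knorm_append: "knorm (l @ m) \<le> knorm l + knorm m"
proof (rule power2_le_imp_le)
  have "(knorm (l @ m))\<^sup>2 = norm ((kip l l + kip l m) + (kip m l + kip m m))"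
    by (simp add: knorm_power2 algebra_simps)
  also have "\<dots> \<le> (norm (kip l l) + norm (kip l m)) + (norm (kip m l) + norm (kip m m))"
    by (intro norm_triangle_mono norm_triangle_ineq)
  also have "\<dots> \<le> ((knorm l)\<^sup>2 + knorm l * knorm m) + (knorm m * knorm l + (knorm m)\<^sup>2)"
    unfolding knorm_power2 by (intro add_mono kip_cauchy_schwarz order_refl)
  also have "\<dots> = (knorm l + knorm m)\<^sup>2" by (simp add: power2_eq_square algebra_simps)
  finally show "(knorm (l @ m))\<^sup>2 \<le> (knorm l + knorm m)\<^sup>2" .
qed (simp add: knorm_nonneg)

lemma knorm_kmul: "knorm (kmul l c) \<le> knorm l * norm c"
proof (rule power2_le_imp_le)
  have "norm (star c * (kip l l * c)) \<le> norm (star c) * (norm (kip l l) * norm c)"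
    by (rule order_trans[OF norm_mult_ineq]) (simp add: mult_left_mono norm_mult_ineq)
  then show "(knorm (kmul l c))\<^sup>2 \<le> (knorm l * norm c)\<^sup>2"
    by (simp add: power_mult_distrib knorm_power2 mult.assoc power2_eq_square[of "norm c"] mult_ac)
qed (simp add: knorm_nonneg)

lemma knorm_kdiff_commute: "knorm (kdiff l m) = knorm (kdiff m l)"
  unfolding knorm_def by (simp add: algebra_simps)

lemma knorm_kdiff_triangle: "knorm (kdiff l n) \<le> knorm (kdiff l m) + knorm (kdiff m n)"
  using knorm_append[of "kdiff l m" "kdiff m n"] knorm_cong[of "kdiff l n" "kdiff l m @ kdiff m n"]
  by simp

lemma knorm_tri: "\<bar>knorm l - knorm m\<bar> \<le> knorm (kdiff l m)"
  using knorm_append[of "kdiff l m" m] knorm_cong[of "kdiff l m @ m" l]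
    knorm_append[of "kdiff m l" l] knorm_cong[of "kdiff m l @ l" m] knorm_kdiff_commute[of l m]
  by simp

section \<open>Cauchy sequences of kernel combinations\<close>

definition kcauchy :: "(nat \<Rightarrow> ('i \<times> 'b) list) \<Rightarrow> bool" where
  "kcauchy L \<longleftrightarrow> (\<forall>e>0. \<exists>N. \<forall>m\<ge>N. \<forall>n\<ge>N. knorm (kdiff (L m) (L n)) < e)"

lemma kcauchy_const: "kcauchy (\<lambda>_. l)"
  by (simp add: kcauchy_def knorm_def)

lemma kcauchy_lipschitz:
  assumes L: "kcauchy L" and le: "\<And>m n. knorm (kdiff (M m) (M n)) \<le> knorm (kdiff (L m) (L n)) * C" and C: "C \<ge> 0"
  shows "kcauchy M"
  unfolding kcauchy_def
proof (intro allI impI)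
  fix e :: real assume "e > 0"
  then have "e / (C + 1) > 0" using C by simp
  then obtain N where N: "\<And>m n. m \<ge> N \<Longrightarrow> n \<ge> N \<Longrightarrow> knorm (kdiff (L m) (L n)) < e / (C + 1)"
    using L unfolding kcauchy_def by metis
  have "knorm (kdiff (M m) (M n)) < e" if "m \<ge> N" "n \<ge> N" for m n
  proof -
    have "knorm (kdiff (M m) (M n)) \<le> knorm (kdiff (L m) (L n)) * (C + 1)"
      using le[of m n] knorm_nonneg[of "kdiff (L m) (L n)"] by (simp add: distrib_left)
    also have "\<dots> < e" using N[OF that] C by (simp add: pos_less_divide_eq)
    finally show ?thesis .
  qed
  then show "\<exists>N. \<forall>m\<ge>N. \<forall>n\<ge>N. knorm (kdiff (M m) (M n)) < e" by blast
qed

lemma kcauchy_kmul: "kcauchy L \<Longrightarrow> kcauchy (\<lambda>n. kmul (L n) c)"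
proof (erule kcauchy_lipschitz)
  fix m n
  have "knorm (kdiff (kmul (L m) c) (kmul (L n) c)) = knorm (kmul (kdiff (L m) (L n)) c)"
    by (rule knorm_cong) (simp add: algebra_simps)
  then show "knorm (kdiff (kmul (L m) c) (kmul (L n) c)) \<le> knorm (kdiff (L m) (L n)) * norm c"
    by (simp add: knorm_kmul)
qed simp

lemma kcauchy_append:
  assumes L: "kcauchy L" and M: "kcauchy M" shows "kcauchy (\<lambda>n. L n @ M n)"
  unfolding kcauchy_def
proof (intro allI impI)
  fix e :: real assume "e > 0"
  then have "e / 2 > 0" by simp
  with L M obtain N N' where
    N: "\<And>m n. m \<ge> N \<Longrightarrow> n \<ge> N \<Longrightarrow> knorm (kdiff (L m) (L n)) < e / 2" and
    N': "\<And>m n. m \<ge> N' \<Longrightarrow> n \<ge> N' \<Longrightarrow> knorm (kdiff (M m) (M n)) < e / 2"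
    unfolding kcauchy_def by metis
  have "knorm (kdiff (L m @ M m) (L n @ M n)) < e" if "m \<ge> max N N'" "n \<ge> max N N'" for m n
    using N[of m n] N'[of m n] knorm_append[of "kdiff (L m) (L n)" "kdiff (M m) (M n)"] that
      knorm_cong[of "kdiff (L m @ M m) (L n @ M n)" "kdiff (L m) (L n) @ kdiff (M m) (M n)"]
    by simp
  then show "\<exists>N. \<forall>m\<ge>N. \<forall>n\<ge>N. knorm (kdiff (L m @ M m) (L n @ M n)) < e" by blast
qed

lemma kcauchy_bounded:
  assumes "kcauchy L" obtains B where "B > 0" "\<And>n. knorm (L n) \<le> B"
proof -
  have "Cauchy (\<lambda>n. knorm (L n))"
  proof (rule metric_CauchyI)
    fix e :: real assume "e > 0"
    with assms show "\<exists>M. \<forall>m\<ge>M. \<forall>n\<ge>M. dist (knorm (L m)) (knorm (L n)) < e"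
      unfolding kcauchy_def dist_real_def by (meson knorm_tri le_less_trans)
  qed
  then have "Bseq (\<lambda>n. knorm (L n))" by (rule Cauchy_Bseq)
  then obtain B where "B > 0" "\<And>n. \<bar>knorm (L n)\<bar> \<le> B" by (auto simp: Bseq_def)
  then show thesis using that by (metis abs_le_D1)
qed

lemma kip_diff:
  "norm (kip l m - kip l' m') \<le> knorm (kdiff l l') * knorm m + knorm l' * knorm (kdiff m m')"
proof -
  have "norm (kip l m - kip l' m') \<le> norm (kip (kdiff l l') m) + norm (kip l' (kdiff m m'))"
    using norm_triangle_ineq[of "kip (kdiff l l') m" "kip l' (kdiff m m')"] by simp
  then show ?thesis
    using kip_cauchy_schwarz[of "kdiff l l'" m] kip_cauchy_schwarz[of l' "kdiff m m'"] by linarith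
qed

lemma kip_convergent:
  assumes L: "kcauchy L" and M: "kcauchy M" shows "convergent (\<lambda>n. kip (L n) (M n))"
proof -
  obtain B where B: "B > 0" "\<And>n. knorm (L n) \<le> B" by (metis kcauchy_bounded L)
  obtain C where C: "C > 0" "\<And>n. knorm (M n) \<le> C" by (metis kcauchy_bounded M)
  have "Cauchy (\<lambda>n. kip (L n) (M n))"
  proof (rule metric_CauchyI)
    fix e :: real assume e: "e > 0"
    have "e / (2 * C) > 0" "e / (2 * B) > 0" using e B C by simp_all
    with L M obtain N N' where
      N: "\<And>m n. m \<ge> N \<Longrightarrow> n \<ge> N \<Longrightarrow> knorm (kdiff (L m) (L n)) < e / (2 * C)" and
      N': "\<And>m n. m \<ge> N' \<Longrightarrow> n \<ge> N' \<Longrightarrow> knorm (kdiff (M m) (M n)) < e / (2 * B)"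
      unfolding kcauchy_def by metis
    have "dist (kip (L m) (M m)) (kip (L n) (M n)) < e" if "m \<ge> max N N'" "n \<ge> max N N'" for m n
    proof -
      have "knorm (kdiff (L m) (L n)) * knorm (M m) \<le> knorm (kdiff (L m) (L n)) * C"
        by (rule mult_left_mono[OF C(2) knorm_nonneg])
      also have "\<dots> < e / 2" using N[of m n] that C(1) by (simp add: field_simps)
      finally have 1: "knorm (kdiff (L m) (L n)) * knorm (M m) < e / 2" .
      have "knorm (L n) * knorm (kdiff (M m) (M n)) \<le> B * knorm (kdiff (M m) (M n))"
        by (rule mult_right_mono[OF B(2) knorm_nonneg])
      also have "\<dots> < e / 2" using N'[of m n] that B(1) by (simp add: field_simps)
      finally show ?thesis
        using 1 kip_diff[of "L m" "M m" "L n" "M n"] by (simp add: dist_norm)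
    qed
    then show "\<exists>N. \<forall>m\<ge>N. \<forall>n\<ge>N. dist (kip (L m) (M m)) (kip (L n) (M n)) < e" by blast
  qed
  then show ?thesis by (rule Cauchy_convergent)
qed

lemma kip_tendsto_zero:
  assumes "\<And>i. (\<lambda>n. kfun (M n) i) \<longlonglongrightarrow> 0" shows "(\<lambda>n. kip l (M n)) \<longlonglongrightarrow> 0"
proof (induction l)
  case (Cons p l)
  have "(\<lambda>n. star (snd p) * kfun (M n) (fst p) + kip l (M n)) \<longlonglongrightarrow> star (snd p) * 0 + 0"
    by (intro tendsto_intros assms Cons)
  then show ?case by (cases p) simp
qed simp

text \<open>This is why the completion can be realized by functions: a Cauchy sequence that vanishes
  pointwise in the limit is a null sequence. For fixed n, pointwise convergence sends <L n, L m> to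
  0 as m grows, while replacing L m by L n costs at most knorm (L n) e / 2.\<close>

lemma knorm_tendsto_zero:
  assumes L: "kcauchy L" and 0: "\<And>i. (\<lambda>n. kfun (L n) i) \<longlonglongrightarrow> 0"
  shows "(\<lambda>n. knorm (L n)) \<longlonglongrightarrow> 0"
proof (rule LIMSEQ_I)
  fix e :: real assume "e > 0"
  then have "e / 2 > 0" by simp
  with L obtain N where N: "\<And>m n. m \<ge> N \<Longrightarrow> n \<ge> N \<Longrightarrow> knorm (kdiff (L m) (L n)) < e / 2"
    unfolding kcauchy_def by metis
  have "knorm (L n) < e" if "n \<ge> N" for n
  proof -
    have "norm (kip (L n) (L n)) \<le> knorm (L n) * (e / 2)"
    proof (rule LIMSEQ_le_const)
      have "(\<lambda>m. norm (kip (L n) (L m)) + knorm (L n) * (e / 2)) \<longlonglongrightarrow> norm (0::'b) + knorm (L n) * (e / 2)"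
        by (intro tendsto_intros kip_tendsto_zero 0)
      then show "(\<lambda>m. norm (kip (L n) (L m)) + knorm (L n) * (e / 2)) \<longlonglongrightarrow> knorm (L n) * (e / 2)"
        by simp
      have "norm (kip (L n) (L n)) \<le> norm (kip (L n) (L m)) + knorm (L n) * (e / 2)" if "m \<ge> N" for m
      proof -
        have "kip (L n) (L n) = kip (L n) (L m) + kip (L n) (kdiff (L n) (L m))" by simp
        then have "norm (kip (L n) (L n)) \<le> norm (kip (L n) (L m)) + norm (kip (L n) (kdiff (L n) (L m)))"
          by (metis norm_triangle_ineq)
        moreover have "norm (kip (L n) (kdiff (L n) (L m))) \<le> knorm (L n) * (e / 2)"
          using kip_cauchy_schwarz order_trans
            mult_left_mono[OF less_imp_le[OF N[OF \<open>n \<ge> N\<close> that]] knorm_nonneg] by blast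
        ultimately show ?thesis by linarith
      qed
      then show "\<exists>N. \<forall>m\<ge>N. norm (kip (L n) (L n)) \<le> norm (kip (L n) (L m)) + knorm (L n) * (e / 2)"
        by blast
    qed
    then have "knorm (L n) * knorm (L n) \<le> knorm (L n) * (e / 2)"
      by (simp add: knorm_power2[symmetric] power2_eq_square)
    then have "knorm (L n) \<le> e / 2"
      using knorm_nonneg[of "L n"] \<open>e > 0\<close> by (cases "knorm (L n) = 0") auto
    then show ?thesis using \<open>e > 0\<close> by simp
  qed
  then show "\<exists>no. \<forall>n\<ge>no. norm (knorm (L n) - 0) < e" by (auto simp: knorm_nonneg)
qed

definition krep :: "(nat \<Rightarrow> ('i \<times> 'b) list) \<Rightarrow> ('i \<Rightarrow> 'b) \<Rightarrow> bool" where
  "krep L F \<longleftrightarrow> kcauchy L \<and> (\<forall>i. (\<lambda>n. kfun (L n) i) \<longlonglongrightarrow> F i)"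

lemma krepD: "krep L F \<Longrightarrow> kcauchy L" "krep L F \<Longrightarrow> (\<lambda>n. kfun (L n) i) \<longlonglongrightarrow> F i"
  by (simp_all add: krep_def)

text \<open>The reproducing property: evaluation at i is the inner product with the list
  [(i, 1)].\<close>

lemma kcauchy_krep: assumes "kcauchy L" shows "\<exists>F. krep L F"
proof -
  have "convergent (\<lambda>n. kip [(i, 1)] (L n))" for i
    by (rule kip_convergent[OF kcauchy_const assms])
  then have "\<exists>F. \<forall>i. (\<lambda>n. kfun (L n) i) \<longlonglongrightarrow> F i"
    by (simp add: convergent_def) metis
  with assms show ?thesis by (simp add: krep_def)
qed

lemma krep_const: "krep (\<lambda>_. l) (kfun l)"
  by (simp add: krep_def kcauchy_const)

lemma krep_add: "krep L F \<Longrightarrow> krep M G \<Longrightarrow> krep (\<lambda>n. L n @ M n) (\<lambda>i. F i + G i)"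
  by (simp add: krep_def kcauchy_append tendsto_add)

lemma krep_act: "krep L F \<Longrightarrow> krep (\<lambda>n. kmul (L n) c) (\<lambda>i. F i * c)"
  by (simp add: krep_def kcauchy_kmul tendsto_mult)

lemma krep_diff: "krep L F \<Longrightarrow> krep M G \<Longrightarrow> krep (\<lambda>n. kdiff (L n) (M n)) (\<lambda>i. F i - G i)"
  using krep_add[of L F "\<lambda>n. kmul (M n) (-1)" "\<lambda>i. G i * (-1)"] krep_act[of M G "-1"]
  by (simp add: kdiff_def)

definition krepr :: "('i \<Rightarrow> 'b) \<Rightarrow> nat \<Rightarrow> ('i \<times> 'b) list" where
  "krepr F = (SOME L. krep L F)"

lemma krepr: "krep L F \<Longrightarrow> krep (krepr F) F"
  unfolding krepr_def by (rule someI[of "\<lambda>L. krep L F"])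

definition kinner :: "('i \<Rightarrow> 'b) \<Rightarrow> ('i \<Rightarrow> 'b) \<Rightarrow> 'b" where
  "kinner F G = lim (\<lambda>n. kip (krepr F n) (krepr G n))"

lemma krep_unique_limit:
  assumes "krep L F" "krep L' F" shows "(\<lambda>n. knorm (kdiff (L n) (L' n))) \<longlonglongrightarrow> 0"
  using krep_diff[OF assms] by (intro knorm_tendsto_zero) (simp_all add: krep_def)

text \<open>The sequences chosen in \<open>kinner\<close> may be replaced by any others with the
  same pointwise limits, since by \<open>knorm_tendsto_zero\<close> the differences are null
  sequences.\<close>

lemma kinner_tendsto:
  assumes F: "krep L F" and G: "krep M G"
  shows "(\<lambda>n. kip (L n) (M n)) \<longlonglongrightarrow> kinner F G"
proof -
  let ?L = "krepr F" and ?M = "krepr G"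
  note F' = krepr[OF F] and G' = krepr[OF G]
  obtain B where B: "\<And>n. knorm (?L n) \<le> B" by (metis kcauchy_bounded krepD(1) F')
  obtain C where C: "\<And>n. knorm (M n) \<le> C" by (metis kcauchy_bounded krepD(1) G)
  have "(\<lambda>n. kip (?L n) (?M n)) \<longlonglongrightarrow> kinner F G"
    unfolding kinner_def
    using kip_convergent[OF krepD(1)[OF F'] krepD(1)[OF G']] convergent_LIMSEQ_iff by blast
  moreover have "(\<lambda>n. kip (L n) (M n) - kip (?L n) (?M n)) \<longlonglongrightarrow> 0"
  proof (rule Lim_null_comparison)
    have "(\<lambda>n. knorm (kdiff (L n) (?L n)) * C + B * knorm (kdiff (M n) (?M n))) \<longlonglongrightarrow> 0 * C + B * 0"
      by (intro tendsto_intros krep_unique_limit[OF F F'] krep_unique_limit[OF G G'])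
    then show "(\<lambda>n. knorm (kdiff (L n) (?L n)) * C + B * knorm (kdiff (M n) (?M n))) \<longlonglongrightarrow> 0" by simp
    show "\<forall>\<^sub>F n in sequentially. norm (kip (L n) (M n) - kip (?L n) (?M n)) \<le>
        knorm (kdiff (L n) (?L n)) * C + B * knorm (kdiff (M n) (?M n))"
    proof (rule always_eventually, rule allI)
      fix n
      show "norm (kip (L n) (M n) - kip (?L n) (?M n)) \<le>
          knorm (kdiff (L n) (?L n)) * C + B * knorm (kdiff (M n) (?M n))"
        using kip_diff[of "L n" "M n" "?L n" "?M n"]
          mult_left_mono[OF C[of n] knorm_nonneg[of "kdiff (L n) (?L n)"]]
          mult_right_mono[OF B[of n] knorm_nonneg[of "kdiff (M n) (?M n)"]] by linarith
    qed
  qed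
  ultimately show ?thesis using tendsto_add by fastforce
qed

section \<open>The module of pointwise limits and its completeness\<close>

definition kmod :: "('i \<Rightarrow> 'b, 'b) hmod" where
  "kmod = \<lparr>hcarrier = {F. \<exists>L. krep L F}, hzero = (\<lambda>_. 0), hadd = (\<lambda>F G i. F i + G i),
    hscale = (\<lambda>c F i. c *\<^sub>C F i), hact = (\<lambda>F b i. F i * b), hinner = kinner\<rparr>"

lemma kmod_simps [simp]:
  "hcarrier kmod = {F. \<exists>L. krep L F}" "hzero kmod = (\<lambda>_. 0)" "hadd kmod F G = (\<lambda>i. F i + G i)"
  "hscale kmod c F = (\<lambda>i. c *\<^sub>C F i)" "hact kmod F b = (\<lambda>i. F i * b)" "hinner kmod = kinner"
  "hdiff kmod F G = (\<lambda>i. F i - G i)"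
  by (simp_all add: kmod_def hdiff_def scaleC_minus_one)

lemma krep_scale: "krep L F \<Longrightarrow> krep (\<lambda>n. kmul (L n) (c *\<^sub>C 1)) (\<lambda>i. c *\<^sub>C F i)"
  using krep_act[of L F "c *\<^sub>C 1"] by (simp add: mult_scaleC_right)

lemma hnorm_kmod_tendsto:
  assumes "krep L F" shows "(\<lambda>n. knorm (L n)) \<longlonglongrightarrow> hnorm kmod F"
  unfolding knorm_def hnorm_def using kinner_tendsto[OF assms assms]
  by (auto intro!: tendsto_intros)

lemma hnorm_kfun: "hnorm kmod (kfun l) = knorm l"
  using LIMSEQ_unique[OF hnorm_kmod_tendsto[OF krep_const[of l]]] by simp

lemma hnorm_kmod_triangle:
  assumes "krep L F" "krep M G" "krep N H"
  shows "hnorm kmod (\<lambda>i. F i - H i) \<le> hnorm kmod (\<lambda>i. F i - G i) + hnorm kmod (\<lambda>i. G i - H i)"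
  by (rule LIMSEQ_le[OF hnorm_kmod_tendsto[OF krep_diff[OF assms(1,3)]]
        tendsto_add[OF hnorm_kmod_tendsto[OF krep_diff[OF assms(1,2)]]
          hnorm_kmod_tendsto[OF krep_diff[OF assms(2,3)]]]])
    (auto intro: knorm_kdiff_triangle)

lemma kfun_approx:
  assumes F: "krep L F" shows "(\<lambda>n. hnorm kmod (\<lambda>i. F i - kfun (L n) i)) \<longlonglongrightarrow> 0"
proof (rule LIMSEQ_I)
  fix e :: real assume "e > 0"
  then have "e / 2 > 0" by simp
  with krepD(1)[OF F] obtain N where N: "\<And>m n. m \<ge> N \<Longrightarrow> n \<ge> N \<Longrightarrow> knorm (kdiff (L m) (L n)) < e / 2"
    unfolding kcauchy_def by metis
  have "hnorm kmod (\<lambda>i. F i - kfun (L n) i) \<le> e / 2" if "n \<ge> N" for n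
    by (rule LIMSEQ_le_const2[OF hnorm_kmod_tendsto[OF krep_diff[OF F krep_const]]])
      (use N that in \<open>auto intro: less_imp_le\<close>)
  then show "\<exists>no. \<forall>n\<ge>no. norm (hnorm kmod (\<lambda>i. F i - kfun (L n) i) - 0) < e"
    using \<open>e > 0\<close> by (force simp: hnorm_def)
qed

text \<open>Replace X n by a finite list l n at distance less than 1 / (n + 1). These lists form a
  Cauchy sequence, and their pointwise limit is the limit of X.\<close>

lemma kmod_complete:
  assumes X: "\<And>n. \<exists>L. krep L (X n)"
    and cauchy: "\<And>e. e > 0 \<Longrightarrow> \<exists>M. \<forall>m\<ge>M. \<forall>n\<ge>M. hnorm kmod (\<lambda>i. X m i - X n i) < e"
  shows "\<exists>F. (\<exists>L. krep L F) \<and> (\<lambda>n. hnorm kmod (\<lambda>i. X n i - F i)) \<longlonglongrightarrow> 0"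
proof -
  have "\<exists>l. hnorm kmod (\<lambda>i. X n i - kfun l i) < inverse (real (Suc n))" for n
  proof -
    obtain L where "krep L (X n)" using X by blast
    from LIMSEQ_D[OF kfun_approx[OF this], of "inverse (real (Suc n))"]
    show ?thesis by (force simp: hnorm_def)
  qed
  then obtain l where l: "\<And>n. hnorm kmod (\<lambda>i. X n i - kfun (l n) i) < inverse (real (Suc n))" by metis
  have null: "(\<lambda>n. hnorm kmod (\<lambda>i. X n i - kfun (l n) i)) \<longlonglongrightarrow> 0"
    by (rule tendsto_sandwich[OF _ _ tendsto_const LIMSEQ_inverse_real_of_nat])
      (use less_imp_le[OF l] in \<open>auto simp: hnorm_def\<close>)
  obtain R where R: "\<And>n. krep (R n) (X n)" using X by metis
  have comm: "hnorm kmod (\<lambda>i. X n i - kfun m i) = hnorm kmod (\<lambda>i. kfun m i - X n i)" for n m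
    using LIMSEQ_unique[OF hnorm_kmod_tendsto[OF krep_diff[OF R krep_const]]]
      hnorm_kmod_tendsto[OF krep_diff[OF krep_const R]] by (simp add: knorm_kdiff_commute)
  have "kcauchy l"
    unfolding kcauchy_def
  proof (intro allI impI)
    fix e :: real assume "e > 0"
    then have e: "e / 3 > 0" by simp
    obtain M where M: "\<And>m n. m \<ge> M \<Longrightarrow> n \<ge> M \<Longrightarrow> hnorm kmod (\<lambda>i. X m i - X n i) < e / 3"
      using cauchy[OF e] by blast
    obtain M' where M': "\<And>n. n \<ge> M' \<Longrightarrow> hnorm kmod (\<lambda>i. X n i - kfun (l n) i) < e / 3"
      using LIMSEQ_D[OF null e] by (auto simp: hnorm_def)
    have "knorm (kdiff (l m) (l n)) < e" if "m \<ge> max M M'" "n \<ge> max M M'" for m n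
    proof -
      have "knorm (kdiff (l m) (l n)) = hnorm kmod (\<lambda>i. kfun (l m) i - kfun (l n) i)"
        using hnorm_kfun[of "kdiff (l m) (l n)"] by (simp add: fun_eq_iff[symmetric] kfun_kdiff[abs_def])
      also have "\<dots> \<le> hnorm kmod (\<lambda>i. kfun (l m) i - X m i) + hnorm kmod (\<lambda>i. X m i - kfun (l n) i)"
        by (rule hnorm_kmod_triangle[OF krep_const R krep_const])
      also have "hnorm kmod (\<lambda>i. X m i - kfun (l n) i) \<le>
          hnorm kmod (\<lambda>i. X m i - X n i) + hnorm kmod (\<lambda>i. X n i - kfun (l n) i)"
        by (rule hnorm_kmod_triangle[OF R R krep_const])
      finally show ?thesis using M[of m n] M'[of m] M'[of n] that by (simp add: comm)
    qed
    then show "\<exists>N. \<forall>m\<ge>N. \<forall>n\<ge>N. knorm (kdiff (l m) (l n)) < e" by blast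
  qed
  then obtain F where F: "krep l F" using kcauchy_krep by blast
  have F0: "(\<lambda>n. hnorm kmod (\<lambda>i. kfun (l n) i - F i)) \<longlonglongrightarrow> 0"
  proof -
    have "hnorm kmod (\<lambda>i. F i - kfun m i) = hnorm kmod (\<lambda>i. kfun m i - F i)" for m
      using LIMSEQ_unique[OF hnorm_kmod_tendsto[OF krep_diff[OF F krep_const]]]
        hnorm_kmod_tendsto[OF krep_diff[OF krep_const F]] by (simp add: knorm_kdiff_commute)
    then show ?thesis using kfun_approx[OF F] by simp
  qed
  have "(\<lambda>n. hnorm kmod (\<lambda>i. X n i - F i)) \<longlonglongrightarrow> 0"
  proof (rule tendsto_sandwich[OF _ _ tendsto_const])
    show "(\<lambda>n. hnorm kmod (\<lambda>i. X n i - kfun (l n) i) + hnorm kmod (\<lambda>i. kfun (l n) i - F i)) \<longlonglongrightarrow> 0"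
      using tendsto_add[OF null F0] by simp
    show "\<forall>\<^sub>F n in sequentially. hnorm kmod (\<lambda>i. X n i - F i) \<le>
        hnorm kmod (\<lambda>i. X n i - kfun (l n) i) + hnorm kmod (\<lambda>i. kfun (l n) i - F i)"
      by (rule always_eventually, rule allI, rule hnorm_kmod_triangle[OF R krep_const F])
  qed (simp add: hnorm_def)
  with F show ?thesis by blast
qed

lemma kinner_eqI:
  assumes "krep L F" "krep M G" "(\<lambda>n. kip (L n) (M n)) \<longlonglongrightarrow> b" shows "kinner F G = b"
  using kinner_tendsto[OF assms(1,2)] assms(3) LIMSEQ_unique by blast

lemma hilbert_module_kmod: "hilbert_module kmod"
proof
  fix F G H :: "'i \<Rightarrow> 'b" and b :: 'b and c :: complex
  assume "F \<in> hcarrier kmod" "G \<in> hcarrier kmod"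
  then obtain L M where F: "krep L F" and G: "krep M G" by auto
  show "hinner kmod F (hscale kmod c G) = c *\<^sub>C hinner kmod F G"
  proof -
    have "(\<lambda>n. kip (L n) (kmul (M n) (c *\<^sub>C 1))) \<longlonglongrightarrow> kinner F G * (c *\<^sub>C 1)"
      unfolding kip_kmul_right by (intro tendsto_intros kinner_tendsto F G)
    then show ?thesis using kinner_eqI[OF F krep_scale[OF G]] by (simp add: mult_scaleC_right)
  qed
  show "hinner kmod F (hact kmod G b) = hinner kmod F G * b"
  proof -
    have "(\<lambda>n. kip (L n) (kmul (M n) b)) \<longlonglongrightarrow> kinner F G * b"
      unfolding kip_kmul_right by (intro tendsto_intros kinner_tendsto F G)
    then show ?thesis using kinner_eqI[OF F krep_act[OF G]] by simp
  qed
  show "star (hinner kmod F G) = hinner kmod G F"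
    using bounded_linear.tendsto[OF bounded_linear_star kinner_tendsto[OF F G]] kinner_eqI[OF G F]
    by (simp add: star_kip)
  assume "H \<in> hcarrier kmod"
  then obtain N where H: "krep N H" by auto
  have "(\<lambda>n. kip (L n) (M n @ N n)) \<longlonglongrightarrow> kinner F G + kinner F H"
    unfolding kip_append_right by (intro tendsto_intros kinner_tendsto F G H)
  then show "hinner kmod F (hadd kmod G H) = hinner kmod F G + hinner kmod F H"
    using kinner_eqI[OF F krep_add[OF G H]] by simp
next
  fix F :: "'i \<Rightarrow> 'b"
  assume "F \<in> hcarrier kmod"
  then obtain L where F: "krep L F" by auto
  show "cstar_pos (hinner kmod F F)"
    using cstar_pos_lim[OF kip_pos kinner_tendsto[OF F F]] by simp
  assume "hinner kmod F F = 0"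
  then have "hnorm kmod F = 0" by (simp add: hnorm_def)
  then have "(\<lambda>n. knorm (L n)) \<longlonglongrightarrow> 0" using hnorm_kmod_tendsto[OF F] by simp
  \<comment> \<open>Definiteness: by the reproducing property and Cauchy-Schwarz, the value at i is
    controlled by the norm.\<close>
  then have 0: "(\<lambda>n. knorm [(i, 1)] * knorm (L n)) \<longlonglongrightarrow> 0" for i by (rule tendsto_mult_right_zero)
  have "(\<lambda>n. kfun (L n) i) \<longlonglongrightarrow> 0" for i
    by (rule Lim_null_comparison[OF always_eventually 0[of i]])
      (use kip_cauchy_schwarz[of "[(i, 1)]"] in simp)
  then show "F = hzero kmod"
    using krepD(2)[OF F] LIMSEQ_unique by (fastforce simp: fun_eq_iff)
next
  fix X :: "nat \<Rightarrow> 'i \<Rightarrow> 'b" assume "\<And>n. X n \<in> hcarrier kmod"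
    "\<And>e. e > 0 \<Longrightarrow> \<exists>M. \<forall>m\<ge>M. \<forall>n\<ge>M. hnorm kmod (hdiff kmod (X m) (X n)) < e"
  then show "\<exists>l\<in>hcarrier kmod. (\<lambda>n. hnorm kmod (hdiff kmod (X n) l)) \<longlonglongrightarrow> 0"
    using kmod_complete[of X] by simp
next
  have "krep (\<lambda>_. []) (\<lambda>_. 0)" using krep_const[of "[]"] by (simp add: kfun_def[abs_def])
  then show "hzero kmod \<in> hcarrier kmod" by auto
qed (auto simp: scaleC_add_right scaleC_add_left scaleC_scaleC scaleC_minus_one mult_scaleC_left
    mult_scaleC_right algebra_simps intro: krep_add krep_scale krep_act)

end

section \<open>The representation of a unital completely positive map\<close>

lemma completely_positive_gram:
  fixes n :: nat and v :: "nat \<Rightarrow> 'c::cstar_algebra"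
  assumes "completely_positive \<phi>"
  shows "\<exists>Y. \<forall>i<n. \<forall>j<n. \<phi> (star (v i) * v j) = (\<Sum>k<n. star (Y k i) * Y k j)"
proof -
  have "mat_pos n (\<lambda>i j. star (v i) * v j)"
    unfolding mat_pos_def
  \<comment> \<open>The row vector v, padded with zero rows, because \<open>mat_pos\<close> asks for
    a square factor.\<close>
  proof (intro exI[of _ "\<lambda>k j. if k = 0 then v j else 0"] allI impI)
    fix i j assume "i < n" "j < n"
    have "(\<Sum>k<n. star (if k = 0 then v i else 0) * (if k = 0 then v j else 0)) =
        (\<Sum>k<n. if k = 0 then star (v i) * v j else 0)"
      by (rule sum.cong) auto
    then show "star (v i) * v j = (\<Sum>k<n. star (if k = 0 then v i else 0) * (if k = 0 then v j else 0))"
      using \<open>i < n\<close> by simp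
  qed
  then have "mat_pos n (\<lambda>i j. \<phi> (star (v i) * v j))"
    by (rule assms[unfolded completely_positive_def, rule_format])
  then show ?thesis by (simp add: mat_pos_def)
qed

text \<open>Symmetry is read off from the 2 by 2 Gram matrix of a and c, hermitian because it has a
  factor. Positivity on a list of length n uses the n by n Gram matrix of its first components: with
  a factor Y the double sum becomes a sum of terms \<open>star z * z\<close>.\<close>

lemma positive_kernel_UCP:
  fixes \<phi> :: "'c::cstar_algebra \<Rightarrow> 'b::cstar_algebra"
  assumes "completely_positive \<phi>"
  shows "positive_kernel (\<lambda>a c. \<phi> (star a * c))"
proof
  fix a c :: 'c
  define v where "v i = (if i = 0 then a else c)" for i :: nat
  obtain Y where Y: "\<forall>i<(2::nat). \<forall>j<(2::nat). \<phi> (star (v i) * v j) = (\<Sum>k<(2::nat). star (Y k i) * Y k j)"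
    using completely_positive_gram[OF assms, of 2 v] by blast
  have "star (\<phi> (star (v 0) * v 1)) = \<phi> (star (v 1) * v 0)"
    by (simp add: Y star_sum star_mult star_star)
  then show "star (\<phi> (star a * c)) = \<phi> (star c * a)" by (simp add: v_def)
next
  fix l :: "('c \<times> 'b) list"
  let ?n = "length l" and ?v = "\<lambda>i. fst (l ! i)" and ?b = "\<lambda>i. snd (l ! i)"
  obtain Y where Y: "\<forall>i<?n. \<forall>j<?n. \<phi> (star (?v i) * ?v j) = (\<Sum>k<?n. star (Y k i) * Y k j)"
    using completely_positive_gram[OF assms, of ?n ?v] by blast
  have "(\<Sum>(i, b)\<leftarrow>l. star b * (\<Sum>(j, c)\<leftarrow>l. \<phi> (star i * j) * c)) =
      (\<Sum>i<?n. star (?b i) * (\<Sum>j<?n. \<phi> (star (?v i) * ?v j) * ?b j))"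
    by (simp add: sum_list_sum_nth split_def atLeast0LessThan)
  also have "\<dots> = (\<Sum>i<?n. \<Sum>j<?n. \<Sum>k<?n. star (?b i) * star (Y k i) * (Y k j * ?b j))"
    by (simp add: Y sum_distrib_left sum_distrib_right mult.assoc)
  also have "\<dots> = (\<Sum>i<?n. \<Sum>k<?n. \<Sum>j<?n. star (?b i) * star (Y k i) * (Y k j * ?b j))"
    by (intro sum.cong refl sum.swap)
  also have "\<dots> = (\<Sum>k<?n. \<Sum>i<?n. \<Sum>j<?n. star (?b i) * star (Y k i) * (Y k j * ?b j))"
    by (rule sum.swap)
  also have "\<dots> = (\<Sum>k<?n. star (\<Sum>j<?n. Y k j * ?b j) * (\<Sum>j<?n. Y k j * ?b j))"
    by (simp add: star_sum star_mult sum_product)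
  finally show "cstar_pos (\<Sum>(i, b)\<leftarrow>l. star b * (\<Sum>(j, c)\<leftarrow>l. \<phi> (star i * j) * c))"
    by (simp add: cstar_pos_sum cstar_pos_star_mult)
qed

locale ucp_map =
  fixes \<phi> :: "'c::cstar_algebra \<Rightarrow> 'b::cstar_algebra"
  assumes ucp: "\<phi> \<in> UCP"
begin

lemma phi_add: "\<phi> (a + c) = \<phi> a + \<phi> c" and phi_scale: "\<phi> (s *\<^sub>C a) = s *\<^sub>C \<phi> a" and phi_one: "\<phi> 1 = 1"
  using ucp by (auto simp: UCP_def clinear_map_def)

sublocale positive_kernel "\<lambda>a c. \<phi> (star a * c)"
  using ucp by (intro positive_kernel_UCP) (simp add: UCP_def)

sublocale kmod: hilbert_module kmod
  by (rule hilbert_module_kmod)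

definition kact :: "'c \<Rightarrow> ('c \<times> 'b) list \<Rightarrow> ('c \<times> 'b) list" where
  "kact a l = map (\<lambda>(c, b). (a * c, b)) l"

text \<open>The value F c is the inner product of the generator at c with F. Letting a act on F
  therefore amounts to letting its adjoint act on the generator, which gives
  \<open>star a * c\<close>.\<close>

definition gns_act :: "'c \<Rightarrow> ('c \<Rightarrow> 'b) \<Rightarrow> 'c \<Rightarrow> 'b" where
  "gns_act a F c = F (star a * c)"

lemma kfun_kact [simp]: "kfun (kact a l) c = kfun l (star a * c)"
  by (induction l) (auto simp: kact_def star_mult star_star mult.assoc)

lemma kfun_add: "kfun l (a + c) = kfun l a + kfun l c"
  by (induction l) (auto simp: star_add phi_add algebra_simps)

lemma kfun_scale: "kfun l (s *\<^sub>C a) = cnj s *\<^sub>C kfun l a"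
  by (induction l) (auto simp: star_scaleC mult_scaleC_left phi_scale scaleC_add_right)

lemma kip_kact: "kip (kact a l) m = kip l (kact (star a) m)"
proof (induction l)
  case (Cons p l)
  then show ?case by (cases p) (simp add: kact_def[of a] star_star)
qed (simp add: kact_def)

text \<open>The argument of \<open>action_contractive\<close> on lists, before the action has been
  extended to limits. The identity for \<open>star a * a\<close> + \<open>star h * h\<close> holds
  for the represented functions and not for the lists themselves, hence the passage through
  \<open>kip_cong_right\<close>.\<close>

lemma knorm_kact: "knorm (kact a l) \<le> knorm l * norm a"
proof -
  obtain h where h: "(norm a)\<^sup>2 *\<^sub>R 1 - star a * a = star h * h"
    using norm_square_minus_pos[of a] by (auto simp: cstar_pos_def)
  have "kfun (kact (star a) (kact a l)) c + kfun (kact (star h) (kact h l)) c = (norm a)\<^sup>2 *\<^sub>R kfun l c" for c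
  proof -
    have "kfun (kact (star a) (kact a l)) c + kfun (kact (star h) (kact h l)) c =
        kfun l ((star a * a + star h * h) * c)"
      by (simp add: star_star kfun_add distrib_right mult.assoc)
    also have "star a * a + star h * h = complex_of_real ((norm a)\<^sup>2) *\<^sub>C 1"
      using h unfolding scaleR_scaleC[symmetric] by (simp add: algebra_simps)
    finally show ?thesis by (simp add: mult_scaleC_left kfun_scale scaleR_scaleC)
  qed
  then have "kfun (kact (star a) (kact a l) @ kact (star h) (kact h l)) = kfun (kmul l ((norm a)\<^sup>2 *\<^sub>R 1))"
    by (simp add: fun_eq_iff)
  from kip_cong_right[OF this, of l]
  have "kip (kact a l) (kact a l) + kip (kact h l) (kact h l) = (norm a)\<^sup>2 *\<^sub>R kip l l"
    by (simp add: kip_kact)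
  then have "(norm a)\<^sup>2 *\<^sub>R kip l l - kip (kact a l) (kact a l) = kip (kact h l) (kact h l)"
    by (simp add: algebra_simps)
  then have "norm (kip (kact a l) (kact a l)) \<le> norm ((norm a)\<^sup>2 *\<^sub>R kip l l)"
    by (intro cstar_pos_norm_mono) (simp_all add: kip_pos)
  then have "(knorm (kact a l))\<^sup>2 \<le> (knorm l * norm a)\<^sup>2"
    by (simp add: knorm_power2 power_mult_distrib mult.commute)
  then show ?thesis by (rule power2_le_imp_le) (simp add: knorm_nonneg)
qed

lemma krep_kact: assumes "krep L F" shows "krep (\<lambda>n. kact a (L n)) (gns_act a F)"
proof -
  have "knorm (kdiff (kact a l) (kact a m)) \<le> knorm (kdiff l m) * norm a" for l m
    using knorm_kact[of a "kdiff l m"] knorm_cong[of "kdiff (kact a l) (kact a m)" "kact a (kdiff l m)"]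
    by simp
  then have "kcauchy (\<lambda>n. kact a (L n))"
    by (intro kcauchy_lipschitz[OF krepD(1)[OF assms], of _ "norm a"]) simp_all
  then show ?thesis using assms by (simp add: krep_def gns_act_def)
qed

text \<open>As the action is a precomposition with left multiplication by the adjoint, it is linear
  in a exactly because the functions in the module are additive and, by
  \<open>carrier_scale\<close>, conjugate homogeneous.\<close>

lemma carrier_add: assumes "krep L F" shows "F (a + c) = F a + F c"
  using krepD(2)[OF assms, of "a + c"] tendsto_add[OF krepD(2)[OF assms, of a] krepD(2)[OF assms, of c]]
  by (simp add: kfun_add LIMSEQ_unique)

lemma carrier_scale: assumes "krep L F" shows "F (s *\<^sub>C a) = cnj s *\<^sub>C F a"
  using krepD(2)[OF assms, of "s *\<^sub>C a"] bounded_linear.tendsto[OF bounded_linear_scaleC krepD(2)[OF assms, of a]]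
  by (simp add: kfun_scale LIMSEQ_unique)

lemma left_action_gns: "left_action kmod gns_act"
proof -
  have closed: "gns_act a F \<in> hcarrier kmod" if "F \<in> hcarrier kmod" for a F
    using krep_kact that by auto
  have adj: "hinner kmod (gns_act a F) G = hinner kmod F (gns_act (star a) G)"
    if FG: "F \<in> hcarrier kmod" "G \<in> hcarrier kmod" for a F G
  proof -
    from FG obtain L M where L: "krep L F" and M: "krep M G" by auto
    show ?thesis
      using kinner_tendsto[OF krep_kact[OF L, of a] M] kinner_tendsto[OF L krep_kact[OF M, of "star a"]]
      by (simp add: kip_kact LIMSEQ_unique)
  qed
  have bound: "hnorm kmod (gns_act a F) \<le> norm a * hnorm kmod F" if F: "F \<in> hcarrier kmod" for a F
  proof -
    from F obtain L where L: "krep L F" by auto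
    have "(\<lambda>n. norm a * knorm (L n)) \<longlonglongrightarrow> norm a * hnorm kmod F"
      by (intro tendsto_intros hnorm_kmod_tendsto L)
    from LIMSEQ_le[OF hnorm_kmod_tendsto[OF krep_kact[OF L, of a]] this] show ?thesis
      using knorm_kact by (auto simp: mult.commute)
  qed
  show ?thesis
    unfolding left_action_def
  proof (intro conjI allI ballI)
    show "gns_act a \<in> adjointable_maps kmod" for a
      unfolding adjointable_maps_def is_adjoint_def using closed adj bound by blast
    show "is_adjoint kmod (gns_act a) (gns_act (star a))" for a
      unfolding is_adjoint_def using adj by blast
    fix F assume "F \<in> hcarrier kmod"
    then obtain L where L: "krep L F" by auto
    show "gns_act 1 F = F" by (simp add: gns_act_def fun_eq_iff)
    show "gns_act (a + c) F = hadd kmod (gns_act a F) (gns_act c F)" for a c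
      by (simp add: gns_act_def fun_eq_iff star_add distrib_right carrier_add[OF L])
    show "gns_act (s *\<^sub>C a) F = hscale kmod s (gns_act a F)" for s a
      by (simp add: gns_act_def fun_eq_iff star_scaleC mult_scaleC_left carrier_scale[OF L])
    show "gns_act (a * c) F = gns_act a (gns_act c F)" for a c
      by (simp add: gns_act_def fun_eq_iff star_mult mult.assoc)
  qed
qed

definition gns_vec :: "'c \<Rightarrow> 'b" where "gns_vec = kfun [(1, 1)]"

lemma gns_vec_closed: "gns_vec \<in> hcarrier kmod"
  using krep_const by (auto simp: gns_vec_def)

lemma inner_gns_vec: "hinner kmod gns_vec (gns_act a gns_vec) = \<phi> a"
proof -
  have "kip [(1, 1)] (kact a [(1, 1)]) = \<phi> a" by (simp add: kact_def)
  then show ?thesis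
    using kinner_eqI[OF krep_const krep_kact[OF krep_const], of "[(1, 1)]" a "[(1, 1)]" "\<phi> a"]
    by (simp add: gns_vec_def)
qed

lemma kfun_in_span: "kfun l \<in> hspan kmod (range (\<lambda>(a, b). gns_act a (hact kmod gns_vec b)))"
proof (induction l)
  case Nil
  then show ?case using hspan.zero[of kmod] by (simp add: kfun_def[abs_def])
next
  case (Cons p l)
  obtain a b where p: "p = (a, b)" by (cases p)
  have "kfun (p # l) = hadd kmod (hscale kmod 1 (gns_act a (hact kmod gns_vec b))) (kfun l)"
    by (simp add: p fun_eq_iff gns_act_def gns_vec_def star_mult star_star)
  moreover have "gns_act a (hact kmod gns_vec b) \<in> range (\<lambda>(a, b). gns_act a (hact kmod gns_vec b))"
    by (rule range_eqI[of _ _ "(a, b)"]) simp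
  ultimately show ?case using hspan.insert[OF _ Cons] by metis
qed

lemma gns_total:
  "hcarrier kmod = closed_hspan kmod (range (\<lambda>(a, b). gns_act a (hact kmod gns_vec b)))" (is "_ = closed_hspan kmod ?S")
proof
  have S: "?S \<subseteq> hcarrier kmod"
    using kmod.action_closed[OF left_action_gns] kmod.act_closed[OF gns_vec_closed] by auto
  show "hcarrier kmod \<subseteq> closed_hspan kmod ?S"
  proof
    fix F assume F: "F \<in> hcarrier kmod"
    then obtain L where L: "krep L F" by auto
    show "F \<in> closed_hspan kmod ?S"
    proof (rule kmod.hlim_closed_hspan[OF S kfun_in_span])
      have "hnorm kmod (hdiff kmod (kfun (L n)) F) = hnorm kmod (hdiff kmod F (kfun (L n)))" for n
        using F krep_const by (intro kmod.hnorm_diff_commute) auto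
      then show "kmod.hlim (\<lambda>n. kfun (L n)) F"
        unfolding kmod.hlim_def using kfun_approx[OF L] L krep_const by auto
    qed
  qed
qed (auto simp: closed_hspan_def)

end

section \<open>Closed spans are closed subspaces; pulling back left actions\<close>

context hilbert_module
begin

lemma closed_hspan_limit:
  assumes S: "S \<subseteq> hcarrier E" and y: "y \<in> hcarrier E"
    and approx: "\<And>e. e > 0 \<Longrightarrow> \<exists>z\<in>closed_hspan E S. hnorm E (hdiff E y z) < e"
  shows "y \<in> closed_hspan E S"
  unfolding closed_hspan_def
proof (intro CollectI conjI allI impI y)
  fix e :: real assume e: "e > 0"
  obtain z where z: "z \<in> closed_hspan E S" "hnorm E (hdiff E y z) < e / 2"
    using approx[of "e / 2"] e by auto
  obtain v where v: "v \<in> hspan E S" "hnorm E (hdiff E z v) < e / 2"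
    using z(1) half_gt_zero[OF e] unfolding closed_hspan_def by blast
  have c: "z \<in> hcarrier E" "v \<in> hcarrier E" using z(1) v(1) hspan_closed[OF S] by (auto simp: closed_hspan_def)
  show "\<exists>z\<in>hspan E S. hnorm E (hdiff E y z) < e"
    using hnorm_diff_triangle[OF y c] z(2) v by (intro bexI[of _ v]) auto
qed

lemma closed_hspan_linear:
  assumes S: "S \<subseteq> hcarrier E" and x: "x \<in> closed_hspan E S" and y: "y \<in> closed_hspan E S"
  shows "hadd E (hscale E c x) y \<in> closed_hspan E S"
proof -
  obtain X where X: "\<And>n. X n \<in> hspan E S" "hlim X x" using closed_hspan_hlim[OF S x] by blast
  obtain Y where Y: "\<And>n. Y n \<in> hspan E S" "hlim Y y" using closed_hspan_hlim[OF S y] by blast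
  have cx: "X n \<in> hcarrier E" "x \<in> hcarrier E" for n using X(2) by (auto simp: hlim_def)
  have cy: "Y n \<in> hcarrier E" "y \<in> hcarrier E" for n using Y(2) by (auto simp: hlim_def)
  have "hlim (\<lambda>n. hadd E (hscale E c (X n)) (Y n)) (hadd E (hscale E c x) y)"
  proof (rule hlimI)
    have "(\<lambda>n. cmod c * hnorm E (hdiff E (X n) x) + hnorm E (hdiff E (Y n) y)) \<longlonglongrightarrow> cmod c * 0 + 0"
      using X(2) Y(2) by (intro tendsto_intros) (simp_all add: hlim_def)
    then show "(\<lambda>n. cmod c * hnorm E (hdiff E (X n) x) + hnorm E (hdiff E (Y n) y)) \<longlonglongrightarrow> 0" by simp
    fix n
    have "hdiff E (hadd E (hscale E c (X n)) (Y n)) (hadd E (hscale E c x) y) =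
        hadd E (hscale E c (hdiff E (X n) x)) (hdiff E (Y n) y)"
      using cx cy by (intro inner_eqI) (simp_all add: closed inner_simps scaleC_diff_right)
    then show "hnorm E (hdiff E (hadd E (hscale E c (X n)) (Y n)) (hadd E (hscale E c x) y)) \<le>
        cmod c * hnorm E (hdiff E (X n) x) + hnorm E (hdiff E (Y n) y)"
      using hnorm_add[of "hscale E c (hdiff E (X n) x)" "hdiff E (Y n) y"] cx cy
      by (simp add: closed hnorm_scale)
  qed (use cx cy in \<open>simp_all add: closed\<close>)
  then show ?thesis using X Y by (intro hlim_closed_hspan[OF S]) (auto intro: hspan_add[OF S] hspan_scale[OF S])
qed

lemma closed_hspan_base: "S \<subseteq> hcarrier E \<Longrightarrow> s \<in> S \<Longrightarrow> s \<in> closed_hspan E S"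
  by (rule hlim_closed_hspan[of S "\<lambda>_. s"]) (auto intro: hspan_base hlim_const)

lemma closed_hspan_add_scale:
  assumes S: "S \<subseteq> hcarrier E"
  shows "x \<in> closed_hspan E S \<Longrightarrow> y \<in> closed_hspan E S \<Longrightarrow> hadd E x y \<in> closed_hspan E S"
    and "x \<in> closed_hspan E S \<Longrightarrow> hscale E c x \<in> closed_hspan E S"
proof -
  show "hadd E x y \<in> closed_hspan E S" if "x \<in> closed_hspan E S" "y \<in> closed_hspan E S"
    using closed_hspan_linear[OF S that, of 1] that by (simp add: closed_hspan_def scale_one)
  assume x: "x \<in> closed_hspan E S"
  then have xc: "x \<in> hcarrier E" by (simp add: closed_hspan_def)
  \<comment> \<open>Written as (c - 1) x + x, the multiple c x is an instance of
    \<open>closed_hspan_linear\<close> with y = x.\<close>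
  have "hadd E (hscale E (c - 1) x) x = hscale E c x"
    using xc by (intro inner_eqI) (simp_all add: closed inner_simps scaleC_add_left[symmetric]
        scaleC_add_left[of "c - 1" 1, simplified, symmetric])
  then show "hscale E c x \<in> closed_hspan E S" using closed_hspan_linear[OF S x x, of "c - 1"] by simp
qed

lemma closed_hspan_subset:
  assumes S: "S \<subseteq> hcarrier E" and T: "T \<subseteq> closed_hspan E S"
  shows "closed_hspan E T \<subseteq> closed_hspan E S"
proof
  fix y assume y: "y \<in> closed_hspan E T"
  have z: "hzero E \<in> closed_hspan E S"
    by (rule hlim_closed_hspan[OF S hspan.zero hlim_const[OF zero_closed]])
  have "v \<in> closed_hspan E S" if "v \<in> hspan E T" for v
    using that by induction (use z T in \<open>auto intro: closed_hspan_linear[OF S]\<close>)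
  moreover have "y \<in> hcarrier E" "\<And>e. e > 0 \<Longrightarrow> \<exists>z\<in>hspan E T. hnorm E (hdiff E y z) < e"
    using y by (simp_all add: closed_hspan_def)
  ultimately show "y \<in> closed_hspan E S" by (intro closed_hspan_limit[OF S]) blast+
qed

lemma left_action_comp:
  assumes \<sigma>: "left_action E \<sigma>" and \<pi>: "unital_star_hom \<pi>"
  shows "left_action E (\<lambda>a. \<sigma> (\<pi> a))"
  using \<sigma> \<pi> by (simp add: left_action_def unital_star_hom_def clinear_map_def)

end

text \<open>By \<open>gns_total\<close> the vectors d x b with d in the free product are total,
  whereas minimality demands this of words only. Induction on d with \<open>fp_induct\<close> closes
  the gap: passing to limits in d is covered by contractivity of the action.\<close>

lemma coupling_representation:
  fixes \<phi> :: "('a::cstar_algebra, 'a) free_product \<Rightarrow> 'b::cstar_algebra"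
  assumes \<phi>: "\<phi> \<in> couplings \<phi>1 \<phi>2"
  shows "\<exists>R \<in> (minimal_joint_reps \<phi>1 \<phi>2 :: (('a, 'a) free_product \<Rightarrow> 'b, 'a, 'b) joint_rep set). induces R \<phi>"
proof -
  interpret ucp_map \<phi> using \<phi> by unfold_locales (simp add: couplings_def)
  define \<sigma>1 where "\<sigma>1 a = gns_act (fp_inl a)" for a
  define \<sigma>2 where "\<sigma>2 a = gns_act (fp_inr a)" for a
  let ?R = "(kmod, \<sigma>1, \<sigma>2, gns_vec)"
  note cl = kmod.action_closed[OF left_action_gns]
  have a1: "left_action kmod \<sigma>1" and a2: "left_action kmod \<sigma>2"
    unfolding \<sigma>1_def \<sigma>2_def
    by (rule kmod.left_action_comp[OF left_action_gns unital_star_hom_fp_inl],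
        rule kmod.left_action_comp[OF left_action_gns unital_star_hom_fp_inr])
  interpret ta: two_actions kmod \<sigma>1 \<sigma>2 using a1 a2 by unfold_locales
  have one: "gns_act 1 gns_vec = gns_vec" by (simp add: gns_act_def fun_eq_iff)
  have jr: "?R \<in> joint_reps \<phi>1 \<phi>2"
    using \<phi> a1 a2 gns_vec_closed inner_gns_vec[of 1] inner_gns_vec
    by (auto simp: joint_reps_def couplings_def hilbert_module_kmod \<sigma>1_def \<sigma>2_def one phi_one
        simp del: kmod_simps)
  define S where "S = {foldr (case_sum \<sigma>1 \<sigma>2) w (hact kmod gns_vec b) |w b. w \<noteq> []}"
  have S: "S \<subseteq> hcarrier kmod"
    using ta.wact_closed[OF kmod.act_closed[OF gns_vec_closed]] unfolding S_def by blast
  have word: "gns_act (fp_word w) (hact kmod gns_vec b) = ta.wact w (hact kmod gns_vec b)" for w b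
    by (rule kmod.free_action_word[OF left_action_gns kmod.act_closed[OF gns_vec_closed]])
      (simp add: \<sigma>1_def \<sigma>2_def)
  have "gns_act d (hact kmod gns_vec b) \<in> closed_hspan kmod S" for d b
  proof (induction d rule: fp_induct)
    case (word w)
    have "ta.wact w (hact kmod gns_vec b) \<in> S"
    proof (cases "w = []")
      case True
      \<comment> \<open>The spanning set of a minimal module has no empty word, so the letter of the
        unit is inserted.\<close>
      have "ta.wact w (hact kmod gns_vec b) = ta.wact [Inl 1] (hact kmod gns_vec b)"
        using kmod.left_actionD(3)[OF a1 kmod.act_closed[OF gns_vec_closed]] True by simp
      then show ?thesis unfolding S_def by blast
    qed (auto simp: S_def simp del: kmod_simps)
    then show ?case
      unfolding \<open>\<And>w b. gns_act (fp_word w) (hact kmod gns_vec b) = ta.wact w (hact kmod gns_vec b)\<close>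
      by (rule kmod.closed_hspan_base[OF S])
  next
    case (scale c x)
    then show ?case
      using kmod.closed_hspan_add_scale(2)[OF S]
        kmod.left_actionD(5)[OF left_action_gns kmod.act_closed[OF gns_vec_closed]] by metis
  next
    case (add x y)
    then show ?case
      using kmod.closed_hspan_add_scale(1)[OF S]
        kmod.left_actionD(4)[OF left_action_gns kmod.act_closed[OF gns_vec_closed]] by metis
  next
    case (limit X x)
    let ?u = "hact kmod gns_vec b"
    have u: "?u \<in> hcarrier kmod" by (rule kmod.act_closed[OF gns_vec_closed])
    show ?case
    proof (rule kmod.closed_hspan_limit[OF S cl[OF u]])
      fix e :: real assume e: "e > 0"
      have pos: "0 < hnorm kmod ?u + 1" using kmod.hnorm_nonneg[of ?u] by linarith
      then obtain n where n: "norm (X n - x) < e / (hnorm kmod ?u + 1)"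
        using LIMSEQ_D[OF limit(2), of "e / (hnorm kmod ?u + 1)"] e by (meson divide_pos_pos order_refl)
      have "hdiff kmod (gns_act x ?u) (gns_act (X n) ?u) = gns_act (x - X n) ?u"
        using kmod.left_actionD(4)[OF left_action_gns u, of x "(-1) *\<^sub>C X n"]
          kmod.left_actionD(5)[OF left_action_gns u, of "-1" "X n"]
        by (simp only: hdiff_def scaleC_minus_one) simp
      then have "hnorm kmod (hdiff kmod (gns_act x ?u) (gns_act (X n) ?u)) \<le> norm (x - X n) * hnorm kmod ?u"
        using kmod.action_contractive[OF left_action_gns u] by simp
      also have "\<dots> \<le> norm (X n - x) * (hnorm kmod ?u + 1)"
        by (simp add: norm_minus_commute distrib_left)
      also have "\<dots> < e" using n pos by (simp add: pos_less_divide_eq)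
      finally show "\<exists>z\<in>closed_hspan kmod S. hnorm kmod (hdiff kmod (gns_act x ?u) z) < e"
        using limit(1) by blast
    qed
  qed
  then have "hcarrier kmod \<subseteq> closed_hspan kmod S"
    by (subst gns_total, intro kmod.closed_hspan_subset[OF S]) auto
  then have "hcarrier kmod = closed_hspan kmod S" by (auto simp: closed_hspan_def)
  then have "?R \<in> minimal_joint_reps \<phi>1 \<phi>2"
    using jr by (simp add: minimal_joint_reps_def S_def del: kmod_simps)
  moreover have "induces ?R \<phi>"
    unfolding induces.simps
    by (intro exI[of _ gns_act]) (simp add: left_action_gns \<sigma>1_def \<sigma>2_def inner_gns_vec del: kmod_simps)
  ultimately show ?thesis by blast
qed

section \<open>Transport to another carrier type\<close>

locale transport = two_actions E \<sigma>1 \<sigma>2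
  for E :: "('e, 'b::cstar_algebra) hmod" and \<sigma>1 \<sigma>2 :: "'a::cstar_algebra \<Rightarrow> 'e \<Rightarrow> 'e" +
  fixes enc :: "'e \<Rightarrow> 'f"
  assumes inj: "inj_on enc (hcarrier E)"
begin

definition dec :: "'f \<Rightarrow> 'e" where "dec = inv_into (hcarrier E) enc"

definition image_mod :: "('f, 'b) hmod" where
  "image_mod = \<lparr>hcarrier = enc ` hcarrier E, hzero = enc (hzero E),
    hadd = (\<lambda>u v. enc (hadd E (dec u) (dec v))), hscale = (\<lambda>c u. enc (hscale E c (dec u))),
    hact = (\<lambda>u b. enc (hact E (dec u) b)), hinner = (\<lambda>u v. hinner E (dec u) (dec v))\<rparr>"

definition image_act :: "('c \<Rightarrow> 'e \<Rightarrow> 'e) \<Rightarrow> 'c \<Rightarrow> 'f \<Rightarrow> 'f" where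
  "image_act \<sigma> a u = enc (\<sigma> a (dec u))"

lemma dec_enc [simp]: "u \<in> hcarrier E \<Longrightarrow> dec (enc u) = u"
  by (simp add: dec_def inj)

lemma image_mod_simps [simp]:
  "hcarrier image_mod = enc ` hcarrier E" "hzero image_mod = enc (hzero E)"
  "hadd image_mod u v = enc (hadd E (dec u) (dec v))" "hscale image_mod c u = enc (hscale E c (dec u))"
  "hact image_mod u b = enc (hact E (dec u) b)" "hinner image_mod u v = hinner E (dec u) (dec v)"
  by (simp_all add: image_mod_def)

lemma hdiff_image: "u \<in> hcarrier E \<Longrightarrow> v \<in> hcarrier E \<Longrightarrow> hdiff image_mod (enc u) (enc v) = enc (hdiff E u v)"
  by (simp add: hdiff_def closed)

lemma hnorm_image: "u \<in> hcarrier E \<Longrightarrow> hnorm image_mod (enc u) = hnorm E u"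
  by (simp add: hnorm_def)

lemma hilbert_module_image: "hilbert_module image_mod"
proof
  fix X :: "nat \<Rightarrow> 'f"
  assume X: "\<And>n. X n \<in> hcarrier image_mod"
    and cauchy: "\<And>e. e > 0 \<Longrightarrow> \<exists>M. \<forall>m\<ge>M. \<forall>n\<ge>M. hnorm image_mod (hdiff image_mod (X m) (X n)) < e"
  define Y where "Y n = dec (X n)" for n
  have Y: "Y n \<in> hcarrier E" "X n = enc (Y n)" for n using X[of n] by (auto simp: Y_def)
  have "\<exists>l. hlim Y l"
    using cauchy by (intro Cauchy_hlim Y(1)) (simp add: Y(2) hdiff_image hnorm_image Y(1) closed)
  then obtain l where l: "hlim Y l" by blast
  show "\<exists>l\<in>hcarrier image_mod. (\<lambda>n. hnorm image_mod (hdiff image_mod (X n) l)) \<longlonglongrightarrow> 0"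
    by (rule bexI[of _ "enc l"]) (use l Y(1) in \<open>simp_all add: hlim_def Y(2) hdiff_image hnorm_image closed\<close>)
next
  fix u v assume "u \<in> hcarrier image_mod" "v \<in> hcarrier image_mod"
  then show "hadd image_mod u v = hadd image_mod v u" by (auto simp: add_commute)
qed (auto simp: closed add_assoc scale_one scale_scale scale_add_right
    scale_add_left act_one act_mult act_add_left act_add_right act_scale_left act_scale_right inner_add_right
    inner_scale_right inner_act_right inner_star inner_pos add_zero add_inverse
    dest: inner_eq_zero)

lemma left_action_image:
  assumes \<sigma>: "left_action E \<sigma>" shows "left_action image_mod (image_act \<sigma>)"
proof -
  have closed': "image_act \<sigma> a u \<in> hcarrier image_mod" if "u \<in> hcarrier image_mod" for a u
    using that by (auto simp: image_act_def action_closed[OF \<sigma>])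
  have adj: "is_adjoint image_mod (image_act \<sigma> a) (image_act \<sigma> (star a))" for a
    by (auto simp: is_adjoint_def image_act_def action_closed[OF \<sigma>] left_actionD(2)[OF \<sigma>])
  have "hnorm image_mod (image_act \<sigma> a u) \<le> norm a * hnorm image_mod u" if "u \<in> hcarrier image_mod" for a u
    using that by (auto simp: image_act_def hnorm_image action_closed[OF \<sigma>] action_contractive[OF \<sigma>])
  then have "image_act \<sigma> a \<in> adjointable_maps image_mod" for a
    unfolding adjointable_maps_def using closed' adj by blast
  moreover have "image_act \<sigma> 1 u = u \<and>
      (\<forall>a b. image_act \<sigma> (a + b) u = hadd image_mod (image_act \<sigma> a u) (image_act \<sigma> b u)) \<and>
      (\<forall>c a. image_act \<sigma> (c *\<^sub>C a) u = hscale image_mod c (image_act \<sigma> a u)) \<and>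
      (\<forall>a b. image_act \<sigma> (a * b) u = image_act \<sigma> a (image_act \<sigma> b u))"
    if "u \<in> hcarrier image_mod" for u
    using that by (auto simp: image_act_def action_closed[OF \<sigma>] left_actionD(3-6)[OF \<sigma>])
  ultimately show ?thesis using adj by (simp only: left_action_def) blast
qed

lemma foldr_image:
  "u \<in> hcarrier E \<Longrightarrow> foldr (case_sum (image_act \<sigma>1) (image_act \<sigma>2)) w (enc u) = enc (wact w u)"
proof (induction w)
  case (Cons l w)
  then show ?case by (cases l) (simp_all add: image_act_def wact_closed)
qed simp

lemma hspan_image:
  assumes S: "S \<subseteq> hcarrier E" and v: "v \<in> hspan E S"
  shows "enc v \<in> hspan image_mod (enc ` S)"
  using v
proof induction
  case zero
  then show ?case using hspan.zero[of image_mod] by simp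
next
  case (insert s y c)
  have "s \<in> hcarrier E" "y \<in> hcarrier E" using S insert hspan_closed[OF S] by auto
  then show ?case
    using hspan.insert[OF imageI[OF insert(1)] insert.IH, where c = c] by (simp add: closed)
qed

lemma transport_minimal:
  assumes R: "(E, \<sigma>1, \<sigma>2, x) \<in> minimal_joint_reps \<phi>1 \<phi>2"
  shows "(image_mod, image_act \<sigma>1, image_act \<sigma>2, enc x) \<in> minimal_joint_reps \<phi>1 \<phi>2"
proof -
  have x: "x \<in> hcarrier E" by (rule minimal_joint_repsD(2)[OF R])
  define S where "S = {wact w (hact E x b) |w b. w \<noteq> []}"
  define S' where "S' = {foldr (case_sum (image_act \<sigma>1) (image_act \<sigma>2)) w (hact image_mod (enc x) b) |w b. w \<noteq> []}"
  have S: "S \<subseteq> hcarrier E" unfolding S_def using wact_closed[OF act_closed[OF x]] by blast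
  have tot: "hcarrier E = closed_hspan E S" using R by (simp add: minimal_joint_reps_def S_def)
  have SS: "enc ` S = S'"
    unfolding S_def S'_def using x by (auto simp: foldr_image closed)
  have "enc u \<in> closed_hspan image_mod S'" if u: "u \<in> hcarrier E" for u
    unfolding closed_hspan_def
  proof (intro CollectI conjI allI impI)
    fix e :: real assume "e > 0"
    with u tot obtain z where z: "z \<in> hspan E S" "hnorm E (hdiff E u z) < e"
      unfolding closed_hspan_def by blast
    then have "z \<in> hcarrier E" using hspan_closed[OF S] by blast
    then show "\<exists>z\<in>hspan image_mod S'. hnorm image_mod (hdiff image_mod (enc u) z) < e"
      using z u hspan_image[OF S z(1)] SS
      by (intro bexI[of _ "enc z"]) (simp_all add: hdiff_image hnorm_image closed)
  qed (use u in simp)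
  then have "hcarrier image_mod = closed_hspan image_mod S'"
    by (auto simp: closed_hspan_def[of image_mod] simp del: image_mod_simps(2-))
  moreover have "(image_mod, image_act \<sigma>1, image_act \<sigma>2, enc x) \<in> joint_reps \<phi>1 \<phi>2"
    using minimal_joint_repsD(3-5)[OF R] x \<sigma>1 \<sigma>2
    by (simp add: joint_reps_def hilbert_module_image left_action_image image_act_def action_closed)
  ultimately show ?thesis by (simp add: minimal_joint_reps_def S'_def del: image_mod_simps)
qed

lemma transport_iso:
  "joint_rep_iso (E, \<sigma>1, \<sigma>2, x) (image_mod, image_act \<sigma>1, image_act \<sigma>2, enc x)"
  unfolding joint_rep_iso.simps
  by (rule exI[of _ enc]) (simp add: inj inj_on_imp_bij_betw image_act_def)

end

text \<open>A vector is determined by a sequence of finite sums of vectors \<open>w x b\<close> converging to it.\<close>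

lemma minimal_encoding:
  assumes R: "(E, \<sigma>1, \<sigma>2, x) \<in> (minimal_joint_reps \<phi>1 \<phi>2 :: ('e, 'a::cstar_algebra, 'b::cstar_algebra) joint_rep set)"
  shows "\<exists>enc :: 'e \<Rightarrow> ('a, 'b) module_universe. inj_on enc (hcarrier E)"
proof -
  interpret two_actions E \<sigma>1 \<sigma>2 by (rule minimal_joint_repsD(1)[OF R])
  have x: "x \<in> hcarrier E" by (rule minimal_joint_repsD(2)[OF R])
  define T where "T = foldr (\<lambda>(w, b). hadd E (wact w (hact E x b)))"
  define S where "S = {wact w (hact E x b) |w b. w \<noteq> []}"
  have S: "S \<subseteq> hcarrier E" unfolding S_def using wact_closed[OF act_closed[OF x]] by blast
  have tot: "hcarrier E = closed_hspan E S" using R by (simp add: minimal_joint_reps_def S_def)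
  have T: "\<exists>l. z = T l (hzero E)" if "z \<in> hspan E S" for z
    using that
  proof induction
    case zero
    show ?case by (rule exI[of _ "[]"]) (simp add: T_def)
  next
    case (insert s y c)
    then obtain w b l where "s = wact w (hact E x b)" "y = T l (hzero E)" by (auto simp: S_def)
    \<comment> \<open>The coefficient c is absorbed into b, so the code needs no separate
      scalars.\<close>
    then have "hadd E (hscale E c s) y = T ((w, c *\<^sub>C b) # l) (hzero E)"
      using x by (simp add: T_def act_scale_right wact_scale closed)
    then show ?case by blast
  qed
  have "\<exists>s. \<forall>n. T (s n) (hzero E) \<in> hcarrier E \<and> hnorm E (hdiff E u (T (s n) (hzero E))) < inverse (real (Suc n))"
    if "u \<in> hcarrier E" for u
  proof -
    have "\<exists>l. T l (hzero E) \<in> hcarrier E \<and> hnorm E (hdiff E u (T l (hzero E))) < inverse (real (Suc n))" for n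
    proof -
      have "0 < inverse (real (Suc n))" "u \<in> closed_hspan E S" using that tot by auto
      then obtain z where z: "z \<in> hspan E S" "hnorm E (hdiff E u z) < inverse (real (Suc n))"
        unfolding closed_hspan_def by blast
      then show ?thesis using T[OF z(1)] hspan_closed[OF S] by blast
    qed
    then show ?thesis by metis
  qed
  then obtain enc where enc: "\<And>u n. u \<in> hcarrier E \<Longrightarrow> T (enc u n) (hzero E) \<in> hcarrier E"
    "\<And>u n. u \<in> hcarrier E \<Longrightarrow> hnorm E (hdiff E u (T (enc u n) (hzero E))) < inverse (real (Suc n))"
    by metis
  have lim: "hlim (\<lambda>n. T (enc u n) (hzero E)) u" if u: "u \<in> hcarrier E" for u
  proof (rule hlimI[OF enc(1)[OF u] u _ LIMSEQ_inverse_real_of_nat])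
    show "hnorm E (hdiff E (T (enc u n) (hzero E)) u) \<le> inverse (real (Suc n))" for n
      using enc(2)[OF u, of n] by (simp only: hnorm_diff_commute[OF u enc(1)[OF u]] less_imp_le)
  qed
  have "inj_on enc (hcarrier E)"
  proof (rule inj_onI)
    fix u v assume "u \<in> hcarrier E" "v \<in> hcarrier E" "enc u = enc v"
    then show "u = v" using lim[of u] lim[of v] hlim_unique by simp
  qed
  then show ?thesis by blast
qed

lemma minimal_transport:
  assumes "R \<in> (minimal_joint_reps \<phi>1 \<phi>2 :: ('e, 'a::cstar_algebra, 'b::cstar_algebra) joint_rep set)"
  shows "\<exists>S \<in> (minimal_joint_reps \<phi>1 \<phi>2 :: (('a, 'b) module_universe, 'a, 'b) joint_rep set). joint_rep_iso R S"
proof -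
  obtain E \<sigma>1 \<sigma>2 x where R: "R = (E, \<sigma>1, \<sigma>2, x)" by (cases R)
  obtain enc :: "'e \<Rightarrow> ('a, 'b) module_universe" where enc: "inj_on enc (hcarrier E)"
    using minimal_encoding[OF assms[unfolded R]] by blast
  interpret two_actions E \<sigma>1 \<sigma>2 by (rule minimal_joint_repsD(1)[OF assms[unfolded R]])
  interpret transport E \<sigma>1 \<sigma>2 enc by unfold_locales (rule enc)
  show ?thesis using transport_minimal[of x \<phi>1 \<phi>2] transport_iso[of x] assms unfolding R by blast
qed

section \<open>The correspondence\<close>

lemma minimal_subset_joint_reps: "minimal_joint_reps \<phi>1 \<phi>2 \<subseteq> joint_reps \<phi>1 \<phi>2"
  by (auto simp: minimal_joint_reps_def)

lemma iso_iff_induced_eq: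
  assumes R: "R \<in> minimal_joint_reps \<phi>1 \<phi>2" "induces R \<phi>"
    and S: "S \<in> minimal_joint_reps \<phi>1 \<phi>2" "induces S \<psi>"
  shows "joint_rep_iso R S \<longleftrightarrow> \<phi> = \<psi>"
proof -
  obtain E \<sigma>1 \<sigma>2 x where RE: "R = (E, \<sigma>1, \<sigma>2, x)" by (cases R)
  obtain F \<tau>1 \<tau>2 y where SF: "S = (F, \<tau>1, \<tau>2, y)" by (cases S)
  have jR: "(E, \<sigma>1, \<sigma>2, x) \<in> joint_reps \<phi>1 \<phi>2" and jS: "(F, \<tau>1, \<tau>2, y) \<in> joint_reps \<phi>1 \<phi>2"
    using R(1) S(1) minimal_subset_joint_reps unfolding RE SF by blast+
  note moments = induced_eq_iff_moments[OF jR R(2)[unfolded RE] jS S(2)[unfolded SF]]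
  show ?thesis
  proof
    assume iso: "joint_rep_iso R S"
    show "\<phi> = \<psi>" unfolding moments by (intro allI joint_rep_iso_moments[OF jR iso[unfolded RE SF]])
  next
    assume "\<phi> = \<psi>"
    then show "joint_rep_iso R S"
      unfolding moments RE SF
      using joint_rep_iso_if_equal_moments[OF R(1)[unfolded RE] S(1)[unfolded SF]] by blast
  qed
qed

text \<open>The choice is immaterial on joint representations: two maps induced by the same one have
  the same moments and agree by \<open>induced_eq_iff_moments\<close>.\<close>

definition induced_map :: "('e, 'a::cstar_algebra, 'b::cstar_algebra) joint_rep \<Rightarrow> ('a, 'a) free_product \<Rightarrow> 'b" where
  "induced_map R = (SOME \<phi>. induces R \<phi>)"

lemma induces_induced_map:
  assumes "R \<in> minimal_joint_reps \<phi>1 \<phi>2" shows "induces R (induced_map R)"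
proof -
  have "R \<in> joint_reps \<phi>1 \<phi>2" using assms minimal_subset_joint_reps by blast
  from someI_ex[OF induces_ex[OF this]] show ?thesis unfolding induced_map_def .
qed

text \<open>The module built from \<phi> consists of functions on the free product. Its transport S
  into the universe is isomorphic to it, and isomorphic representations induce the same map.\<close>

lemma coupling_in_universe:
  fixes \<phi> :: "('a::cstar_algebra, 'a) free_product \<Rightarrow> 'b::cstar_algebra"
  assumes "\<phi> \<in> couplings \<phi>1 \<phi>2"
  shows "\<exists>S \<in> (minimal_joint_reps \<phi>1 \<phi>2 :: (('a, 'b) module_universe, 'a, 'b) joint_rep set). induced_map S = \<phi>"
proof -
  obtain R :: "(('a, 'a) free_product \<Rightarrow> 'b, 'a, 'b) joint_rep"
    where R: "R \<in> minimal_joint_reps \<phi>1 \<phi>2" "induces R \<phi>"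
    using coupling_representation[OF assms] by blast
  obtain S :: "(('a, 'b) module_universe, 'a, 'b) joint_rep"
    where S: "S \<in> minimal_joint_reps \<phi>1 \<phi>2" "joint_rep_iso R S"
    using minimal_transport[OF R(1)] by blast
  show ?thesis
    using iso_iff_induced_eq[OF R S(1) induces_induced_map[OF S(1)]] S by blast
qed

theorem theorem4p2:
  fixes \<phi>1 \<phi>2 :: "'a::cstar_algebra \<Rightarrow> 'b::cstar_algebra"
  assumes "\<phi>1 \<in> UCP" and "\<phi>2 \<in> UCP"
  shows "(\<exists>\<Phi> :: (('a, 'b) module_universe, 'a, 'b) joint_rep set \<Rightarrow> ('a, 'a) free_product \<Rightarrow> 'b.
            bij_betw \<Phi> (minimal_joint_reps \<phi>1 \<phi>2 // iso_rel \<phi>1 \<phi>2) (couplings \<phi>1 \<phi>2) \<and>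
            (\<forall>R \<in> minimal_joint_reps \<phi>1 \<phi>2. induces R (\<Phi> (iso_rel \<phi>1 \<phi>2 `` {R})))) \<and>
         (\<forall>R \<in> (minimal_joint_reps \<phi>1 \<phi>2 :: ('e, 'a, 'b) joint_rep set).
            \<exists>S \<in> (minimal_joint_reps \<phi>1 \<phi>2 :: (('a, 'b) module_universe, 'a, 'b) joint_rep set).
              joint_rep_iso R S)"
proof (intro conjI ballI)
  let ?M = "minimal_joint_reps \<phi>1 \<phi>2 :: (('a, 'b) module_universe, 'a, 'b) joint_rep set"
  let ?f = "induced_map :: (('a, 'b) module_universe, 'a, 'b) joint_rep \<Rightarrow> _"
  define \<Phi> where "\<Phi> C = ?f (SOME R. R \<in> C)" for C
  \<comment> \<open>The isomorphism classes are the fibres of \<open>induced_map\<close>; this makes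
    \<Phi> independent of the chosen representative and injective.\<close>
  have cls: "iso_rel \<phi>1 \<phi>2 `` {R} = {S \<in> ?M. ?f S = ?f R}" if R: "R \<in> ?M" for R
  proof -
    have "joint_rep_iso R S \<longleftrightarrow> ?f S = ?f R" if S: "S \<in> ?M" for S
      using iso_iff_induced_eq[OF R induces_induced_map[OF R] S induces_induced_map[OF S]] by metis
    moreover have "iso_rel \<phi>1 \<phi>2 `` {R} = {S \<in> ?M. joint_rep_iso R S}"
      unfolding iso_rel_def using R by blast
    ultimately show ?thesis by blast
  qed
  have \<Phi>: "\<Phi> (iso_rel \<phi>1 \<phi>2 `` {R}) = ?f R" if R: "R \<in> ?M" for R
  proof -
    have "R \<in> iso_rel \<phi>1 \<phi>2 `` {R}" using R unfolding cls[OF R] by blast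
    from someI[of "\<lambda>S. S \<in> iso_rel \<phi>1 \<phi>2 `` {R}", OF this] show ?thesis unfolding \<Phi>_def using cls[OF R] by blast
  qed
  have "bij_betw \<Phi> (?M // iso_rel \<phi>1 \<phi>2) (couplings \<phi>1 \<phi>2)"
    unfolding bij_betw_def
  proof
    show "inj_on \<Phi> (?M // iso_rel \<phi>1 \<phi>2)"
    proof (rule inj_onI)
      fix C D assume "C \<in> ?M // iso_rel \<phi>1 \<phi>2" "D \<in> ?M // iso_rel \<phi>1 \<phi>2" "\<Phi> C = \<Phi> D"
      then obtain R S where R: "R \<in> ?M" "C = iso_rel \<phi>1 \<phi>2 `` {R}"
        and S: "S \<in> ?M" "D = iso_rel \<phi>1 \<phi>2 `` {S}" by (elim quotientE) blast
      then have "?f R = ?f S" using \<open>\<Phi> C = \<Phi> D\<close> by (simp only: \<Phi>)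
      then show "C = D" unfolding R(2) S(2) by (simp only: cls R(1) S(1))
    qed
    have "\<Phi> ` (?M // iso_rel \<phi>1 \<phi>2) = ?f ` ?M"
    proof -
      have "?M // iso_rel \<phi>1 \<phi>2 = (\<lambda>R. iso_rel \<phi>1 \<phi>2 `` {R}) ` ?M"
        unfolding quotient_def by blast
      then show ?thesis by (simp only: image_image \<Phi> cong: image_cong)
    qed
    moreover have "?f ` ?M \<subseteq> couplings \<phi>1 \<phi>2"
    proof (rule image_subsetI)
      fix R assume R: "R \<in> ?M"
      obtain E \<sigma>1 \<sigma>2 x where RE: "R = (E, \<sigma>1, \<sigma>2, x)" by (cases R)
      show "?f R \<in> couplings \<phi>1 \<phi>2"
        unfolding RE
        by (rule induces_moments(1)[OF subsetD[OF minimal_subset_joint_reps R, unfolded RE]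
              induces_induced_map[OF R, unfolded RE]])
    qed
    moreover have "couplings \<phi>1 \<phi>2 \<subseteq> ?f ` ?M"
    proof
      fix \<phi> assume "\<phi> \<in> couplings \<phi>1 \<phi>2"
      then show "\<phi> \<in> ?f ` ?M" using coupling_in_universe[of \<phi> \<phi>1 \<phi>2] by blast
    qed
    ultimately show "\<Phi> ` (?M // iso_rel \<phi>1 \<phi>2) = couplings \<phi>1 \<phi>2" by (simp only: subset_antisym)
  qed
  moreover have "induces R (\<Phi> (iso_rel \<phi>1 \<phi>2 `` {R}))" if "R \<in> ?M" for R
    unfolding \<Phi>[OF that] by (rule induces_induced_map[OF that])
  ultimately show "\<exists>\<Phi>. bij_betw \<Phi> (?M // iso_rel \<phi>1 \<phi>2) (couplings \<phi>1 \<phi>2) \<and>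
      (\<forall>R \<in> ?M. induces R (\<Phi> (iso_rel \<phi>1 \<phi>2 `` {R})))" by blast
next
  fix R :: "('e, 'a, 'b) joint_rep" assume "R \<in> minimal_joint_reps \<phi>1 \<phi>2"
  then show "\<exists>S \<in> (minimal_joint_reps \<phi>1 \<phi>2 :: (('a, 'b) module_universe, 'a, 'b) joint_rep set).
      joint_rep_iso R S" by (rule minimal_transport)
qed

end
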